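(* Let $w=w_{5}$ be the Atkin-Lehner involution of $X_0(45)$ attached to $5$. There exist $x,y,t\in\mathbb{Q}(X_0(45))$ such that $\mathbb{Q}(X_0(45))=\mathbb{Q}(x,y,t)$, the subfield of functions invariant under $w^*$ is $\mathbb{Q}(x,y)$, $w^*(t)=-t$, and $$y^2+xy=x^3-x^2-5,\qquad t^2=x^2(-3+6x+x^2+4y).$$ In particular these two equations are equations for $X_0(45)$ over $\mathbb{Q}$ (up to birational equivalence over $\mathbb{Q}$).
   Context: $X_0(N)$ denotes the smooth projective curve over $\mathbb{Q}$ attached to $\Gamma_0(N)$, where $\mathbb{Q}(X_0(N))$ is the subfield of $\mathbb{C}(X_0(N))$ of functions with rational $q$-expansion at the cusp $\infty$, $q=e^{2\pi i z}$. For a positive divisor $d$ of $N$ coprime to $N/d$, the Atkin-Lehner involution $w_d$ of $X_0(N)$ is induced by any matrix $\frac{1}{\sqrt d}\begin{pmatrix} A d & B\\ N C & D d\end{pmatrix}$ of determinant $1$ with $A,B,C,D\in\mathbb{Z}$; it is defined over $\mathbb{Q}$. *)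

theory Defs
  imports "HOL-Complex_Analysis.Complex_Analysis"
begin

definition uhp :: "complex set" where
  "uhp = {z. Im z > 0}"

lemma uhp_iff: "z \<in> uhp \<longleftrightarrow> Im z > 0"
  by (simp add: uhp_def)

lemma open_uhp [simp, intro]: "open uhp"
  by (simp add: uhp_def open_halfspace_Im_gt)

lemma connected_uhp [simp, intro]: "connected uhp"
  unfolding uhp_def by (intro convex_connected convex_halfspace_Im_gt)

lemma uhp_nonempty: "\<i> \<in> uhp"
  by (simp add: uhp_def)

text \<open>
  A meromorphic function on the upper half plane is represented by its values: it has no
  removable singularities, and it takes the value 0 at its poles and outside the upper half
  plane. With this normalisation equality of meromorphic functions is equality of functions,
  but the field operations are pointwise only off a discrete set.
\<close>

typedef mero_uhp =
  "{f :: complex \<Rightarrow> complex. f nicely_meromorphic_on uhp \<and> (\<forall>z. z \<notin> uhp \<longrightarrow> f z = 0)}"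
  morphisms eval_uhp Abs_mero_uhp
  by (rule exI[of _ "\<lambda>_. 0"]) auto

definition mero_of :: "(complex \<Rightarrow> complex) \<Rightarrow> mero_uhp" where
  "mero_of f = Abs_mero_uhp (\<lambda>z. if z \<in> uhp then remove_sings f z else 0)"

lemma eval_uhp_nicely_meromorphic: "eval_uhp f nicely_meromorphic_on uhp"
  using eval_uhp[of f] by auto

lemma eval_uhp_meromorphic: "eval_uhp f meromorphic_on uhp"
  using eval_uhp_nicely_meromorphic[of f] by (simp add: nicely_meromorphic_on_def)

lemma eval_uhp_outside: "z \<notin> uhp \<Longrightarrow> eval_uhp f z = 0"
  using eval_uhp[of f] by auto

lemma nicely_meromorphic_on_cong_open:
  assumes "f nicely_meromorphic_on A" "open A" "\<And>z. z \<in> A \<Longrightarrow> f z = g z"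
  shows "g nicely_meromorphic_on A"
proof -
  have ev: "\<forall>\<^sub>F w in at z. f w = g w" if "z \<in> A" for z
    using eventually_at_in_open'[OF assms(2) that] by eventually_elim (use assms(3) in auto)
  have "g meromorphic_on A"
  proof -
    have "(f meromorphic_on A) = (g meromorphic_on A)"
      by (rule meromorphic_on_cong) (use ev in auto)
    thus ?thesis using assms(1) by (simp add: nicely_meromorphic_on_def)
  qed
  moreover have "is_pole g z \<and> g z = 0 \<or> g \<midarrow>z\<rightarrow> g z" if z: "z \<in> A" for z
  proof -
    have "is_pole f z = is_pole g z"
      by (rule is_pole_cong[OF ev[OF z] refl])
    moreover have "(f \<midarrow>z\<rightarrow> f z) = (g \<midarrow>z\<rightarrow> f z)"
      by (rule tendsto_cong[OF ev[OF z]])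
    ultimately show ?thesis
      using assms(1) assms(3)[OF z] z unfolding nicely_meromorphic_on_def by auto
  qed
  ultimately show ?thesis
    unfolding nicely_meromorphic_on_def by blast
qed

lemma eval_mero_of:
  assumes "f meromorphic_on uhp"
  shows "eval_uhp (mero_of f) = (\<lambda>z. if z \<in> uhp then remove_sings f z else 0)"
proof -
  have "(\<lambda>z. if z \<in> uhp then remove_sings f z else 0) nicely_meromorphic_on uhp"
    by (rule nicely_meromorphic_on_cong_open[OF remove_sings_nicely_meromorphic[OF assms]]) auto
  thus ?thesis
    unfolding mero_of_def by (subst Abs_mero_uhp_inverse) auto
qed

lemma eventually_in_uhp: "\<forall>\<^sub>\<approx>z\<in>uhp. z \<in> uhp"
  by (rule eventually_in_cosparse) auto

lemma eval_mero_of_cosparse: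
  assumes "f meromorphic_on uhp"
  shows "\<forall>\<^sub>\<approx>z\<in>uhp. eval_uhp (mero_of f) z = f z"
  using eventually_remove_sings_eq[OF assms] eventually_in_uhp
  by eventually_elim (simp add: eval_mero_of[OF assms])

lemma remove_sings_nicely:
  assumes "f nicely_meromorphic_on A" "z \<in> A"
  shows "remove_sings f z = f z"
  using assms unfolding nicely_meromorphic_on_def by (metis remove_sings_at_pole remove_sings_eqI)

lemma eval_mero_of_nicely:
  assumes "f nicely_meromorphic_on uhp" "z \<in> uhp"
  shows "eval_uhp (mero_of f) z = f z"
  using eval_mero_of[of f] remove_sings_nicely[OF assms] assms
  by (simp add: nicely_meromorphic_on_def)

lemma mero_uhp_eqI:
  assumes "\<forall>\<^sub>\<approx>z\<in>uhp. eval_uhp f z = eval_uhp g z"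
  shows "f = g"
proof -
  have "eval_uhp f z = eval_uhp g z" for z
  proof (cases "z \<in> uhp")
    case True
    have "remove_sings (eval_uhp f) z = remove_sings (eval_uhp g) z"
      by (rule remove_sings_cong) (use assms True in \<open>auto simp: eventually_cosparse_open_eq\<close>)
    thus ?thesis
      using True by (simp add: remove_sings_nicely[OF eval_uhp_nicely_meromorphic])
  qed (simp add: eval_uhp_outside)
  thus ?thesis
    by (simp add: eval_uhp_inject[symmetric] fun_eq_iff)
qed

instantiation mero_uhp :: field
begin

definition zero_mero_uhp :: mero_uhp where "0 = mero_of (\<lambda>_. 0)"
definition one_mero_uhp :: mero_uhp where "1 = mero_of (\<lambda>_. 1)"
definition plus_mero_uhp :: "mero_uhp \<Rightarrow> mero_uhp \<Rightarrow> mero_uhp" where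
  "f + g = mero_of (\<lambda>z. eval_uhp f z + eval_uhp g z)"
definition minus_mero_uhp :: "mero_uhp \<Rightarrow> mero_uhp \<Rightarrow> mero_uhp" where
  "f - g = mero_of (\<lambda>z. eval_uhp f z - eval_uhp g z)"
definition uminus_mero_uhp :: "mero_uhp \<Rightarrow> mero_uhp" where
  "- f = mero_of (\<lambda>z. - eval_uhp f z)"
definition times_mero_uhp :: "mero_uhp \<Rightarrow> mero_uhp \<Rightarrow> mero_uhp" where
  "f * g = mero_of (\<lambda>z. eval_uhp f z * eval_uhp g z)"
definition inverse_mero_uhp :: "mero_uhp \<Rightarrow> mero_uhp" where
  "inverse f = mero_of (\<lambda>z. inverse (eval_uhp f z))"
definition divide_mero_uhp :: "mero_uhp \<Rightarrow> mero_uhp \<Rightarrow> mero_uhp" where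
  "f div g = mero_of (\<lambda>z. eval_uhp f z / eval_uhp g z)"

lemma eval_zero_cosparse: "\<forall>\<^sub>\<approx>z\<in>uhp. eval_uhp 0 z = 0"
  unfolding zero_mero_uhp_def by (rule eval_mero_of_cosparse) auto
lemma eval_one_cosparse: "\<forall>\<^sub>\<approx>z\<in>uhp. eval_uhp 1 z = 1"
  unfolding one_mero_uhp_def by (rule eval_mero_of_cosparse) auto
lemma eval_plus_cosparse: "\<forall>\<^sub>\<approx>z\<in>uhp. eval_uhp (f + g) z = eval_uhp f z + eval_uhp g z"
  unfolding plus_mero_uhp_def
  by (rule eval_mero_of_cosparse) (intro meromorphic_intros eval_uhp_meromorphic)
lemma eval_minus_cosparse: "\<forall>\<^sub>\<approx>z\<in>uhp. eval_uhp (f - g) z = eval_uhp f z - eval_uhp g z"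
  unfolding minus_mero_uhp_def
  by (rule eval_mero_of_cosparse) (intro meromorphic_intros eval_uhp_meromorphic)
lemma eval_uminus_cosparse: "\<forall>\<^sub>\<approx>z\<in>uhp. eval_uhp (- f) z = - eval_uhp f z"
  unfolding uminus_mero_uhp_def
  by (rule eval_mero_of_cosparse) (intro meromorphic_intros eval_uhp_meromorphic)
lemma eval_times_cosparse: "\<forall>\<^sub>\<approx>z\<in>uhp. eval_uhp (f * g) z = eval_uhp f z * eval_uhp g z"
  unfolding times_mero_uhp_def
  by (rule eval_mero_of_cosparse) (intro meromorphic_intros eval_uhp_meromorphic)
lemma eval_inverse_cosparse: "\<forall>\<^sub>\<approx>z\<in>uhp. eval_uhp (inverse f) z = inverse (eval_uhp f z)"
  unfolding inverse_mero_uhp_def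
  by (rule eval_mero_of_cosparse) (intro meromorphic_intros eval_uhp_meromorphic)
lemma eval_divide_cosparse: "\<forall>\<^sub>\<approx>z\<in>uhp. eval_uhp (f div g) z = eval_uhp f z / eval_uhp g z"
  unfolding divide_mero_uhp_def
  by (rule eval_mero_of_cosparse) (intro meromorphic_intros eval_uhp_meromorphic)

instance
proof
  fix a b c :: mero_uhp
  show "a * b * c = a * (b * c)"
    by (rule mero_uhp_eqI)
       (use eval_times_cosparse[of "a * b" c] eval_times_cosparse[of a b]
            eval_times_cosparse[of a "b * c"] eval_times_cosparse[of b c] in
         \<open>eventually_elim, simp\<close>)
  show "a * b = b * a"
    by (rule mero_uhp_eqI)
       (use eval_times_cosparse[of a b] eval_times_cosparse[of b a] in \<open>eventually_elim, simp\<close>)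
  show "1 * a = a"
    by (rule mero_uhp_eqI)
       (use eval_times_cosparse[of 1 a] eval_one_cosparse in \<open>eventually_elim, simp\<close>)
  show "a + b + c = a + (b + c)"
    by (rule mero_uhp_eqI)
       (use eval_plus_cosparse[of "a + b" c] eval_plus_cosparse[of a b]
            eval_plus_cosparse[of a "b + c"] eval_plus_cosparse[of b c] in
         \<open>eventually_elim, simp\<close>)
  show "a + b = b + a"
    by (rule mero_uhp_eqI)
       (use eval_plus_cosparse[of a b] eval_plus_cosparse[of b a] in \<open>eventually_elim, simp\<close>)
  show "0 + a = a"
    by (rule mero_uhp_eqI)
       (use eval_plus_cosparse[of 0 a] eval_zero_cosparse in \<open>eventually_elim, simp\<close>)
  show "- a + a = 0"
    by (rule mero_uhp_eqI)
       (use eval_plus_cosparse[of "- a" a] eval_uminus_cosparse[of a] eval_zero_cosparse in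
         \<open>eventually_elim, simp\<close>)
  show "a - b = a + - b"
    by (rule mero_uhp_eqI)
       (use eval_plus_cosparse[of a "- b"] eval_uminus_cosparse[of b] eval_minus_cosparse[of a b] in
         \<open>eventually_elim, simp\<close>)
  show "(a + b) * c = a * c + b * c"
    by (rule mero_uhp_eqI)
       (use eval_times_cosparse[of "a + b" c] eval_plus_cosparse[of a b]
            eval_plus_cosparse[of "a * c" "b * c"] eval_times_cosparse[of a c]
            eval_times_cosparse[of b c] in
         \<open>eventually_elim, simp add: algebra_simps\<close>)
  show "a div b = a * inverse b"
    by (rule mero_uhp_eqI)
       (use eval_divide_cosparse[of a b] eval_times_cosparse[of a "inverse b"]
            eval_inverse_cosparse[of b] in
         \<open>eventually_elim, simp add: divide_inverse\<close>)
  show "inverse (0 :: mero_uhp) = 0"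
    by (rule mero_uhp_eqI)
       (use eval_inverse_cosparse[of 0] eval_zero_cosparse in \<open>eventually_elim, simp\<close>)
  show "(0 :: mero_uhp) \<noteq> 1"
  proof
    assume "(0 :: mero_uhp) = 1"
    hence "\<forall>\<^sub>\<approx>z\<in>uhp. (0 :: complex) = 1"
      using eval_zero_cosparse eval_one_cosparse by (auto elim: eventually_elim2)
    hence "uhp = {}"
      by (simp add: trivial_limit_def[symmetric])
    thus False
      using uhp_nonempty by auto
  qed
  show "inverse a * a = 1" if "a \<noteq> 0"
  proof -
    have "\<not> (\<forall>\<^sub>\<approx>z\<in>uhp. eval_uhp a z = 0)"
    proof
      assume "\<forall>\<^sub>\<approx>z\<in>uhp. eval_uhp a z = 0"
      hence "\<forall>\<^sub>\<approx>z\<in>uhp. eval_uhp a z = eval_uhp 0 z"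
        using eval_zero_cosparse by eventually_elim simp
      hence "a = 0"
        by (rule mero_uhp_eqI)
      with that show False by contradiction
    qed
    hence "\<forall>\<^sub>\<approx>z\<in>uhp. eval_uhp a z \<noteq> 0"
      using meromorphic_imp_constant_or_avoid[OF eval_uhp_meromorphic[of a] open_uhp connected_uhp]
      by blast
    hence "\<forall>\<^sub>\<approx>z\<in>uhp. eval_uhp (inverse a * a) z = eval_uhp 1 z"
      using eval_times_cosparse[of "inverse a" a] eval_inverse_cosparse[of a] eval_one_cosparse
      by eventually_elim simp
    thus ?thesis
      by (rule mero_uhp_eqI)
  qed
qed

end

lemma eval_of_nat_cosparse: "\<forall>\<^sub>\<approx>z\<in>uhp. eval_uhp (of_nat n) z = of_nat n"
proof (induction n)
  case 0
  show ?case using eval_zero_cosparse by simp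
next
  case (Suc n)
  show ?case
    using Suc eval_plus_cosparse[of 1 "of_nat n"] eval_one_cosparse by eventually_elim simp
qed

lemma of_nat_mero_uhp_eqD:
  assumes "(of_nat m :: mero_uhp) = of_nat n"
  shows "m = n"
proof (rule ccontr)
  assume neq: "m \<noteq> n"
  have "\<forall>\<^sub>\<approx>z\<in>uhp. eval_uhp (of_nat m) z = of_nat n"
    unfolding assms by (rule eval_of_nat_cosparse)
  hence "\<forall>\<^sub>\<approx>z\<in>uhp. False"
    using eval_of_nat_cosparse[of m]
    by (rule eventually_elim2) (use neq in auto)
  hence "uhp = {}"
    by (simp add: trivial_limit_def[symmetric])
  thus False
    using uhp_nonempty by auto
qed

instance mero_uhp :: field_char_0
  by standard (rule injI, rule of_nat_mero_uhp_eqD)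


definition moebius_map :: "int \<Rightarrow> int \<Rightarrow> int \<Rightarrow> int \<Rightarrow> complex \<Rightarrow> complex" where
  "moebius_map a b c d z = (of_int a * z + of_int b) / (of_int c * z + of_int d)"

definition pullback :: "int \<Rightarrow> int \<Rightarrow> int \<Rightarrow> int \<Rightarrow> mero_uhp \<Rightarrow> mero_uhp" where
  "pullback a b c d f = mero_of (\<lambda>z. eval_uhp f (moebius_map a b c d z))"

lemma moebius_denom_nonzero:
  assumes "a * d - b * c > 0" "z \<in> uhp"
  shows "of_int c * z + of_int d \<noteq> (0 :: complex)"
proof
  assume eq: "of_int c * z + of_int d = (0 :: complex)"
  hence "Im (of_int c * z + of_int d) = 0" by simp
  hence "c = 0" using assms(2) by (simp add: uhp_def)
  with eq have "d = 0" by simp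
  with \<open>c = 0\<close> assms(1) show False by simp
qed

lemma moebius_in_uhp:
  assumes "a * d - b * c > 0" "z \<in> uhp"
  shows "moebius_map a b c d z \<in> uhp"
proof -
  define w where "w = of_int c * z + of_int d"
  have "w \<noteq> 0"
    using moebius_denom_nonzero[OF assms] by (simp add: w_def)
  hence pos: "(Re w)\<^sup>2 + (Im w)\<^sup>2 > 0"
    by (simp add: complex_neq_0[symmetric])
  have "Im (moebius_map a b c d z) = real_of_int (a * d - b * c) * Im z / ((Re w)\<^sup>2 + (Im w)\<^sup>2)"
    unfolding moebius_map_def w_def[symmetric] Im_divide
    by (simp add: w_def algebra_simps)
  also have "\<dots> > 0"
    using assms pos by (intro divide_pos_pos mult_pos_pos) (auto simp: uhp_def simp del: of_int_diff of_int_mult)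
  finally show ?thesis by (simp add: uhp_def)
qed

lemma moebius_compose:
  assumes "a' * d' - b' * c' > 0" "z \<in> uhp"
  shows "moebius_map a b c d (moebius_map a' b' c' d' z) =
           moebius_map (a * a' + b * c') (a * b' + b * d') (c * a' + d * c') (c * b' + d * d') z"
proof -
  define w where "w = of_int c' * z + of_int d'"
  define u where "u = of_int a' * z + of_int b'"
  have w: "w \<noteq> 0"
    using moebius_denom_nonzero[OF assms] by (simp add: w_def)
  have *: "p * (u / w) + q = (p * u + q * w) / w" for p q :: complex
    using w by (simp add: field_simps)
  have "moebius_map a b c d (moebius_map a' b' c' d' z) =
          (of_int a * u + of_int b * w) / (of_int c * u + of_int d * w)"
    unfolding moebius_map_def w_def[symmetric] u_def[symmetric] * using w by simp
  also have "\<dots> = moebius_map (a * a' + b * c') (a * b' + b * d') (c * a' + d * c') (c * b' + d * d') z"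
    unfolding moebius_map_def w_def u_def by (simp add: algebra_simps)
  finally show ?thesis .
qed

lemma moebius_inverse:
  assumes "a * d - b * c > 0" "z \<in> uhp"
  shows "moebius_map d (-b) (-c) a (moebius_map a b c d z) = z"
proof -
  define e where "e = a * d - b * c"
  have "of_int e \<noteq> (0 :: complex)"
    using assms(1) unfolding e_def by (simp only: of_int_eq_0_iff)
  hence "moebius_map e 0 0 e z = z"
    by (simp add: moebius_map_def)
  moreover have "d * a + - b * c = e" "d * b + - b * d = 0" "- c * a + a * c = 0"
      "- c * b + a * d = e"
    by (simp_all add: e_def algebra_simps)
  ultimately show ?thesis
    using moebius_compose[OF assms, of d "-b" "-c" a] by simp
qed

lemma moebius_analytic:
  assumes "a * d - b * c > 0"
  shows "moebius_map a b c d analytic_on uhp"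
  unfolding moebius_map_def[abs_def] using moebius_denom_nonzero[OF assms]
  by (intro analytic_intros) auto

lemma nicely_meromorphic_moebius:
  assumes det: "a * d - b * c > 0"
  shows "(\<lambda>z. eval_uhp f (moebius_map a b c d z)) nicely_meromorphic_on uhp"
  unfolding nicely_meromorphic_on_def
proof (intro conjI ballI)
  let ?g = "moebius_map a b c d"
  show "(\<lambda>z. eval_uhp f (?g z)) meromorphic_on uhp"
    by (rule meromorphic_on_compose[OF eval_uhp_meromorphic moebius_analytic[OF det]])
       (use moebius_in_uhp[OF det] in auto)
  fix z assume z: "z \<in> uhp"
  have gz: "?g z \<in> uhp"
    by (rule moebius_in_uhp[OF det z])
  have "?g analytic_on {z}"
    using moebius_analytic[OF det] z analytic_on_analytic_at by blast
  hence "?g \<midarrow>z\<rightarrow> ?g z"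
    by (intro isContD analytic_at_imp_isCont)
  moreover have "\<forall>\<^sub>F w in at z. ?g w \<noteq> ?g z"
    using eventually_at_in_open[OF open_uhp z]
    by eventually_elim (metis DiffE det insertI1 moebius_inverse z)
  ultimately have lim: "filterlim ?g (at (?g z)) (at z)"
    by (simp add: filterlim_at)
  have "is_pole (eval_uhp f) (?g z) \<and> eval_uhp f (?g z) = 0 \<or>
          eval_uhp f \<midarrow>?g z\<rightarrow> eval_uhp f (?g z)"
    using eval_uhp_nicely_meromorphic[of f] gz by (simp add: nicely_meromorphic_on_def)
  thus "is_pole (\<lambda>z. eval_uhp f (?g z)) z \<and> eval_uhp f (?g z) = 0 \<or>
          (\<lambda>z. eval_uhp f (?g z)) \<midarrow>z\<rightarrow> eval_uhp f (?g z)"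
    unfolding is_pole_def using filterlim_compose[OF _ lim] by blast
qed

lemma eval_pullback:
  assumes "a * d - b * c > 0" "z \<in> uhp"
  shows "eval_uhp (pullback a b c d f) z = eval_uhp f (moebius_map a b c d z)"
  unfolding pullback_def
  by (rule eval_mero_of_nicely[OF nicely_meromorphic_moebius[OF assms(1)] assms(2)])

lemma pullback_pullback:
  assumes "a * d - b * c > 0" "a' * d' - b' * c' > 0"
  shows "pullback a' b' c' d' (pullback a b c d f) =
           pullback (a * a' + b * c') (a * b' + b * d') (c * a' + d * c') (c * b' + d * d') f"
    (is "?l = ?r")
proof (rule mero_uhp_eqI)
  have "(a * a' + b * c') * (c * b' + d * d') - (a * b' + b * d') * (c * a' + d * c') =
          (a * d - b * c) * (a' * d' - b' * c')"
    by (simp add: algebra_simps)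
  hence det: "(a * a' + b * c') * (c * b' + d * d') - (a * b' + b * d') * (c * a' + d * c') > 0"
    using assms by simp
  show "\<forall>\<^sub>\<approx>z\<in>uhp. eval_uhp ?l z = eval_uhp ?r z"
    using eventually_in_uhp
    by eventually_elim
       (simp add: eval_pullback[OF assms(2)] eval_pullback[OF assms(1)] eval_pullback[OF det]
          moebius_in_uhp[OF assms(2)] moebius_compose[OF assms(2)])
qed


text \<open>
  \<open>F\<close> is the expansion of \<open>f\<close> at the cusp \<open>\<infinity>\<close> in the local parameter \<open>exp (2 \<pi> \<i> z / h)\<close>.
\<close>
definition has_q_expansion :: "nat \<Rightarrow> mero_uhp \<Rightarrow> complex fls \<Rightarrow> bool" where
  "has_q_expansion h f F \<longleftrightarrow>
     (\<exists>g. g has_laurent_expansion F \<and>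
          (\<forall>\<^sub>F z in filtercomap Im at_top.
             eval_uhp f z = g (exp (2 * of_real pi * \<i> * z / of_nat h))))"

text \<open>
  Meromorphic functions on the compact Riemann surface $X_0(N)(\mathbb{C})$ are the
  \<open>\<Gamma>\<^sub>0(N)\<close>-invariant meromorphic functions on the upper half plane that are meromorphic at all
  cusps. The cusp \<open>\<gamma> \<infinity>\<close>, \<open>\<gamma> \<in> SL\<^sub>2(\<int>)\<close>, is moved to \<open>\<infinity>\<close> by pulling back along \<open>\<gamma>\<close>; its width
  divides \<open>N\<close>, so the parameter \<open>exp (2 \<pi> \<i> z / N)\<close> may be used at every cusp.
\<close>
definition X0_functions_complex :: "nat \<Rightarrow> mero_uhp set" where
  "X0_functions_complex N =
     {f. (\<forall>a b c d. a * d - b * c = 1 \<and> int N dvd c \<longrightarrow> pullback a b c d f = f) \<and>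
         (\<forall>a b c d. a * d - b * c = 1 \<longrightarrow> (\<exists>F. has_q_expansion N (pullback a b c d f) F))}"

definition X0_functions_rat :: "nat \<Rightarrow> mero_uhp set" where
  "X0_functions_rat N =
     {f \<in> X0_functions_complex N. \<exists>F. has_q_expansion 1 f F \<and> (\<forall>n. fls_nth F n \<in> \<rat>)}"


text \<open>
  The integral matrix with rows \<open>(A d, B)\<close> and \<open>(N C, D d)\<close> has determinant \<open>d\<close>; dividing it by
  \<open>sqrt d\<close> makes the determinant 1 and does not change the Moebius transformation.
  By \<open>atkin_lehner_eq\<close> below, the choice of the matrix does not matter for functions on $X_0(N)$.
\<close>
definition atkin_lehner_matrix :: "nat \<Rightarrow> nat \<Rightarrow> int \<times> int \<times> int \<times> int \<Rightarrow> bool" where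
  "atkin_lehner_matrix N d = (\<lambda>(A, B, C, D).
     (A * int d) * (D * int d) - B * (int N * C) = int d)"

definition atkin_lehner :: "nat \<Rightarrow> nat \<Rightarrow> mero_uhp \<Rightarrow> mero_uhp" where
  "atkin_lehner N d f =
     (case SOME M. atkin_lehner_matrix N d M of
        (A, B, C, D) \<Rightarrow> pullback (A * int d) B (int N * C) (D * int d) f)"

lemma atkin_lehner_matrix_exists:
  assumes "d dvd N" "coprime d (N div d)" "d > 0"
  shows "\<exists>M. atkin_lehner_matrix N d M"
proof -
  obtain m where m: "N = d * m" using assms(1) by auto
  have "coprime (int d) (int m)"
    using assms(2,3) m by simp
  then obtain u v where uv: "u * int d + v * int m = 1"
    by (metis bezout_int coprime_iff_gcd_eq_1)
  have "(u * int d) * (1 * int d) - (- v) * (int N * 1) = int d * (u * int d + v * int m)"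
    by (simp add: m algebra_simps)
  hence "atkin_lehner_matrix N d (u, - v, 1, 1)"
    by (simp add: atkin_lehner_matrix_def uv)
  thus ?thesis ..
qed

lemma atkin_lehner_eq:
  assumes "d dvd N" "d > 0" and f: "f \<in> X0_functions_complex N"
    and M: "atkin_lehner_matrix N d (A, B, C, D)"
  shows "atkin_lehner N d f = pullback (A * int d) B (int N * C) (D * int d) f"
proof -
  obtain A' B' C' D' where M': "(SOME M. atkin_lehner_matrix N d M) = (A', B', C', D')"
    by (metis prod_cases4)
  have "atkin_lehner_matrix N d (A', B', C', D')"
    using someI[of "atkin_lehner_matrix N d", OF M] M' by simp
  obtain m where m: "N = d * m" using assms(1) by auto
  let ?d = "int d" and ?m = "int m"
  have 1: "A * D * ?d - B * ?m * C = 1"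
  proof -
    have "?d * (A * D * ?d - B * ?m * C) = ?d * 1"
      using M by (simp add: atkin_lehner_matrix_def m algebra_simps)
    thus ?thesis using assms(2) by simp
  qed
  have 2: "A' * D' * ?d - B' * ?m * C' = 1"
  proof -
    have "?d * (A' * D' * ?d - B' * ?m * C') = ?d * 1"
      using \<open>atkin_lehner_matrix N d (A', B', C', D')\<close>
      by (simp add: atkin_lehner_matrix_def m algebra_simps)
    thus ?thesis using assms(2) by simp
  qed
  have det: "(A * ?d) * (D * ?d) - B * (int N * C) > 0"
    using M assms(2) by (simp add: atkin_lehner_matrix_def)
  define a b c e where "a = A' * D * ?d - B' * ?m * C" and "b = B' * A - A' * B"
    and "c = int N * (C' * D - D' * C)" and "e = D' * A * ?d - C' * ?m * B"
  have "a * e - b * c = (A * D * ?d - B * ?m * C) * (A' * D' * ?d - B' * ?m * C')"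
    unfolding a_def b_def c_def e_def m by (simp add: algebra_simps)
  hence det1: "a * e - b * c = 1"
    by (simp add: 1 2)
  have "pullback a b c e f = f"
    using f det1 by (auto simp: X0_functions_complex_def c_def)
  hence "pullback (A * ?d) B (int N * C) (D * ?d) f =
           pullback (A * ?d) B (int N * C) (D * ?d) (pullback a b c e f)"
    by simp
  also have "\<dots> = pullback (a * (A * ?d) + b * (int N * C)) (a * B + b * (D * ?d))
                     (c * (A * ?d) + e * (int N * C)) (c * B + e * (D * ?d)) f"
    by (rule pullback_pullback) (use det det1 in auto)
  also have "a * (A * ?d) + b * (int N * C) = A' * ?d * (A * D * ?d - B * ?m * C)"
    unfolding a_def b_def m by (simp add: algebra_simps)
  also have "a * B + b * (D * ?d) = B' * (A * D * ?d - B * ?m * C)"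
    unfolding a_def b_def m by (simp add: algebra_simps)
  also have "c * (A * ?d) + e * (int N * C) = int N * C' * (A * D * ?d - B * ?m * C)"
    unfolding c_def e_def m by (simp add: algebra_simps)
  also have "c * B + e * (D * ?d) = D' * ?d * (A * D * ?d - B * ?m * C)"
    unfolding c_def e_def m by (simp add: algebra_simps)
  finally show ?thesis
    by (simp add: atkin_lehner_def M' 1)
qed


inductive_set rat_adjoin :: "'a :: field_char_0 set \<Rightarrow> 'a set" for S where
  rat: "of_rat r \<in> rat_adjoin S"
| base: "s \<in> S \<Longrightarrow> s \<in> rat_adjoin S"
| add: "u \<in> rat_adjoin S \<Longrightarrow> v \<in> rat_adjoin S \<Longrightarrow> u + v \<in> rat_adjoin S"
| mult: "u \<in> rat_adjoin S \<Longrightarrow> v \<in> rat_adjoin S \<Longrightarrow> u * v \<in> rat_adjoin S"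
| uminus: "u \<in> rat_adjoin S \<Longrightarrow> - u \<in> rat_adjoin S"
| inverse: "u \<in> rat_adjoin S \<Longrightarrow> inverse u \<in> rat_adjoin S"

text \<open>The ring $\mathbb{Q}[X,Y,T]$ is represented as $\mathbb{Q}[X][Y][T]$.\<close>
type_synonym rat_poly3 = "rat poly poly poly"

definition polyX :: rat_poly3 where "polyX = [:[:[:0, 1:]:]:]"
definition polyY :: rat_poly3 where "polyY = [:[:0, 1:]:]"
definition polyT :: rat_poly3 where "polyT = [:0, 1:]"

definition eval_poly3 :: "rat_poly3 \<Rightarrow> 'a :: field_char_0 \<Rightarrow> 'a \<Rightarrow> 'a \<Rightarrow> 'a" where
  "eval_poly3 P x y t =
     poly (map_poly (\<lambda>p. poly (map_poly (\<lambda>r. poly (map_poly of_rat r) x) p) y) P) t"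

text \<open>
  The affine scheme \<open>F = G = 0\<close> over $\mathbb{Q}$ is integral with generic point \<open>(x, y, t)\<close> and
  function field \<open>K\<close>: evaluation at \<open>(x, y, t)\<close> is injective on $\mathbb{Q}[X,Y,T]/(F,G)$, and \<open>K\<close>
  is the field of fractions of its image. If \<open>K\<close> is the function field of a curve over
  $\mathbb{Q}$, then \<open>x, y, t\<close> define a birational map over $\mathbb{Q}$ from it to the curve
  \<open>F = G = 0\<close>.
\<close>
definition birational_equations ::
    "'a :: field_char_0 set \<Rightarrow> 'a \<times> 'a \<times> 'a \<Rightarrow> rat_poly3 \<Rightarrow> rat_poly3 \<Rightarrow> bool" where
  "birational_equations K = (\<lambda>(x, y, t) F G.
     K = rat_adjoin {x, y, t} \<and>
     (\<forall>P. eval_poly3 P x y t = 0 \<longleftrightarrow> (\<exists>U V. P = U * F + V * G)))"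

end

theory Submission
  imports Defs
begin

text \<open>
  Put \<open>h = (\<eta>(z) / \<eta>(9z))\<^sup>3\<close>, \<open>k = (\<eta>(5z) / \<eta>(45z))\<^sup>3\<close> and \<open>p = \<eta>(z) \<eta>(5z) / (\<eta>(9z) \<eta>(45z))\<close>, so
  that \<open>p\<^sup>3 = h k\<close>. They are products of quotients of Klein forms of level 3. By the inversion formula of
  the theta function, \<open>SL\<^sub>2(\<int>)\<close> acts on the indices of the Klein forms, up to a factor common to all
  of them; hence \<open>h, k, p\<close> are functions on \<open>X\<^sub>0(45)\<close>, holomorphic on the upper half
  plane, and \<open>w\<^sub>5\<close> exchanges \<open>h\<close> and \<open>k\<close> and fixes \<open>p\<close>. The functions \<open>p\<close> and \<open>S = h + k\<close> have poles
  of order 2 and 5 at the cusp \<open>\<infinity>\<close> and no others modulo \<open>w\<^sub>5\<close>, so by Liouville's theorem a polynomial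
  relation between them need only be checked on the first 11 coefficients of the \<open>q\<close>-expansion.

  The poles of any \<open>w\<^sub>5\<close>-invariant function outside \<open>\<infinity>\<close> are cleared by a polynomial in \<open>p\<close>, and
  counting coefficients of principal parts at \<open>\<infinity>\<close> then shows that the function is rational in \<open>p\<close> and
  \<open>S\<close>. With \<open>T = h - k\<close>, which is anti-invariant, every function is \<open>u + T v\<close> with \<open>u, v\<close> rational in
  \<open>p\<close> and \<open>S\<close>. A \<open>\<rat>\<close>-linear map \<open>\<complex> \<Rightarrow> \<rat>\<close> applied to the coefficients of such a relation makes it
  rational if the function has a rational \<open>q\<close>-expansion.

  Finally \<open>x = p + 2\<close>, \<open>y = y\<^sub>0 - 2 x + 3\<close> and \<open>t = x T / (p - y\<^sub>0)\<close>, where \<open>y\<^sub>0 = S / (p + 3) - p\<close>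
  satisfies \<open>y\<^sub>0\<^sup>2 = p\<^sup>3 + 3 p y\<^sub>0 + 3 p\<^sup>2 + 9 p\<close> and
  \<open>T\<^sup>2 = S\<^sup>2 - 4 p\<^sup>3 = (-3 + 6 x + x\<^sup>2 + 4 y) (p - y\<^sub>0)\<^sup>2\<close>.
\<close>

section \<open>Jacobi's theta function as an infinite product\<close>

text \<open>Klein forms are used in place of the eta function because
  \<open>SL\<^sub>2(\<int>)\<close> acts on their indices without a multiplier system:
  \<open>klein_mat\<close> alone yields both the invariance under
  \<open>\<Gamma>\<^sub>0(45)\<close> and the growth at every cusp. The quotients
  \<open>\<eta>(z) / \<eta>(9z)\<close> and \<open>\<eta>(5z) / \<eta>(45z)\<close> are invariant
  only up to cube roots of unity; this is why their cubes and their product appear. No genus and no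
  Riemann-Roch theorem enter. Their place is taken by Liouville's theorem for functions whose poles
  lie at \<open>\<infinity>\<close> and its image under \<open>w\<^sub>5\<close>, together with
  linear algebra on principal parts. The pole orders 2 and 5 do not generate 3, and the relation
  between \<open>p\<close> and \<open>S\<close> describes a plane curve with a singular point at
  \<open>p = -3\<close>. Dividing \<open>S\<close> by \<open>p + 3\<close> resolves it:
  \<open>y\<^sub>0\<close> has a pole of order 3, so \<open>p\<close> and \<open>y\<^sub>0\<close>
  satisfy a Weierstrass equation, which the affine changes of variables to \<open>x\<close> and
  \<open>y\<close> bring into the required form.\<close>

definition qprod :: "complex \<Rightarrow> complex \<Rightarrow> complex" where
  "qprod x q = (\<Prod>n. 1 - x * q ^ n)"

lemma summable_qprod:
  fixes x q :: complex
  assumes "norm q < 1"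
  shows "summable (\<lambda>n. norm ((1 - x * q ^ n) - 1))"
  using assms by (simp add: norm_mult norm_power summable_geometric summable_mult)

lemma convergent_qprod:
  fixes x q :: complex
  assumes "norm q < 1"
  shows "convergent_prod (\<lambda>n. 1 - x * q ^ n)"
  by (intro abs_convergent_prod_imp_convergent_prod summable_imp_abs_convergent_prod
      summable_qprod assms)

lemma qprod_LIMSEQ:
  assumes "norm q < 1"
  shows "(\<lambda>N. \<Prod>n<N. 1 - x * q ^ n) \<longlonglongrightarrow> qprod x q"
  using convergent_prod_LIMSEQ[OF convergent_qprod[OF assms]]
  by (simp add: qprod_def LIMSEQ_lessThan_iff_atMost)

lemma qprod_rec:
  assumes "norm q < 1"
  shows "qprod x q = (1 - x) * qprod (x * q) q"
proof -
  have "(\<lambda>N. (1 - x) * (\<Prod>n<N. 1 - x * q * q ^ n)) \<longlonglongrightarrow> (1 - x) * qprod (x * q) q"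
    by (intro tendsto_intros qprod_LIMSEQ assms)
  also have "(\<lambda>N. (1 - x) * (\<Prod>n<N. 1 - x * q * q ^ n)) = (\<lambda>N. \<Prod>n<Suc N. 1 - x * q ^ n)"
    by (simp only: prod.lessThan_Suc_shift) (simp add: mult_ac)
  finally have "(\<lambda>N. \<Prod>n<Suc N. 1 - x * q ^ n) \<longlonglongrightarrow> (1 - x) * qprod (x * q) q" .
  moreover have "(\<lambda>N. \<Prod>n<Suc N. 1 - x * q ^ n) \<longlonglongrightarrow> qprod x q"
    using LIMSEQ_Suc[OF qprod_LIMSEQ[OF assms]] .
  ultimately show ?thesis
    by (rule LIMSEQ_unique[symmetric])
qed

lemma qprod_split:
  assumes "norm q < 1"
  shows "qprod x q = (\<Prod>n<N. 1 - x * q ^ n) * qprod (x * q ^ N) q"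
proof (induction N)
  case (Suc N)
  show ?case
    using Suc qprod_rec[OF assms, of "x * q ^ N"] by (simp add: mult_ac)
qed simp

lemma qprod_eq_0_iff:
  assumes "norm q < 1"
  shows "qprod x q = 0 \<longleftrightarrow> (\<exists>n. x * q ^ n = 1)"
proof
  show "\<exists>n. x * q ^ n = 1" if "qprod x q = 0"
  proof (rule ccontr)
    assume "\<not> (\<exists>n. x * q ^ n = 1)"
    hence "1 - x * q ^ n \<noteq> 0" for n by auto
    thus False
      using prodinf_nonzero[OF convergent_qprod[OF assms, of x]] that by (simp add: qprod_def)
  qed
next
  assume "\<exists>n. x * q ^ n = 1"
  then obtain n where "x * q ^ n = 1" by blast
  thus "qprod x q = 0"
    by (subst qprod_split[OF assms, of _ "Suc n"]) simp
qed

text \<open>Comparison with the exponential of a geometric series. The bound involves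
  \<open>x\<close> only through its norm, so it serves both for estimates near a cusp and for
  truncating expansions at \<open>q = 0\<close>.\<close>

lemma norm_qprod_minus_1_le:
  assumes "norm q < 1"
  shows "norm (qprod x q - 1) \<le> exp (norm x / (1 - norm q)) - 1"
proof (rule LIMSEQ_le_const2)
  show "(\<lambda>N. norm ((\<Prod>n<N. 1 - x * q ^ n) - 1)) \<longlonglongrightarrow> norm (qprod x q - 1)"
    by (intro tendsto_intros qprod_LIMSEQ assms)
  have "norm ((\<Prod>n<N. 1 - x * q ^ n) - 1) \<le> exp (norm x / (1 - norm q)) - 1" for N
  proof -
    have "norm ((\<Prod>n<N. 1 + (- (x * q ^ n))) - 1) \<le> (\<Prod>n<N. 1 + norm (- (x * q ^ n))) - 1"
      by (rule norm_prod_minus1_le_prod_minus1)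
    also have "(\<Prod>n<N. 1 + norm (- (x * q ^ n))) \<le> (\<Prod>n<N. exp (norm (- (x * q ^ n))))"
      by (intro prod_mono) (auto simp: add.commute exp_ge_add_one_self)
    also have "\<dots> = exp (\<Sum>n<N. norm (x * q ^ n))"
      by (simp add: exp_sum)
    also have "(\<Sum>n<N. norm (x * q ^ n)) \<le> (\<Sum>n. norm (x * q ^ n))"
      using summable_qprod[OF assms, of x] by (intro sum_le_suminf) auto
    also have "(\<Sum>n. norm (x * q ^ n)) = norm x / (1 - norm q)"
      using assms by (simp add: norm_mult norm_power suminf_mult suminf_geometric summable_geometric)
    finally show ?thesis by simp
  qed
  thus "\<exists>M. \<forall>N\<ge>M. norm ((\<Prod>n<N. 1 - x * q ^ n) - 1) \<le> exp (norm x / (1 - norm q)) - 1"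
    by blast
qed

lemma qprod_0 [simp]: "qprod 0 q = 1"
  by (simp add: qprod_def)

text \<open>The partial products converge locally uniformly: on a small closed ball the norm of
  \<open>g\<close> stays below some \<open>r < 1\<close>, and a geometric series dominates the
  factors. Both arguments vary, because theta is needed as a function of \<open>u\<close> and as a
  function of \<open>\<tau>\<close>.\<close>

lemma qprod_holomorphic [holomorphic_intros]:
  assumes "f holomorphic_on A" "g holomorphic_on A" "open A" "\<And>z. z \<in> A \<Longrightarrow> norm (g z) < 1"
  shows "(\<lambda>z. qprod (f z) (g z)) holomorphic_on A"
proof (rule holomorphic_uniform_sequence[where f = "\<lambda>N z. \<Prod>n<N. 1 - f z * g z ^ n"])
  show "(\<lambda>z. \<Prod>n<N. 1 - f z * g z ^ n) holomorphic_on A" for N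
    by (intro holomorphic_intros assms)
  fix z assume "z \<in> A"
  then obtain d where d: "d > 0" "cball z d \<subseteq> A"
    using assms(3) open_contains_cball by blast
  have cf: "continuous_on (cball z d) f" and cg: "continuous_on (cball z d) g"
    using assms(1,2) d(2) by (meson continuous_on_subset holomorphic_on_imp_continuous_on)+
  have "compact (f ` cball z d)"
    by (intro compact_continuous_image cf compact_cball)
  then obtain R where R: "R > 0" "\<And>w. w \<in> cball z d \<Longrightarrow> norm (f w) \<le> R"
    using compact_imp_bounded[of "f ` cball z d"] unfolding bounded_pos by (metis imageI)
  have "continuous_on (cball z d) (\<lambda>w. norm (g w))"
    by (intro continuous_intros cg)
  then obtain w0 where w0: "w0 \<in> cball z d" "\<And>w. w \<in> cball z d \<Longrightarrow> norm (g w) \<le> norm (g w0)"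
    using continuous_attains_sup[of "cball z d" "\<lambda>w. norm (g w)"] d(1) by auto
  define r where "r = norm (g w0)"
  have r: "r < 1" "r \<ge> 0" "\<And>w. w \<in> cball z d \<Longrightarrow> norm (g w) \<le> r"
    using w0 assms(4) d(2) by (auto simp: r_def)
  have "uniformly_convergent_on (cball z d) (\<lambda>N w. \<Prod>n<N. 1 - f w * g w ^ n)"
  proof (rule uniformly_convergent_on_prod')
    show "uniformly_convergent_on (cball z d) (\<lambda>N w. \<Sum>n<N. norm ((1 - f w * g w ^ n) - 1))"
    proof (rule Weierstrass_m_test'_ev)
      show "\<forall>\<^sub>F n in sequentially. \<forall>w\<in>cball z d. norm (norm ((1 - f w * g w ^ n) - 1)) \<le> R * r ^ n"
      proof (intro always_eventually allI ballI)
        fix n w assume "w \<in> cball z d"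
        hence "norm (f w) * norm (g w) ^ n \<le> R * r ^ n"
          using R r by (intro mult_mono power_mono) auto
        thus "norm (norm ((1 - f w * g w ^ n) - 1)) \<le> R * r ^ n"
          by (simp add: norm_mult norm_power)
      qed
      show "summable (\<lambda>n. R * r ^ n)"
        using r by (intro summable_mult summable_geometric) auto
    qed
  qed (intro continuous_intros cf cg compact_cball)+
  then obtain l where l: "uniform_limit (cball z d) (\<lambda>N w. \<Prod>n<N. 1 - f w * g w ^ n) l sequentially"
    by (auto simp: uniformly_convergent_on_def)
  have "l w = qprod (f w) (g w)" if "w \<in> cball z d" for w
    using tendsto_uniform_limitI[OF l that] qprod_LIMSEQ[of "g w" "f w"] assms(4) d(2) that
    by (meson LIMSEQ_unique in_mono)
  hence "uniform_limit (cball z d) (\<lambda>N w. \<Prod>n<N. 1 - f w * g w ^ n)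
           (\<lambda>w. qprod (f w) (g w)) sequentially"
    using l by (subst (asm) uniform_limit_cong'[where g = "\<lambda>N w. \<Prod>n<N. 1 - f w * g w ^ n"]) auto
  thus "\<exists>d>0. cball z d \<subseteq> A \<and> uniform_limit (cball z d) (\<lambda>N z. \<Prod>n<N. 1 - f z * g z ^ n)
          (\<lambda>z. qprod (f z) (g z)) sequentially"
    using d by blast
qed fact

text \<open>The factors are grouped by the residue of their exponent modulo 3.\<close>

lemma qprod_trisect:
  assumes "norm q < 1"
  shows "qprod x (q ^ 3) * qprod (x * q) (q ^ 3) * qprod (x * q ^ 2) (q ^ 3) = qprod x q"
proof -
  have q3: "norm (q ^ 3) < 1"
    using assms by (simp add: norm_power power_less_one_iff)
  have eq: "(\<Prod>n<N. 1 - x * (q ^ 3) ^ n) * (\<Prod>n<N. 1 - x * q * (q ^ 3) ^ n) *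
              (\<Prod>n<N. 1 - x * q ^ 2 * (q ^ 3) ^ n) = (\<Prod>n<3 * N. 1 - x * q ^ n)" for N
  proof (induction N)
    case (Suc N)
    have "(\<Prod>n<3 * Suc N. 1 - x * q ^ n) =
            (\<Prod>n<3 * N. 1 - x * q ^ n) * (1 - x * q ^ (3 * N)) * (1 - x * q ^ (3 * N + 1)) *
            (1 - x * q ^ (3 * N + 2))"
      by (simp add: eval_nat_numeral mult_ac)
    also have "\<dots> = (\<Prod>n<Suc N. 1 - x * (q ^ 3) ^ n) * (\<Prod>n<Suc N. 1 - x * q * (q ^ 3) ^ n) *
              (\<Prod>n<Suc N. 1 - x * q ^ 2 * (q ^ 3) ^ n)"
      unfolding Suc[symmetric] prod.lessThan_Suc power_mult power_add by (simp add: mult_ac)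
    finally show ?case ..
  qed simp
  have "(\<lambda>N. \<Prod>n<3 * N. 1 - x * q ^ n) \<longlonglongrightarrow> qprod x q"
    by (rule filterlim_compose[OF qprod_LIMSEQ[OF assms] mult_nat_left_at_top]) simp
  moreover have "(\<lambda>N. \<Prod>n<3 * N. 1 - x * q ^ n) \<longlonglongrightarrow>
      qprod x (q ^ 3) * qprod (x * q) (q ^ 3) * qprod (x * q ^ 2) (q ^ 3)"
    unfolding eq[symmetric] by (intro tendsto_intros qprod_LIMSEQ q3)
  ultimately show ?thesis
    by (rule LIMSEQ_unique[symmetric])
qed

text \<open>For a primitive cube root of unity \<open>w\<close> the three factors with the same
  index multiply to \<open>1 - y ^ 3\<close>.\<close>

lemma qprod_cube:
  fixes w :: complex
  assumes "norm q < 1" and w: "w ^ 2 + w + 1 = 0"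
  shows "qprod x q * qprod (w * x) q * qprod (w ^ 2 * x) q = qprod (x ^ 3) (q ^ 3)"
proof -
  have q3: "norm (q ^ 3) < 1"
    using assms by (simp add: norm_power power_less_one_iff)
  have *: "(1 - y) * (1 - w * y) * (1 - w ^ 2 * y) = 1 - y ^ 3" for y :: complex
  proof -
    have "(1 - y) * (1 - w * y) * (1 - w ^ 2 * y) =
            1 - y ^ 3 + (w ^ 2 + w + 1) * (y ^ 2 * w - y - y ^ 3 * (w - 1))"
      by (simp add: algebra_simps eval_nat_numeral)
    thus ?thesis using w by simp
  qed
  have eq: "(\<Prod>n<N. 1 - x * q ^ n) * (\<Prod>n<N. 1 - w * x * q ^ n) *
              (\<Prod>n<N. 1 - w ^ 2 * x * q ^ n) = (\<Prod>n<N. 1 - x ^ 3 * (q ^ 3) ^ n)" for N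
    unfolding prod.distrib[symmetric] using *
    by (intro prod.cong refl)
       (simp add: power_mult_distrib mult.assoc mult.commute[of 3] flip: power_mult)
  have "(\<lambda>N. \<Prod>n<N. 1 - x ^ 3 * (q ^ 3) ^ n) \<longlonglongrightarrow>
      qprod x q * qprod (w * x) q * qprod (w ^ 2 * x) q"
    unfolding eq[symmetric] by (intro tendsto_intros qprod_LIMSEQ assms)
  thus ?thesis
    using qprod_LIMSEQ[OF q3] by (rule LIMSEQ_unique)
qed

section \<open>The normalised exponential and the theta function\<close>

definition ee :: "complex \<Rightarrow> complex" where
  "ee z = exp (2 * of_real pi * \<i> * z)"

lemma ee_add: "ee (a + b) = ee a * ee b"
  by (simp add: ee_def exp_add algebra_simps)

lemma ee_diff: "ee (a - b) = ee a / ee b"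
  by (simp add: ee_def exp_diff algebra_simps)

lemma ee_minus: "ee (- a) = inverse (ee a)"
  by (simp add: ee_def exp_minus)

lemma ee_0 [simp]: "ee 0 = 1"
  by (simp add: ee_def)

lemma ee_nonzero [simp]: "ee z \<noteq> 0"
  by (simp add: ee_def)

lemma ee_of_int [simp]: "ee (of_int n) = 1"
  using exp_integer_2pi[of "of_int n"] by (simp add: ee_def mult_ac)

lemma ee_1 [simp]: "ee 1 = 1"
  using ee_of_int[of 1] by simp

lemma ee_half: "ee (1 / 2) = -1"
  by (simp add: ee_def)

lemma ee_of_nat_mult: "ee (of_nat n * z) = ee z ^ n"
  by (simp add: ee_def mult_ac flip: exp_of_nat_mult)

lemma ee_of_int_mult: "ee (of_int n * z) = ee z powi n"
proof (cases "n \<ge> 0")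
  case True
  thus ?thesis
    using ee_of_nat_mult[of "nat n" z] by (simp add: power_int_def)
next
  case False
  have "ee (of_int n * z) = ee (- (of_nat (nat (-n)) * z))"
    using False by simp
  also have "\<dots> = inverse (ee z ^ nat (-n))"
    by (simp only: ee_minus ee_of_nat_mult)
  finally show ?thesis
    using False by (simp add: power_int_def power_inverse)
qed

lemma norm_ee: "norm (ee z) = exp (- 2 * pi * Im z)"
  by (simp add: ee_def)

lemma norm_ee_less_1: "z \<in> uhp \<Longrightarrow> norm (ee z) < 1"
  by (simp add: norm_ee uhp_def)

lemma ee_holomorphic [holomorphic_intros]:
  "f holomorphic_on A \<Longrightarrow> (\<lambda>z. ee (f z)) holomorphic_on A"
  unfolding ee_def by (intro holomorphic_intros)

lemma ee_eq_1_iff: "ee z = 1 \<longleftrightarrow> (\<exists>n. z = of_int n)"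
proof
  assume "ee z = 1"
  then obtain n :: int where n: "2 * of_real pi * \<i> * z = of_int (2 * n) * of_real pi * \<i>"
    unfolding ee_def exp_eq_1 by (auto simp: complex_eq_iff)
  hence "(2 * of_real pi * \<i>) * z = (2 * of_real pi * \<i>) * of_int n"
    by (simp add: mult_ac)
  hence "z = of_int n"
    by (subst (asm) mult_left_cancel) auto
  thus "\<exists>n. z = of_int n" ..
qed auto

lemma ee_eq_iff: "ee z = ee w \<longleftrightarrow> (\<exists>n. z = w + of_int n)"
  using ee_eq_1_iff[of "z - w"] by (auto simp: ee_diff algebra_simps)

text \<open>This is the Jacobi triple product without the factor \<open>qprod q q\<close>, which
  depends on \<open>q\<close> alone and would cancel in every quotient formed later.\<close>

definition th0 :: "complex \<Rightarrow> complex \<Rightarrow> complex" where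
  "th0 x q = qprod x q * qprod (q / x) q"

lemma th0_mult_q:
  assumes "norm q < 1" "q \<noteq> 0" "x \<noteq> 0"
  shows "th0 (x * q) q = - (1 / x) * th0 x q"
proof -
  have "qprod (1 / x) q = (1 - 1 / x) * qprod (q / x) q"
    using qprod_rec[of q "1 / x"] assms by simp
  moreover have "1 - 1 / x = - (1 / x) * (1 - x)"
    using assms by (simp add: field_simps)
  ultimately show ?thesis
    using assms by (simp add: th0_def qprod_rec[of q x])
qed

lemma th0_inverse:
  assumes "norm q < 1" "q \<noteq> 0" "x \<noteq> 0"
  shows "th0 (1 / x) q = - (1 / x) * th0 x q"
proof -
  have "qprod (1 / x) q = (1 - 1 / x) * qprod (q / x) q"
    using qprod_rec[of q "1 / x"] assms by simp
  moreover have "1 - 1 / x = - (1 / x) * (1 - x)"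
    using assms by (simp add: field_simps)
  ultimately show ?thesis
    using assms by (simp add: th0_def qprod_rec[of q x] mult_ac)
qed

text \<open>The factor \<open>ee (- u / 2)\<close> makes the function odd in \<open>u\<close>. Up to
  a factor depending on \<open>\<tau>\<close> alone this is Jacobi's
  \<open>\<theta>\<^sub>1\<close>.\<close>

definition Theta :: "complex \<Rightarrow> complex \<Rightarrow> complex" where
  "Theta u \<tau> = ee (- u / 2) * th0 (ee u) (ee \<tau>)"

lemma Theta_holomorphic [holomorphic_intros]:
  assumes "f holomorphic_on A" "g holomorphic_on A" "open A" "\<And>z. z \<in> A \<Longrightarrow> g z \<in> uhp"
  shows "(\<lambda>z. Theta (f z) (g z)) holomorphic_on A"
  unfolding Theta_def th0_def using assms(4)
  by (intro holomorphic_intros assms) (auto intro: norm_ee_less_1)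

lemma Theta_add_1: "Theta (u + 1) \<tau> = - Theta u \<tau>"
  by (simp add: Theta_def ee_add ee_diff add_divide_distrib diff_divide_distrib ee_half)

lemma Theta_add_tau:
  assumes "\<tau> \<in> uhp"
  shows "Theta (u + \<tau>) \<tau> = - ee (- u - \<tau> / 2) * Theta u \<tau>"
proof -
  have "- (u + \<tau>) / 2 + (- u) = (- u - \<tau> / 2) + (- u / 2)"
    by (simp add: field_simps)
  hence "ee (- (u + \<tau>) / 2) * ee (- u) = ee (- u - \<tau> / 2) * ee (- u / 2)"
    by (simp only: flip: ee_add)
  hence "ee (- (u + \<tau>) / 2) * (1 / ee u) = ee (- u - \<tau> / 2) * ee (- u / 2)"
    by (simp only: ee_minus inverse_eq_divide)
  moreover have "Theta (u + \<tau>) \<tau> = - (ee (- (u + \<tau>) / 2) * (1 / ee u)) * th0 (ee u) (ee \<tau>)"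
    using th0_mult_q[OF norm_ee_less_1[OF assms], of "ee u"] by (simp add: Theta_def ee_add)
  ultimately show ?thesis
    by (simp only: Theta_def mult_minus_left mult.assoc)
qed

lemma Theta_minus:
  assumes "\<tau> \<in> uhp"
  shows "Theta (- u) \<tau> = - Theta u \<tau>"
proof -
  have "ee (- u / 2) * ee u = ee (u / 2)"
    by (simp flip: ee_add)
  thus ?thesis
  using th0_inverse[OF norm_ee_less_1[OF assms], of "ee u"]
    by (simp add: Theta_def ee_minus field_simps)
qed

text \<open>Lattice points with \<open>n \<le> 0\<close> come from the factors of
  \<open>qprod (ee u)\<close>, those with \<open>n > 0\<close> from the factors of the second
  product.\<close>

lemma Theta_eq_0_iff:
  assumes "\<tau> \<in> uhp"
  shows "Theta u \<tau> = 0 \<longleftrightarrow> (\<exists>m n. u = of_int m + of_int n * \<tau>)"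
proof
  assume "Theta u \<tau> = 0"
  hence "qprod (ee u) (ee \<tau>) = 0 \<or> qprod (ee \<tau> / ee u) (ee \<tau>) = 0"
    by (auto simp: Theta_def th0_def)
  then obtain k where "ee u * ee \<tau> ^ k = 1 \<or> ee \<tau> / ee u * ee \<tau> ^ k = 1"
    using norm_ee_less_1[OF assms] by (auto simp: qprod_eq_0_iff)
  hence "ee (u + of_nat k * \<tau>) = 1 \<or> ee (of_nat (Suc k) * \<tau> - u) = 1"
    unfolding ee_add ee_diff ee_of_nat_mult by (simp add: mult_ac)
  then obtain m where "u + of_nat k * \<tau> = of_int m \<or> of_nat (Suc k) * \<tau> - u = of_int m"
    by (auto simp only: ee_eq_1_iff)
  thus "\<exists>m n. u = of_int m + of_int n * \<tau>"
  proof
    assume "u + of_nat k * \<tau> = of_int m"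
    hence "u = of_int m + of_int (- int k) * \<tau>" by (simp add: algebra_simps)
    thus ?thesis by blast
  next
    assume "of_nat (Suc k) * \<tau> - u = of_int m"
    hence "u = of_int (- m) + of_int (int (Suc k)) * \<tau>" by (simp add: algebra_simps)
    thus ?thesis by blast
  qed
next
  assume "\<exists>m n. u = of_int m + of_int n * \<tau>"
  then obtain m n where u: "u = of_int m + of_int n * \<tau>" by blast
  have e: "ee u = ee \<tau> powi n"
    by (simp add: u ee_add ee_of_int_mult)
  show "Theta u \<tau> = 0"
  proof (cases "n > 0")
    case True
    then obtain k where "n = int (Suc k)"
      by (metis Suc_pred' zero_less_imp_eq_int)
    hence "ee \<tau> / ee u * ee \<tau> ^ k = 1"
      using e by (simp add: power_int_def nat_add_distrib)
    hence "qprod (ee \<tau> / ee u) (ee \<tau>) = 0"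
      using qprod_eq_0_iff[OF norm_ee_less_1[OF assms]] by blast
    thus ?thesis by (simp add: Theta_def th0_def)
  next
    case False
    hence "ee u * ee \<tau> ^ nat (- n) = 1"
      using e by (cases "n = 0") (auto simp: power_int_def simp flip: power_mult_distrib)
    hence "qprod (ee u) (ee \<tau>) = 0"
      using qprod_eq_0_iff[OF norm_ee_less_1[OF assms]] by blast
    thus ?thesis by (simp add: Theta_def th0_def)
  qed
qed

text \<open>The factor \<open>1 - ee u\<close> splits off, and the cofactor \<open>R\<close> does
  not vanish at 0. Simplicity of this zero lets quotients by theta extend over the lattice.\<close>

lemma deriv_Theta_0:
  assumes "\<tau> \<in> uhp"
  shows "deriv (\<lambda>u. Theta u \<tau>) 0 \<noteq> 0"
proof -
  define R where "R u = ee (- u / 2) * (qprod (ee u * ee \<tau>) (ee \<tau>) * qprod (ee \<tau> / ee u) (ee \<tau>))" for u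
  have q: "norm (ee \<tau>) < 1"
    by (rule norm_ee_less_1[OF assms])
  have "R holomorphic_on UNIV"
    unfolding R_def[abs_def] by (intro holomorphic_intros q) auto
  hence R': "(R has_field_derivative deriv R 0) (at 0)"
    by (simp add: holomorphic_derivI)
  have eq: "(\<lambda>u. Theta u \<tau>) = (\<lambda>u. (1 - ee u) * R u)"
    by (intro ext) (simp add: Theta_def th0_def R_def qprod_rec[OF q, of "ee _"])
  have "((\<lambda>u. (1 - ee u) * R u) has_field_derivative (- (2 * of_real pi * \<i>) * R 0)) (at 0)"
    unfolding ee_def by (rule derivative_eq_intros R' refl)+ simp
  hence "deriv (\<lambda>u. Theta u \<tau>) 0 = - (2 * of_real pi * \<i>) * R 0"
    unfolding eq by (rule DERIV_imp_deriv)
  moreover have "R 0 \<noteq> 0"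
  proof -
    have "ee \<tau> * ee \<tau> ^ n \<noteq> 1" for n
    proof -
      have "norm (ee \<tau> * ee \<tau> ^ n) \<le> norm (ee \<tau>) * 1"
        unfolding norm_mult norm_power using q by (intro mult_left_mono power_le_one) auto
      thus ?thesis using q by auto
    qed
    thus ?thesis by (simp add: R_def qprod_eq_0_iff[OF q])
  qed
  ultimately show ?thesis by simp
qed

lemma uhp_S: "\<tau> \<in> uhp \<Longrightarrow> - 1 / \<tau> \<in> uhp"
  using moebius_in_uhp[of 0 0 "-1" 1 \<tau>] by (simp add: moebius_map_def)

lemma uhp_nonzero: "\<tau> \<in> uhp \<Longrightarrow> \<tau> \<noteq> 0"
  by (auto simp: uhp_def)

section \<open>The inversion formula\<close>

lemma lattice_decomp:
  assumes "\<tau> \<in> uhp"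
  shows "\<exists>m n s t. u = of_int m + of_int n * \<tau> + (of_real s + of_real t * \<tau>) \<and>
           s \<in> {0..1} \<and> t \<in> {0..1}"
proof -
  define y where "y = Im u / Im \<tau>"
  define x where "x = Re u - y * Re \<tau>"
  have "Im \<tau> > 0" using assms by (simp add: uhp_def)
  hence u: "u = of_real x + of_real y * \<tau>"
    by (simp add: complex_eq_iff x_def y_def)
  have "u = of_int \<lfloor>x\<rfloor> + of_int \<lfloor>y\<rfloor> * \<tau> + (of_real (frac x) + of_real (frac y) * \<tau>)"
    unfolding u frac_def by (simp add: algebra_simps)
  moreover have "frac x \<in> {0..1}" "frac y \<in> {0..1}"
    using frac_ge_0 frac_lt_1 less_imp_le by (metis atLeastAtMost_iff)+
  ultimately show ?thesis by blast
qed

lemma periodic_of_int_mult: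
  fixes g :: "complex \<Rightarrow> complex"
  assumes "\<And>u. g (u + w) = g u"
  shows "g (u + of_int m * w) = g u"
proof -
  have nat: "g (v + of_nat k * w) = g v" for v k
  proof (induction k)
    case (Suc k)
    have "g (v + of_nat (Suc k) * w) = g ((v + of_nat k * w) + w)"
      by (simp add: algebra_simps)
    also have "\<dots> = g v"
      using Suc assms by simp
    finally show ?case .
  qed simp
  show ?thesis
  proof (cases "m \<ge> 0")
    case True
    thus ?thesis using nat[of u "nat m"] by simp
  next
    case False
    thus ?thesis using nat[of "u + of_int m * w" "nat (- m)"] by simp
  qed
qed

text \<open>All values are attained on a compact period parallelogram, so Liouville's theorem
  applies.\<close>

lemma elliptic_entire_constant:
  assumes hol: "g holomorphic_on UNIV" and \<tau>: "\<tau> \<in> uhp"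
    and 1: "\<And>u. g (u + 1) = g u" and 2: "\<And>u. g (u + \<tau>) = g u"
  shows "\<exists>C. \<forall>u. g u = C"
proof -
  have 1: "g (u + of_int m) = g u" for u m
    using periodic_of_int_mult[of g 1 u m] 1 by simp
  have 2: "g (u + of_int m * \<tau>) = g u" for u m
    using periodic_of_int_mult[of g \<tau> u m] 2 by simp
  define K where "K = (\<lambda>(s, t). of_real s + of_real t * \<tau>) ` ({0..1} \<times> {0..1 :: real})"
  have "compact K"
    unfolding K_def case_prod_beta
    by (intro compact_continuous_image continuous_intros compact_Times) auto
  moreover have "continuous_on K g"
    using hol holomorphic_on_imp_continuous_on holomorphic_on_subset by blast
  ultimately have "bounded (g ` K)"
    by (intro compact_imp_bounded compact_continuous_image)
  moreover have "range g \<subseteq> g ` K"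
  proof
    fix y assume "y \<in> range g"
    then obtain u where u: "y = g u" by blast
    obtain m n s t where *: "u = of_int m + of_int n * \<tau> + (of_real s + of_real t * \<tau>)"
       "s \<in> {0..1}" "t \<in> {0..1}"
      using lattice_decomp[OF \<tau>] by blast
    have "g u = g ((of_real s + of_real t * \<tau>) + of_int n * \<tau> + of_int m)"
      using *(1) by (simp add: algebra_simps)
    also have "\<dots> = g (of_real s + of_real t * \<tau>)"
      by (simp only: 1 2)
    finally show "y \<in> g ` K"
      using *(2,3) unfolding u K_def by (auto intro!: imageI)
  qed
  ultimately have "bounded (range g)"
    using bounded_subset by blast
  thus ?thesis
    using Liouville_theorem[OF hol] by (metis constant_on_def UNIV_I)
qed

lemma entire_analytic: "f holomorphic_on UNIV \<Longrightarrow> f analytic_on A"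
  by (meson analytic_on_open analytic_on_subset open_UNIV subset_UNIV)

lemma entire_eventually_nonzero:
  assumes "f holomorphic_on UNIV" "f x \<noteq> 0"
  shows "\<forall>\<^sub>F u in nhds x. f u \<noteq> 0"
proof -
  have "isCont f x"
    by (rule analytic_at_imp_isCont[OF entire_analytic[OF assms(1)]])
  hence "(f \<longlongrightarrow> f x) (nhds x)"
    by (simp add: isCont_def tendsto_at_iff_tendsto_nhds)
  thus ?thesis
    using assms(2) by (rule tendsto_imp_eventually_ne)
qed

text \<open>The quotient of \<open>A\<close> and \<open>B\<close> is doubly periodic. At 0 the zero
  of \<open>B\<close> is simple and \<open>A\<close> vanishes, so the quotient extends there, and by
  periodicity over the whole lattice; it is then entire, hence constant.\<close>

lemma elliptic_quotient_constant:
  assumes \<tau>: "\<tau> \<in> uhp"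
    and A: "A holomorphic_on UNIV" and B: "B holomorphic_on UNIV"
    and A1: "\<And>u. A (u + 1) = - A u" and B1: "\<And>u. B (u + 1) = - B u"
    and A2: "\<And>u. A (u + \<tau>) = h u * A u" and B2: "\<And>u. B (u + \<tau>) = h u * B u"
    and h: "\<And>u. h u \<noteq> 0" and h1: "\<And>u. h (u + 1) = h u"
    and A0: "\<And>u. A u = 0 \<longleftrightarrow> (\<exists>m n. u = of_int m + of_int n * \<tau>)"
    and B0: "\<And>u. B u = 0 \<longleftrightarrow> (\<exists>m n. u = of_int m + of_int n * \<tau>)"
    and B': "deriv B 0 \<noteq> 0"
  shows "\<exists>C. C \<noteq> 0 \<and> (\<forall>u. A u = C * B u)"
proof -
  \<comment> \<open>Value of the quotient at the lattice points, by l'Hopital's rule.\<close>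
  define L where "L = deriv A 0 / deriv B 0"
  define g where "g u = (if B u = 0 then L else A u / B u)" for u
  \<comment> \<open>\<open>a\<close> and \<open>b\<close> are \<open>A\<close> and \<open>B\<close>
    divided by \<open>u\<close>, with the removable singularity filled in, so that the quotient is
    \<open>a / b\<close> near 0 with \<open>b 0 \<noteq> 0\<close>.\<close>
  define a where "a u = (if u = 0 then deriv A 0 else A u / u)" for u
  define b where "b u = (if u = 0 then deriv B 0 else B u / u)" for u
  have [simp]: "A 0 = 0" "B 0 = 0"
    unfolding A0 B0 by (rule exI[of _ 0], rule exI[of _ 0], simp)+
  have a: "a holomorphic_on UNIV" and b: "b holomorphic_on UNIV"
    using pole_lemma[OF A, of 0] pole_lemma[OF B, of 0]
    by (auto simp: a_def[abs_def] b_def[abs_def] cong: if_cong)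
  have g1: "g (u + 1) = g u" for u
    by (simp add: g_def A1 B1)
  have g2: "g (u + \<tau>) = g u" for u
    using h[of u] by (simp add: g_def A2 B2)
  have an0: "g analytic_on {0}"
  proof -
    have "b 0 \<noteq> 0" by (simp add: b_def B')
    hence ev: "\<forall>\<^sub>F u in nhds 0. b u \<noteq> 0"
      by (rule entire_eventually_nonzero[OF b])
    have "(\<lambda>u. a u / b u) analytic_on {0}"
      using \<open>b 0 \<noteq> 0\<close> by (intro analytic_on_divide entire_analytic a b) simp
    moreover have "\<forall>\<^sub>F u in nhds 0. a u / b u = g u"
      using ev by eventually_elim (auto simp: a_def b_def g_def L_def)
    ultimately show ?thesis
      using analytic_at_cong[of "\<lambda>u. a u / b u" g 0 0] by blast
  qed
  have an: "g analytic_on {u}" for u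
  proof (cases "B u = 0")
    case False
    have ev: "\<forall>\<^sub>F w in nhds u. B w \<noteq> 0"
      by (rule entire_eventually_nonzero[OF B False])
    have "(\<lambda>u. A u / B u) analytic_on {u}"
      using False by (intro analytic_on_divide entire_analytic A B) simp
    moreover have "\<forall>\<^sub>F u in nhds u. A u / B u = g u"
      using ev by eventually_elim (auto simp: g_def)
    ultimately show ?thesis
      using analytic_at_cong[of "\<lambda>u. A u / B u" g u u] by blast
  next
    case True
    then obtain m n where u: "u = of_int m + of_int n * \<tau>"
      unfolding B0 by blast
    have per: "g (w - u) = g w" for w
    proof -
      have 1: "g (v + of_int k) = g v" for v k
        using periodic_of_int_mult[of g 1 v k] g1 by simp
      have 2: "g (v + of_int k * \<tau>) = g v" for v k
        using periodic_of_int_mult[of g \<tau> v k] g2 by simp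
      have "g w = g (w - u + of_int n * \<tau> + of_int m)"
        by (simp add: u algebra_simps)
      thus ?thesis by (simp only: 1 2)
    qed
    have "g \<circ> (\<lambda>w. w - u) analytic_on {u}"
      by (rule analytic_on_compose_gen[where T = "{0}"]) (auto intro!: analytic_intros an0)
    thus ?thesis by (simp add: o_def per)
  qed
  hence "g holomorphic_on UNIV"
    using analytic_on_analytic_at analytic_imp_holomorphic by blast
  then obtain C where C: "g u = C" for u
    using elliptic_entire_constant[OF _ \<tau> g1 g2] by blast
  have AB: "A u = C * B u" for u
  proof (cases "B u = 0")
    case True
    hence "A u = 0" using A0 B0 by blast
    thus ?thesis using True by simp
  next
    case False
    thus ?thesis using C[of u] by (simp add: g_def field_simps)
  qed
  moreover have "C \<noteq> 0"
  proof
    assume "C = 0"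
    \<comment> \<open>\<open>1 / 2\<close> is not a lattice point: its imaginary part would force
      \<open>n = 0\<close>, and then \<open>2 * m = 1\<close>.\<close>
    hence "A (1/2) = 0" using AB by simp
    then obtain m n where mn: "(1/2 :: complex) = of_int m + of_int n * \<tau>"
      unfolding A0 by blast
    have "Im (1 / 2) = Im (of_int m + of_int n * \<tau>)"
      by (simp only: mn)
    hence n: "n = 0" using \<tau> by (simp add: uhp_def)
    have "Re (1 / 2) = Re (of_int m + of_int n * \<tau>)"
      by (simp only: mn)
    hence "real_of_int 1 = of_int (2 * m)" by (simp add: n)
    hence "1 = 2 * m" by (simp only: of_int_eq_iff)
    thus False by presburger
  qed
  ultimately show ?thesis by blast
qed

text \<open>Passing from \<open>\<tau>\<close> to \<open>- 1 / \<tau>\<close> and from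
  \<open>u\<close> to \<open>u / \<tau>\<close> exchanges the two periods up to sign. The Gaussian
  factor restores the same quasi-periodicity, and the zeros agree, so the two sides have a quotient
  independent of \<open>u\<close>.\<close>

lemma Theta_S:
  assumes "\<tau> \<in> uhp"
  shows "\<exists>C. C \<noteq> 0 \<and> (\<forall>u. ee (- (u ^ 2 / (2 * \<tau>))) * Theta (u / \<tau>) (- 1 / \<tau>) = C * Theta u \<tau>)"
proof (rule elliptic_quotient_constant[OF assms, where h = "\<lambda>u. - ee (- u - \<tau> / 2)"])
  note \<tau>' = uhp_S[OF assms]
  have [simp]: "\<tau> \<noteq> 0" using assms by (rule uhp_nonzero)
  let ?A = "\<lambda>u. ee (- (u ^ 2 / (2 * \<tau>))) * Theta (u / \<tau>) (- 1 / \<tau>)"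
  show "?A holomorphic_on UNIV" "(\<lambda>u. Theta u \<tau>) holomorphic_on UNIV"
    using assms \<tau>' by (auto intro!: holomorphic_intros)
  show "Theta (u + 1) \<tau> = - Theta u \<tau>" for u
    by (rule Theta_add_1)
  show "Theta (u + \<tau>) \<tau> = - ee (- u - \<tau> / 2) * Theta u \<tau>" for u
    by (rule Theta_add_tau[OF assms])
  show "- ee (- u - \<tau> / 2) \<noteq> 0" "- ee (- (u + 1) - \<tau> / 2) = - ee (- u - \<tau> / 2)" for u
    by (simp_all add: ee_diff ee_minus)
  show "?A (u + \<tau>) = - ee (- u - \<tau> / 2) * ?A u" for u
  proof -
    have "Theta ((u + \<tau>) / \<tau>) (- 1 / \<tau>) = - Theta (u / \<tau>) (- 1 / \<tau>)"
      using Theta_add_1[of "u / \<tau>"] by (simp add: add_divide_distrib)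
    moreover have "- ((u + \<tau>) ^ 2 / (2 * \<tau>)) = - (u ^ 2 / (2 * \<tau>)) + (- u - \<tau> / 2)"
      by (simp add: power2_eq_square field_simps)
    ultimately show ?thesis
      by (simp only: ee_add) simp
  qed
  show "?A (u + 1) = - ?A u" for u
  proof -
    have "Theta ((u + 1) / \<tau> + - 1 / \<tau>) (- 1 / \<tau>) =
            - ee (- ((u + 1) / \<tau>) - - 1 / \<tau> / 2) * Theta ((u + 1) / \<tau>) (- 1 / \<tau>)"
      by (rule Theta_add_tau[OF \<tau>'])
    moreover have "(u + 1) / \<tau> + - 1 / \<tau> = u / \<tau>"
      by (simp add: add_divide_distrib)
    ultimately have *: "Theta (u / \<tau>) (- 1 / \<tau>) =
        - ee (- ((u + 1) / \<tau>) - - 1 / \<tau> / 2) * Theta ((u + 1) / \<tau>) (- 1 / \<tau>)"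
      by simp
    have "- (u ^ 2 / (2 * \<tau>)) + (- ((u + 1) / \<tau>) - - 1 / \<tau> / 2) = - ((u + 1) ^ 2 / (2 * \<tau>))"
      by (simp add: power2_eq_square field_simps)
    hence "ee (- (u ^ 2 / (2 * \<tau>))) * ee (- ((u + 1) / \<tau>) - - 1 / \<tau> / 2) = ee (- ((u + 1) ^ 2 / (2 * \<tau>)))"
      by (simp only: flip: ee_add)
    thus ?thesis unfolding * by (simp only: mult_minus_left mult_minus_right minus_minus flip: mult.assoc)
  qed
  show "Theta u \<tau> = 0 \<longleftrightarrow> (\<exists>m n. u = of_int m + of_int n * \<tau>)" for u
    by (rule Theta_eq_0_iff[OF assms])
  show "?A u = 0 \<longleftrightarrow> (\<exists>m n. u = of_int m + of_int n * \<tau>)" for u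
  proof -
    have "?A u = 0 \<longleftrightarrow> (\<exists>m n. u / \<tau> = of_int m + of_int n * (- 1 / \<tau>))"
      using Theta_eq_0_iff[OF \<tau>'] by simp
    also have "\<dots> \<longleftrightarrow> (\<exists>m n. u = of_int m + of_int n * \<tau>)"
    proof safe
      fix m n assume "u / \<tau> = of_int m + of_int n * (- 1 / \<tau>)"
      hence "u = of_int (- n) + of_int m * \<tau>" by (simp add: field_simps)
      thus "\<exists>m n. u = of_int m + of_int n * \<tau>" by blast
    next
      fix m n assume "u = of_int m + of_int n * \<tau>"
      have "(of_int m + of_int n * \<tau>) / \<tau> = of_int n + of_int (- m) * (- 1 / \<tau>)"
        by (simp add: field_simps)
      thus "\<exists>m' n'. (of_int m + of_int n * \<tau>) / \<tau> = of_int m' + of_int n' * (- 1 / \<tau>)"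
        by blast
    qed
    finally show ?thesis .
  qed
  show "deriv (\<lambda>u. Theta u \<tau>) 0 \<noteq> 0"
    by (rule deriv_Theta_0[OF assms])
qed

section \<open>Klein forms\<close>

text \<open>Up to a factor depending on \<open>\<tau>\<close> alone, this is the Klein form of index
  \<open>(r, s)\<close>. The quadratic exponent absorbs the Gaussian factor of the inversion
  formula, so that matrices act linearly on \<open>(r, s)\<close>.\<close>

definition klein :: "complex \<Rightarrow> complex \<Rightarrow> complex \<Rightarrow> complex" where
  "klein r s \<tau> = ee (r * (r * \<tau> + s) / 2) * Theta (r * \<tau> + s) \<tau>"

lemma klein_minus: "\<tau> \<in> uhp \<Longrightarrow> klein (- r) (- s) \<tau> = - klein r s \<tau>"
  using Theta_minus[of \<tau> "r * \<tau> + s"] by (simp add: klein_def algebra_simps)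

lemma klein_shift1:
  assumes "\<tau> \<in> uhp"
  shows "klein (r + 1) s \<tau> = - ee (- s / 2) * klein r s \<tau>"
proof -
  have "(r + 1) * ((r + 1) * \<tau> + s) / 2 + (- (r * \<tau> + s) - \<tau> / 2) = - s / 2 + r * (r * \<tau> + s) / 2"
    by (simp add: field_simps)
  hence "ee ((r + 1) * ((r + 1) * \<tau> + s) / 2) * ee (- (r * \<tau> + s) - \<tau> / 2) =
           ee (- s / 2) * ee (r * (r * \<tau> + s) / 2)"
    by (simp only: flip: ee_add)
  moreover have "Theta ((r + 1) * \<tau> + s) \<tau> = - ee (- (r * \<tau> + s) - \<tau> / 2) * Theta (r * \<tau> + s) \<tau>"
    using Theta_add_tau[OF assms, of "r * \<tau> + s"] by (simp add: algebra_simps)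
  ultimately show ?thesis
    by (simp add: klein_def)
qed

lemma klein_shift2: "klein r (s + 1) \<tau> = - ee (r / 2) * klein r s \<tau>"
proof -
  have "r * (r * \<tau> + (s + 1)) / 2 = r / 2 + r * (r * \<tau> + s) / 2"
    by (simp add: field_simps)
  thus ?thesis
    using Theta_add_1[of "r * \<tau> + s"] by (simp only: klein_def ee_add flip: add.assoc) simp
qed

text \<open>The factor \<open>C\<close> may depend on \<open>\<tau>\<close> but not on
  \<open>(r, s)\<close>. It therefore cancels in quotients, and no formula for it has to be carried
  along.\<close>

definition klein_mat :: "int \<Rightarrow> int \<Rightarrow> int \<Rightarrow> int \<Rightarrow> bool" where
  "klein_mat a b c d \<longleftrightarrow> (\<forall>\<tau>\<in>uhp. \<exists>C. C \<noteq> 0 \<and> (\<forall>r s. klein r s (moebius_map a b c d \<tau>) =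
     C * klein (r * of_int a + s * of_int c) (r * of_int b + s * of_int d) \<tau>))"

lemma klein_mat_mult:
  assumes "klein_mat a b c d" "klein_mat a' b' c' d'" "a' * d' - b' * c' = 1"
  shows "klein_mat (a * a' + b * c') (a * b' + b * d') (c * a' + d * c') (c * b' + d * d')"
  unfolding klein_mat_def
proof
  fix \<tau> assume \<tau>: "\<tau> \<in> uhp"
  have det: "a' * d' - b' * c' > 0" using assms(3) by simp
  obtain C where C: "C \<noteq> 0" "\<And>r s. klein r s (moebius_map a' b' c' d' \<tau>) =
     C * klein (r * of_int a' + s * of_int c') (r * of_int b' + s * of_int d') \<tau>"
    using assms(2) \<tau> unfolding klein_mat_def by blast
  obtain C' where C': "C' \<noteq> 0" "\<And>r s. klein r s (moebius_map a b c d (moebius_map a' b' c' d' \<tau>)) =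
     C' * klein (r * of_int a + s * of_int c) (r * of_int b + s * of_int d) (moebius_map a' b' c' d' \<tau>)"
    using assms(1) moebius_in_uhp[OF det \<tau>] unfolding klein_mat_def by blast
  show "\<exists>C. C \<noteq> 0 \<and> (\<forall>r s. klein r s (moebius_map (a * a' + b * c') (a * b' + b * d')
          (c * a' + d * c') (c * b' + d * d') \<tau>) =
     C * klein (r * of_int (a * a' + b * c') + s * of_int (c * a' + d * c'))
       (r * of_int (a * b' + b * d') + s * of_int (c * b' + d * d')) \<tau>)"
  proof (intro exI[of _ "C' * C"] conjI allI)
    show "C' * C \<noteq> 0" using C C' by simp
    fix r s
    show "klein r s (moebius_map (a * a' + b * c') (a * b' + b * d')
          (c * a' + d * c') (c * b' + d * d') \<tau>) =
     C' * C * klein (r * of_int (a * a' + b * c') + s * of_int (c * a' + d * c'))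
       (r * of_int (a * b' + b * d') + s * of_int (c * b' + d * d')) \<tau>"
      unfolding moebius_compose[OF det \<tau>, symmetric] C'(2) C(2) by (simp add: algebra_simps)
  qed
qed

lemma klein_mat_S: "klein_mat 0 (-1) 1 0"
  unfolding klein_mat_def
proof
  fix \<tau> assume \<tau>: "\<tau> \<in> uhp"
  hence [simp]: "\<tau> \<noteq> 0" by (rule uhp_nonzero)
  obtain C where C: "C \<noteq> 0"
    "\<And>u. ee (- (u ^ 2 / (2 * \<tau>))) * Theta (u / \<tau>) (- 1 / \<tau>) = C * Theta u \<tau>"
    using Theta_S[OF \<tau>] by blast
  have "klein r s (- 1 / \<tau>) = C * klein s (- r) \<tau>" for r s
  proof -
    define u where "u = s * \<tau> - r"
    have 1: "r * (- 1 / \<tau>) + s = u / \<tau>"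
      by (simp add: u_def field_simps)
    \<comment> \<open>This holds because \<open>r + u = s * \<tau>\<close>.\<close>
    have "r * (u / \<tau>) / 2 + u ^ 2 / (2 * \<tau>) = s * u / 2"
      by (simp add: u_def power2_eq_square field_simps)
    hence 2: "ee (r * (u / \<tau>) / 2) * ee (u ^ 2 / (2 * \<tau>)) = ee (s * u / 2)"
      by (simp only: flip: ee_add)
    have "Theta (u / \<tau>) (- 1 / \<tau>) = C * ee (u ^ 2 / (2 * \<tau>)) * Theta u \<tau>"
      using C(2)[of u] by (simp add: ee_minus field_simps)
    hence "klein r s (- 1 / \<tau>) = C * (ee (r * (u / \<tau>) / 2) * ee (u ^ 2 / (2 * \<tau>))) * Theta u \<tau>"
      unfolding klein_def 1 by (simp only: mult_ac)
    also have "\<dots> = C * klein s (- r) \<tau>"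
      unfolding 2 klein_def by (simp add: u_def)
    finally show ?thesis .
  qed
  thus "\<exists>C. C \<noteq> 0 \<and> (\<forall>r s. klein r s (moebius_map 0 (-1) 1 0 \<tau>) =
     C * klein (r * of_int 0 + s * of_int 1) (r * of_int (- 1) + s * of_int 0) \<tau>)"
    using C(1) by (intro exI[of _ C]) (simp add: moebius_map_def)
qed

lemma klein_mat_T: "klein_mat 1 m 0 1"
proof -
  have "klein r s (\<tau> + of_int m) = klein r (r * of_int m + s) \<tau>" for r s \<tau>
    by (simp add: klein_def Theta_def ee_add algebra_simps)
  thus ?thesis
    unfolding klein_mat_def by (intro ballI exI[of _ 1]) (simp add: moebius_map_def)
qed

lemma klein_mat_minus_T: "klein_mat (-1) m 0 (-1)"
proof -
  have "klein_mat (-1) 0 0 (-1)"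
    using klein_mat_mult[OF klein_mat_S klein_mat_S] by simp
  from klein_mat_mult[OF klein_mat_T[of "-m"] this] show ?thesis by simp
qed

theorem klein_mat:
  assumes "a * d - b * c = 1"
  shows "klein_mat a b c d"
  using assms
proof (induction "nat \<bar>c\<bar>" arbitrary: a b c d rule: less_induct)
  case less
  show ?case
  proof (cases "c = 0")
    case True
    hence "a * d = 1" using less.prems by simp
    hence "a = 1 \<and> d = 1 \<or> a = -1 \<and> d = -1" by (simp add: zmult_eq_1_iff)
    thus ?thesis using klein_mat_T klein_mat_minus_T True by auto
  next
    case False
    define m where "m = - (d div c)"
    have d': "c * m + d = d mod c"
      by (simp add: m_def minus_div_mult_eq_mod[symmetric] algebra_simps)
    \<comment> \<open>Euclid's algorithm: right multiplication by \<open>T\<^sup>m S\<close> replaces \<open>c\<close> by \<open>d mod c\<close>.\<close>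
    have "klein_mat (a * m + b) (- a) (c * m + d) (- c)"
    proof (rule less.hyps)
      show "nat \<bar>c * m + d\<bar> < nat \<bar>c\<bar>"
        using False abs_mod_less[of c d] unfolding d' by linarith
      show "(a * m + b) * (- c) - (- a) * (c * m + d) = 1"
        using less.prems by (simp add: algebra_simps)
    qed
    \<comment> \<open>The inverse of \<open>T\<^sup>m S\<close>, which undoes the reduction.\<close>
    moreover have "klein_mat 0 1 (-1) m"
    proof -
      have "klein_mat 0 1 (-1) 0"
        using klein_mat_mult[OF klein_mat_S klein_mat_minus_T[of 0]] by simp
      from klein_mat_mult[OF klein_mat_T[of 0] klein_mat_mult[OF this klein_mat_T[of "-m"]]]
      show ?thesis by simp
    qed
    ultimately show ?thesis
      using klein_mat_mult[of "a * m + b" "- a" "c * m + d" "- c" 0 1 "-1" m]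
      by (simp add: algebra_simps)
  qed
qed

section \<open>Klein forms of level 3\<close>

definition z6 :: "int \<Rightarrow> complex" where "z6 k = ee (of_int k / 6)"

lemma z6_add: "z6 (k + l) = z6 k * z6 l"
  by (simp add: z6_def ee_add add_divide_distrib)

lemma z6_diff: "z6 (k - l) = z6 k / z6 l"
  by (simp add: z6_def ee_diff diff_divide_distrib)

lemma z6_nonzero [simp]: "z6 k \<noteq> 0"
  by (simp add: z6_def)

lemma z6_power: "z6 k ^ n = z6 (int n * k)"
  unfolding z6_def ee_of_nat_mult[symmetric] by simp

lemma z6_0 [simp]: "z6 0 = 1"
  by (simp add: z6_def)

lemma z6_eq_1:
  assumes "6 dvd k"
  shows "z6 k = 1"
  using assms by (auto simp: z6_def)

lemma norm_z6 [simp]: "norm (z6 k) = 1"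
  by (simp add: z6_def norm_ee)

definition kk :: "int \<Rightarrow> int \<Rightarrow> complex \<Rightarrow> complex" where
  "kk m n = klein (of_int m / 3) (of_int n / 3)"

lemma kk_minus: "\<tau> \<in> uhp \<Longrightarrow> kk (- m) (- n) \<tau> = - kk m n \<tau>"
  using klein_minus[of \<tau> "of_int m / 3" "of_int n / 3"] by (simp add: kk_def)

lemma z6_step: "- ee (of_int k / 6) = z6 (3 + k)"
  using ee_half by (simp add: z6_def ee_add add_divide_distrib)

lemma iterate_z6:
  assumes "\<And>j. F (j + 1) = z6 k * F j"
  shows "F j = z6 (j * k) * F (0 :: int)"
proof -
  have "F (int i) = z6 (int i * k) * F 0" for i
  proof (induction i)
    case (Suc i)
    have "F (int (Suc i)) = z6 k * F (int i)"
      using assms[of "int i"] by (simp add: add.commute)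
    thus ?case
      by (simp add: Suc z6_add algebra_simps)
  qed simp
  note pos = this
  have "F 0 = z6 (int i * k) * F (- int i)" for i
  proof (induction i)
    case (Suc i)
    have "F (- int i) = z6 k * F (- int (Suc i))"
      using assms[of "- int (Suc i)"] by simp
    thus ?case
      by (simp add: Suc z6_add algebra_simps)
  qed simp
  hence neg: "F (- int i) = z6 (- int i * k) * F 0" for i
  proof -
    have "z6 (- int i * k) * z6 (int i * k) = 1"
      by (simp flip: z6_add)
    thus ?thesis
      using \<open>\<And>i. F 0 = z6 (int i * k) * F (- int i)\<close>[of i] by (metis mult.assoc mult.left_neutral)
  qed
  show ?thesis
    by (cases j rule: int_cases2) (use pos neg in auto)
qed

text \<open>A shift of the first Klein index by 1 multiplies by \<open>- ee (- s / 2)\<close>, a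
  sixth root of unity when \<open>s\<close> is a third of an integer. Together with
  \<open>kk_shift2\<close> this makes \<open>kk\<close> depend only on its indices modulo 3, up to
  sixth roots of unity.\<close>

lemma kk_shift1:
  assumes "\<tau> \<in> uhp"
  shows "kk (m + 3 * j) n \<tau> = z6 (j * (3 - n)) * kk m n \<tau>"
proof -
  have "kk (m + 3 * (j + 1)) n \<tau> = z6 (3 - n) * kk (m + 3 * j) n \<tau>" for j
  proof -
    have "of_int (m + 3 * (j + 1)) / 3 = (of_int (m + 3 * j) / 3 :: complex) + 1"
      by (simp add: field_simps)
    hence "kk (m + 3 * (j + 1)) n \<tau> = klein (of_int (m + 3 * j) / 3 + 1) (of_int n / 3) \<tau>"
      by (simp only: kk_def)
    also have "\<dots> = - ee (of_int (- n) / 6) * kk (m + 3 * j) n \<tau>"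
      unfolding klein_shift1[OF assms] kk_def by simp
    finally show ?thesis
      unfolding z6_step by simp
  qed
  from iterate_z6[of "\<lambda>j. kk (m + 3 * j) n \<tau>", OF this] show ?thesis by simp
qed

lemma kk_shift2: "kk m (n + 3 * j) \<tau> = z6 (j * (3 + m)) * kk m n \<tau>"
proof -
  have "kk m (n + 3 * (j + 1)) \<tau> = z6 (3 + m) * kk m (n + 3 * j) \<tau>" for j
  proof -
    have "of_int (n + 3 * (j + 1)) / 3 = (of_int (n + 3 * j) / 3 :: complex) + 1"
      by (simp add: field_simps)
    hence "kk m (n + 3 * (j + 1)) \<tau> = klein (of_int m / 3) (of_int (n + 3 * j) / 3 + 1) \<tau>"
      by (simp only: kk_def)
    also have "\<dots> = - ee (of_int m / 6) * kk m (n + 3 * j) \<tau>"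
      unfolding klein_shift2 kk_def by simp
    finally show ?thesis
      unfolding z6_step by simp
  qed
  from iterate_z6[of "\<lambda>j. kk m (n + 3 * j) \<tau>", OF this] show ?thesis by simp
qed

lemma kk_nonzero:
  assumes "\<tau> \<in> uhp" "\<not> (3 dvd m \<and> 3 dvd n)"
  shows "kk m n \<tau> \<noteq> 0"
proof
  assume "kk m n \<tau> = 0"
  hence "Theta (of_int m / 3 * \<tau> + of_int n / 3) \<tau> = 0"
    by (simp add: kk_def klein_def)
  then obtain u v :: int where uv: "of_int m / 3 * \<tau> + of_int n / 3 = of_int u + of_int v * \<tau>"
    using Theta_eq_0_iff[OF assms(1)] by blast
  hence "Im (of_int m / 3 * \<tau> + of_int n / 3) = Im (of_int u + of_int v * \<tau>)"
    by simp
  hence "of_int m / 3 * Im \<tau> = of_int v * Im \<tau>" by simp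
  hence m: "of_int m = (of_int (3 * v) :: real)"
    using assms(1) by (simp add: uhp_def)
  hence m: "m = 3 * v" by (simp only: of_int_eq_iff)
  hence "of_int n / 3 = (of_int u :: complex)" using uv by simp
  hence "of_int n = (of_int (3 * u) :: complex)" by simp
  hence "n = 3 * u" by (simp only: of_int_eq_iff)
  with m assms(2) show False by simp
qed

lemma kk_mat:
  assumes "a * d - b * c = 1" "\<tau> \<in> uhp"
  shows "\<exists>C. C \<noteq> 0 \<and> (\<forall>m n. kk m n (moebius_map a b c d \<tau>) = C * kk (m * a + n * c) (m * b + n * d) \<tau>)"
proof -
  obtain C where "C \<noteq> 0" "\<And>r s. klein r s (moebius_map a b c d \<tau>) =
     C * klein (r * of_int a + s * of_int c) (r * of_int b + s * of_int d) \<tau>"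
    using klein_mat[OF assms(1)] assms(2) unfolding klein_mat_def by blast
  thus ?thesis
    by (intro exI[of _ C]) (simp add: kk_def add_divide_distrib)
qed

lemma kk_holomorphic [holomorphic_intros]:
  assumes "f holomorphic_on A" "open A" "\<And>z. z \<in> A \<Longrightarrow> f z \<in> uhp"
  shows "(\<lambda>z. kk m n (f z)) holomorphic_on A"
  unfolding kk_def klein_def by (intro holomorphic_intros assms) auto

text \<open>In terms of the Dedekind eta function, \<open>kap \<tau> = \<eta>(\<tau>/3) / \<eta>(3\<tau>)\<close>.\<close>
definition kap :: "complex \<Rightarrow> complex" where
  "kap \<tau> = - \<i> * of_real (sqrt 3) * kk 1 0 \<tau> / kk 0 1 \<tau>"

lemma kap_holomorphic [holomorphic_intros]:
  assumes "f holomorphic_on A" "open A" "\<And>z. z \<in> A \<Longrightarrow> f z \<in> uhp"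
  shows "(\<lambda>z. kap (f z)) holomorphic_on A"
  unfolding kap_def using kk_nonzero[OF assms(3), of _ 0 1] by (intro holomorphic_intros assms) auto

lemma kap_SL2:
  assumes "a * d - b * c = 1" "\<tau> \<in> uhp"
  shows "kap (moebius_map a b c d \<tau>) = - \<i> * of_real (sqrt 3) * kk a b \<tau> / kk c d \<tau>"
proof -
  obtain C where "C \<noteq> 0" "\<And>m n. kk m n (moebius_map a b c d \<tau>) = C * kk (m * a + n * c) (m * b + n * d) \<tau>"
    using kk_mat[OF assms] by blast
  thus ?thesis by (simp add: kap_def)
qed

text \<open>Modulo 3 the matrix is plus or minus the identity, so the transformed indices return to
  \<open>(s, 0)\<close> and \<open>(0, s)\<close> after shifts by multiples of 3, and the sign
  \<open>s\<close> cancels in the quotient. This is the shape that a matrix of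
  \<open>\<Gamma>\<^sub>0(9)\<close> acquires when \<open>z\<close> is replaced by
  \<open>3 * z\<close>.\<close>

lemma kap_transform:
  assumes det: "a * d - 9 * b * c = 1" and \<tau>: "\<tau> \<in> uhp"
    and s: "s = 1 \<or> s = - 1" "a = s + 3 * j" "d = s + 3 * l"
  shows "kap (moebius_map a (3 * b) (3 * c) d \<tau>) =
           z6 (b * (3 + a) + 3 * j - c * (3 - d) - 3 * l) * kap \<tau>"
proof -
  have "kap (moebius_map a (3 * b) (3 * c) d \<tau>) =
          - \<i> * of_real (sqrt 3) * kk a (3 * b) \<tau> / kk (3 * c) d \<tau>"
    by (rule kap_SL2) (use det \<tau> in auto)
  moreover have "kk a (3 * b) \<tau> = z6 (b * (3 + a)) * (z6 (3 * j) * kk s 0 \<tau>)"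
    using kk_shift2[of a 0 b \<tau>] kk_shift1[OF \<tau>, of s j 0] by (simp add: s(2) mult.commute)
  moreover have "kk (3 * c) d \<tau> = z6 (c * (3 - d)) * (z6 (3 * l) * kk 0 s \<tau>)"
    using kk_shift1[OF \<tau>, of 0 c d] kk_shift2[of 0 s l \<tau>] by (simp add: s(3) mult.commute)
  moreover have "kk s 0 \<tau> / kk 0 s \<tau> = kk 1 0 \<tau> / kk 0 1 \<tau>"
    using s(1) kk_minus[OF \<tau>, of 1 0] kk_minus[OF \<tau>, of 0 1] by auto
  moreover have "x * (A * (B * X)) / (C * (D * Y)) = A * B / C / D * (x * (X / Y))"
    for x A B C D X Y :: complex
    by (simp add: mult_ac)
  ultimately have "kap (moebius_map a (3 * b) (3 * c) d \<tau>) =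
      z6 (b * (3 + a)) * z6 (3 * j) / z6 (c * (3 - d)) / z6 (3 * l) *
        (- \<i> * of_real (sqrt 3) * (kk 1 0 \<tau> / kk 0 1 \<tau>))"
    by metis
  thus ?thesis
    by (simp only: kap_def z6_add[of "b * (3 + a)" "3 * j"] z6_diff times_divide_eq_right)
qed

section \<open>Size of the Klein forms high in the upper half plane\<close>

lemma qprod_bounds:
  assumes "norm q \<le> 1 / 8" "norm x \<le> 1 / 8"
  shows "norm (qprod x q) \<le> 3 / 2" "norm (qprod x q) \<ge> 1 / 2"
proof -
  have "norm (qprod x q - 1) \<le> exp (norm x / (1 - norm q)) - 1"
    by (rule norm_qprod_minus_1_le) (use assms in auto)
  also have "norm x / (1 - norm q) \<le> (1 / 8) / (7 / 8)"
    using assms by (intro frac_le) auto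
  also have "exp ((1 / 8) / (7 / 8) :: real) \<le> 1 + 1 / 7 + (1 / 7) ^ 2"
    using exp_bound[of "1 / 7"] by simp
  finally have "norm (qprod x q - 1) \<le> 1 / 2"
    by (simp add: power2_eq_square)
  moreover have "norm (qprod x q) \<le> norm (qprod x q - 1) + norm (1 :: complex)"
    using norm_triangle_ineq[of "qprod x q - 1" 1] by simp
  moreover have "norm (1 :: complex) \<le> norm (qprod x q - 1) + norm (qprod x q)"
    using norm_triangle_ineq4[of "qprod x q" "qprod x q - 1"] by simp
  ultimately show "norm (qprod x q) \<le> 3 / 2" "norm (qprod x q) \<ge> 1 / 2"
    by auto
qed

lemma exp_le_eighth:
  assumes "y \<ge> 2" "t \<ge> 2 / 3"
  shows "exp (- (pi * y * t)) \<le> 1 / 8"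
proof -
  have "3 * 2 * (2 / 3) \<le> pi * y * t"
    using assms pi_gt3 by (intro mult_mono) auto
  hence "exp 4 \<le> exp (pi * y * t)" by simp
  moreover have "(2 :: real) ^ 4 \<le> exp 1 ^ 4"
    using exp_ge_add_one_self[of 1] by (intro power_mono) auto
  hence "16 \<le> exp (4 :: real)"
    by (simp flip: exp_of_nat_mult)
  ultimately have "8 \<le> exp (pi * y * t)" by linarith
  thus ?thesis
    by (simp add: exp_minus field_simps)
qed

text \<open>With \<open>r = m / 3\<close> the leading factor has norm
  \<open>exp (pi * (r * (1 - r)) * Im \<tau>)\<close>, and \<open>r * (1 - r)\<close> is
  \<open>2 / 9\<close> for \<open>r = 1 / 3\<close> and \<open>r = 2 / 3\<close>, but 0 for
  \<open>r = 0\<close>. The remaining infinite products have norm between 1/2 and 3/2; for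
  \<open>m = 0\<close> the factor \<open>1 - x\<close>, whose norm does not depend on
  \<open>\<tau>\<close>, is set apart.\<close>

lemma kk_growth_reduced:
  assumes m: "m \<in> {0, 1, 2}" and \<tau>: "Im \<tau> \<ge> 2"
  shows "norm (kk m n \<tau>) \<le> 9 / 2 * exp (pi * (2 / 9) * Im \<tau>)"
    and "m \<noteq> 0 \<Longrightarrow> norm (kk m n \<tau>) \<ge> 1 / 4 * exp (pi * (2 / 9) * Im \<tau>)"
    and "m = 0 \<Longrightarrow> norm (kk m n \<tau>) \<ge> 1 / 4 * norm (1 - ee (of_int n / 3))"
proof -
  define r where "r = real_of_int m / 3"
  define q where "q = ee \<tau>"
  define u where "u = of_real r * \<tau> + of_int n / 3"
  define x where "x = ee u"
  have r: "r \<in> {0, 1/3, 2/3}" using m by (auto simp: r_def)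
  have q: "norm q \<le> 1 / 8"
    using exp_le_eighth[of "Im \<tau>" 2] \<tau> by (simp add: q_def norm_ee mult_ac)
  have q1: "norm q < 1" using q by auto
  have nx: "norm x = exp (- (pi * Im \<tau> * (2 * r)))"
    by (simp add: x_def u_def norm_ee mult_ac)
  have nqx: "norm (q / x) = exp (- (pi * Im \<tau> * (2 * (1 - r))))"
    by (simp add: norm_divide nx) (simp add: q_def norm_ee algebra_simps flip: exp_diff)
  have eq: "norm (kk m n \<tau>) = exp (pi * (r * (1 - r)) * Im \<tau>) * norm (th0 x q)"
  proof -
    have m3: "of_int m / 3 = (of_real r :: complex)" by (simp add: r_def)
    have "kk m n \<tau> = ee (of_real r * u / 2) * (ee (- u / 2) * th0 x q)"
      by (simp add: kk_def klein_def Theta_def m3 u_def x_def q_def)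
    hence "norm (kk m n \<tau>) = exp (- 2 * pi * (r * (r * Im \<tau>) / 2)) * exp (- 2 * pi * (- (r * Im \<tau>) / 2)) * norm (th0 x q)"
      by (simp add: norm_mult norm_ee u_def)
    also have "exp (- 2 * pi * (r * (r * Im \<tau>) / 2)) * exp (- 2 * pi * (- (r * Im \<tau>) / 2)) =
        exp (pi * (r * (1 - r)) * Im \<tau>)"
      unfolding exp_add[symmetric] by (simp add: algebra_simps)
    finally show ?thesis .
  qed
  have e1: "exp (pi * (r * (1 - r)) * Im \<tau>) \<le> exp (pi * (2 / 9) * Im \<tau>)"
  proof -
    have "r * (1 - r) \<le> 2 / 9"
    proof -
      consider "r = 0" | "r = 1 / 3" | "r = 2 / 3" using r by blast
      thus ?thesis
      proof cases
        case 2
        show ?thesis unfolding 2 by simp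
      next
        case 3
        show ?thesis unfolding 3 by simp
      qed simp
    qed
    hence "pi * (r * (1 - r)) * Im \<tau> \<le> pi * (2 / 9) * Im \<tau>"
      using \<tau> by (intro mult_right_mono mult_left_mono) auto
    thus ?thesis by (simp only: exp_le_cancel_iff)
  qed
  {
    assume "m \<noteq> 0"
    hence r': "r = 1/3 \<or> r = 2/3" using r by (auto simp: r_def)
    hence "norm x \<le> 1 / 8" "norm (q / x) \<le> 1 / 8"
      unfolding nx nqx using \<tau> by (intro exp_le_eighth; auto)+
    from qprod_bounds[OF q this(1)] qprod_bounds[OF q this(2)]
    have th: "norm (th0 x q) \<le> (3/2) * (3/2)" "norm (th0 x q) \<ge> (1/2) * (1/2)"
      unfolding th0_def norm_mult by (intro mult_mono; simp)+
    have e: "exp (pi * (r * (1 - r)) * Im \<tau>) = exp (pi * (2 / 9) * Im \<tau>)"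
      using r'
    proof
      assume 1: "r = 1 / 3"
      show ?thesis unfolding 1 by simp
    next
      assume 2: "r = 2 / 3"
      show ?thesis unfolding 2 by simp
    qed
    have "norm (kk m n \<tau>) \<ge> 1 / 4 * exp (pi * (2 / 9) * Im \<tau>)"
      using th unfolding eq e by simp
    moreover have "norm (kk m n \<tau>) \<le> 9 / 2 * exp (pi * (2 / 9) * Im \<tau>)"
      using th unfolding eq e by simp
    note calculation this
  } note 1 = this
  {
    assume "m = 0"
    hence r0: "r = 0" by (simp add: r_def)
    have nx1: "norm x = 1" by (simp add: nx r0)
    have "norm (x * q) \<le> 1 / 8" "norm (q / x) \<le> 1 / 8"
      using q by (simp_all add: norm_mult norm_divide nx1)
    from qprod_bounds[OF q this(1)] qprod_bounds[OF q this(2)]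
    have b: "norm (qprod (x * q) q) * norm (qprod (q / x) q) \<le> (3/2) * (3/2)"
       "norm (qprod (x * q) q) * norm (qprod (q / x) q) \<ge> (1/2) * (1/2)"
      by (intro mult_mono; simp)+
    have th: "norm (th0 x q) = norm (1 - x) * (norm (qprod (x * q) q) * norm (qprod (q / x) q))"
      by (simp add: th0_def norm_mult qprod_rec[OF q1, of x])
    have x2: "norm (1 - x) \<le> 2"
      using norm_triangle_ineq4[of 1 x] nx1 by simp
    have "norm (th0 x q) \<le> 2 * (9 / 4)"
      unfolding th using b x2 by (intro mult_mono) auto
    also have "\<dots> \<le> 9 / 2 * exp (pi * (2 / 9) * Im \<tau>)"
      using \<tau> by simp
    finally have "norm (kk m n \<tau>) \<le> 9 / 2 * exp (pi * (2 / 9) * Im \<tau>)"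
      unfolding eq r0 by simp
    moreover have "norm (1 - x) * (1 / 4) \<le> norm (th0 x q)"
      unfolding th using b by (intro mult_left_mono) auto
    hence "norm (kk m n \<tau>) \<ge> 1 / 4 * norm (1 - ee (of_int n / 3))"
      unfolding eq by (simp add: r0 x_def u_def)
    note calculation this
  } note 2 = this
  show "norm (kk m n \<tau>) \<le> 9 / 2 * exp (pi * (2 / 9) * Im \<tau>)"
    using 1 2 by blast
  show "m \<noteq> 0 \<Longrightarrow> norm (kk m n \<tau>) \<ge> 1 / 4 * exp (pi * (2 / 9) * Im \<tau>)"
    using 1 by blast
  show "m = 0 \<Longrightarrow> norm (kk m n \<tau>) \<ge> 1 / 4 * norm (1 - ee (of_int n / 3))"
    using 2 by blast
qed

lemma norm_kk_mod:
  assumes "Im \<tau> \<ge> 2"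
  shows "norm (kk m n \<tau>) = norm (kk (m mod 3) n \<tau>)"
proof -
  have "\<tau> \<in> uhp" using assms by (simp add: uhp_def)
  from kk_shift1[OF this, of "m mod 3" "m div 3" n] show ?thesis
    by (simp add: norm_mult)
qed

lemma mod3_cases: "m mod 3 \<in> {0, 1, 2 :: int}"
proof -
  have "0 \<le> m mod 3" "m mod 3 < 3" by simp_all
  thus ?thesis by auto
qed

lemma kk_ratio_growth:
  assumes "\<not> (3 dvd c \<and> 3 dvd d)"
  shows "\<exists>C. \<forall>\<tau>. Im \<tau> \<ge> 2 \<longrightarrow> norm (kk a b \<tau> / kk c d \<tau>) \<le> C * exp (pi * (2 / 9) * Im \<tau>)"
proof -
  \<comment> \<open>The denominator stays away from 0. If \<open>3 dvd c\<close>, its lower bound is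
    a multiple of \<open>norm (1 - ee (of_int d / 3))\<close>, nonzero because 3 does not divide
    \<open>d\<close>; otherwise it grows.\<close>
  have "\<exists>C>0. \<forall>\<tau>. Im \<tau> \<ge> 2 \<longrightarrow> norm (kk c d \<tau>) \<ge> C"
  proof (cases "3 dvd c")
    case True
    have "ee (of_int d / 3) \<noteq> 1"
    proof
      assume "ee (of_int d / 3) = 1"
      then obtain n where "of_int d / 3 = (of_int n :: complex)"
        unfolding ee_eq_1_iff by blast
      hence "of_int d = (of_int (3 * n) :: complex)" by simp
      hence "d = 3 * n" by (simp only: of_int_eq_iff)
      thus False using True assms by simp
    qed
    moreover have "norm (kk c d \<tau>) \<ge> 1 / 4 * norm (1 - ee (of_int d / 3))" if "Im \<tau> \<ge> 2" for \<tau>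
      using True kk_growth_reduced(3)[OF mod3_cases that, of c d] norm_kk_mod[OF that, of c d]
      by (simp add: mod_eq_0_iff_dvd)
    ultimately show ?thesis
      by (intro exI[of _ "1 / 4 * norm (1 - ee (of_int d / 3))"]) auto
  next
    case False
    have "norm (kk c d \<tau>) \<ge> 1 / 4" if "Im \<tau> \<ge> 2" for \<tau>
    proof -
      have "1 / 4 * exp (pi * (2 / 9) * Im \<tau>) \<le> norm (kk c d \<tau>)"
        using kk_growth_reduced(2)[OF mod3_cases that, of c] False
        by (simp add: norm_kk_mod[OF that, of c] mod_eq_0_iff_dvd)
      moreover have "1 \<le> exp (pi * (2 / 9) * Im \<tau>)" using that by simp
      ultimately show ?thesis by linarith
    qed
    thus ?thesis by (intro exI[of _ "1/4"]) auto
  qed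
  then obtain C where C: "C > 0" "\<And>\<tau>. Im \<tau> \<ge> 2 \<Longrightarrow> norm (kk c d \<tau>) \<ge> C" by blast
  have "norm (kk a b \<tau> / kk c d \<tau>) \<le> 9 / 2 / C * exp (pi * (2 / 9) * Im \<tau>)" if "Im \<tau> \<ge> 2" for \<tau>
  proof -
    have "norm (kk a b \<tau>) / norm (kk c d \<tau>) \<le> (9 / 2 * exp (pi * (2 / 9) * Im \<tau>)) / C"
      using kk_growth_reduced(1)[OF mod3_cases that, of a b] C that
      by (intro frac_le) (auto simp: norm_kk_mod[OF that, of a])
    thus ?thesis by (simp add: norm_divide)
  qed
  thus ?thesis by blast
qed

text \<open>A denominator whose first index is prime to 3 grows at the largest rate possible at
  level 3, so it dominates every numerator; 18 is the quotient of the constants \<open>9 / 2\<close>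
  and \<open>1 / 4\<close>.\<close>

lemma kk_ratio_bounded:
  assumes "\<not> 3 dvd c" "Im \<tau> \<ge> 2"
  shows "norm (kk a b \<tau> / kk c d \<tau>) \<le> 18"
proof -
  have "norm (kk c d \<tau>) \<ge> 1 / 4 * exp (pi * (2 / 9) * Im \<tau>)"
    using kk_growth_reduced(2)[OF mod3_cases assms(2), of c] assms(1)
    by (simp add: norm_kk_mod[OF assms(2), of c] mod_eq_0_iff_dvd)
  moreover have "norm (kk a b \<tau>) \<le> 9 / 2 * exp (pi * (2 / 9) * Im \<tau>)"
    using kk_growth_reduced(1)[OF mod3_cases assms(2), of a b] by (simp add: norm_kk_mod[OF assms(2), of a])
  ultimately have "norm (kk a b \<tau>) / norm (kk c d \<tau>) \<le>
      (9 / 2 * exp (pi * (2 / 9) * Im \<tau>)) / (1 / 4 * exp (pi * (2 / 9) * Im \<tau>))"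
    by (intro frac_le) auto
  thus ?thesis by (simp add: norm_divide)
qed

text \<open>Hermite normal form: the matrix with rows \<open>(m * a, m * b)\<close> and
  \<open>(c, d)\<close> is a matrix of determinant 1 times an upper triangular one. The diagonal
  entry \<open>\<alpha>\<close> is recorded as \<open>gcd m c\<close> because it decides the
  divisibility of \<open>c'\<close> by 3 in \<open>kap_bounded\<close>.\<close>

lemma hecke_decomposition:
  fixes a b c d m :: int
  assumes "a * d - b * c = 1" "m > 0"
  shows "\<exists>a' b' c' d' \<alpha> \<beta> \<delta>. a' * d' - b' * c' = 1 \<and> \<alpha> > 0 \<and> \<delta> > 0 \<and> \<alpha> = gcd m c \<and> c = c' * \<alpha> \<and>
    (\<forall>z\<in>uhp. of_int m * moebius_map a b c d z = moebius_map a' b' c' d' (moebius_map \<alpha> \<beta> 0 \<delta> z))"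
proof -
  define \<alpha> where "\<alpha> = gcd m c"
  have \<alpha>0: "\<alpha> > 0" using assms(2) by (simp add: \<alpha>_def)
  obtain c' where c': "c = \<alpha> * c'" using \<alpha>_def by (meson dvdE gcd_dvd2)
  obtain m' where m': "m = \<alpha> * m'" using \<alpha>_def by (meson dvdE gcd_dvd1)
  have m'0: "m' > 0" using assms(2) \<alpha>0 m' by (simp add: zero_less_mult_iff)
  have "coprime m' c'"
    using \<alpha>0 m' c' unfolding \<alpha>_def by (metis div_gcd_coprime gcd_eq_0_iff less_irrefl nonzero_mult_div_cancel_left)
  moreover have "coprime a c"
  proof (rule coprimeI)
    fix x assume "x dvd a" "x dvd c"
    hence "x dvd a * d - b * c" by simp
    thus "is_unit x" using assms(1) by simp
  qed
  hence "coprime a c'" using c' by simp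
  ultimately have "coprime (a * m') c'" by simp
  \<comment> \<open>The first column \<open>(m * a, c)\<close> divided by \<open>\<alpha>\<close> is
    the primitive vector \<open>(a * m', c')\<close>; Bezout completes it to a matrix of determinant
    1.\<close>
  then obtain d' b0 where bz: "d' * (a * m') + b0 * c' = 1"
    by (metis bezout_int coprime_iff_gcd_eq_1)
  define b' where "b' = - b0"
  \<comment> \<open>Upper entry of the inverse of the completed matrix applied to the second column
    \<open>(m * b, d)\<close>.\<close>
  define \<beta> where "\<beta> = d' * (m * b) - b' * d"
  have det': "(a * m') * d' - b' * c' = 1" using bz by (simp add: b'_def algebra_simps)
  have *: "a * m' * \<beta> + b' * m' = m * b" "c' * \<beta> + d' * m' = d"
  proof -
    have "a * d - b * (\<alpha> * c') = 1" using assms(1) c' by simp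
    hence ad: "m' * (a * d - b * (\<alpha> * c')) = m'" by simp
    have "a * m' * \<beta> + b' * m' = a * m' * (d' * (m * b) - b' * d) + b' * (m' * (a * d - b * (\<alpha> * c')))"
      by (simp add: ad \<beta>_def)
    also have "\<dots> = m * b * (a * m' * d' - b' * c')"
      by (simp add: m' algebra_simps)
    finally show "a * m' * \<beta> + b' * m' = m * b" by (simp add: det')
    have "c' * \<beta> + d' * m' = c' * (d' * (m * b) - b' * d) + d' * (m' * (a * d - b * (\<alpha> * c')))"
      by (simp add: ad \<beta>_def)
    also have "\<dots> = d * (a * m' * d' - b' * c')"
      by (simp add: m' algebra_simps)
    finally show "c' * \<beta> + d' * m' = d" by (simp add: det')
  qed
  have "of_int m * moebius_map a b c d z = moebius_map (a * m') b' c' d' (moebius_map \<alpha> \<beta> 0 m' z)"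
    if z: "z \<in> uhp" for z
  proof -
    have "moebius_map (a * m') b' c' d' (moebius_map \<alpha> \<beta> 0 m' z) =
            moebius_map (a * m' * \<alpha> + b' * 0) (a * m' * \<beta> + b' * m') (c' * \<alpha> + d' * 0) (c' * \<beta> + d' * m') z"
      by (rule moebius_compose[OF _ z]) (use \<alpha>0 m'0 in auto)
    also have "\<dots> = moebius_map (m * a) (m * b) c d z"
      unfolding * by (simp add: m' c' mult_ac)
    finally show ?thesis
      by (simp add: moebius_map_def algebra_simps)
  qed
  moreover have "c = c' * \<alpha>"
    by (subst mult.commute) (rule c')
  ultimately show ?thesis
    using det' \<alpha>0 m'0 \<alpha>_def by blast
qed

section \<open>Behaviour of \<open>kap\<close> at all cusps\<close>

lemma kap_cusp_aux:
  fixes a b c d m :: int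
  assumes "a * d - b * c = 1" "m > 0"
  shows "\<exists>a' b' c' d' \<alpha> \<beta> \<delta>. a' * d' - b' * c' = 1 \<and> \<alpha> > 0 \<and> \<delta> > 0 \<and> \<alpha> = gcd m c \<and> c = c' * \<alpha> \<and>
    (\<forall>z\<in>uhp. kap (of_int m * moebius_map a b c d z) =
       - \<i> * of_real (sqrt 3) * (kk a' b' (moebius_map \<alpha> \<beta> 0 \<delta> z) / kk c' d' (moebius_map \<alpha> \<beta> 0 \<delta> z))) \<and>
    (\<forall>z. Im (moebius_map \<alpha> \<beta> 0 \<delta> z) = of_int \<alpha> / of_int \<delta> * Im z)"
proof -
  obtain a' b' c' d' \<alpha> \<beta> \<delta> where
    *: "a' * d' - b' * c' = 1" "\<alpha> > 0" "\<delta> > 0" "\<alpha> = gcd m c" "c = c' * \<alpha>"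
    "\<forall>z\<in>uhp. of_int m * moebius_map a b c d z = moebius_map a' b' c' d' (moebius_map \<alpha> \<beta> 0 \<delta> z)"
    using hecke_decomposition[OF assms] by blast
  have "\<forall>z\<in>uhp. kap (of_int m * moebius_map a b c d z) =
       - \<i> * of_real (sqrt 3) * (kk a' b' (moebius_map \<alpha> \<beta> 0 \<delta> z) / kk c' d' (moebius_map \<alpha> \<beta> 0 \<delta> z))"
  proof
    fix z assume z: "z \<in> uhp"
    have "moebius_map \<alpha> \<beta> 0 \<delta> z \<in> uhp"
      by (rule moebius_in_uhp) (use *(2,3) z in auto)
    thus "kap (of_int m * moebius_map a b c d z) =
       - \<i> * of_real (sqrt 3) * (kk a' b' (moebius_map \<alpha> \<beta> 0 \<delta> z) / kk c' d' (moebius_map \<alpha> \<beta> 0 \<delta> z))"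
      using *(6) z kap_SL2[OF *(1)] by simp
  qed
  moreover have "\<forall>z. Im (moebius_map \<alpha> \<beta> 0 \<delta> z) = of_int \<alpha> / of_int \<delta> * Im z"
    using *(3) by (simp add: moebius_map_def Im_divide power2_eq_square)
  ultimately show ?thesis
    using *(1-5) by blast
qed

lemma kap_growth:
  fixes a b c d m :: int
  assumes "a * d - b * c = 1" "m > 0"
  shows "\<exists>A B C. \<forall>z. Im z \<ge> B \<longrightarrow> norm (kap (of_int m * moebius_map a b c d z)) \<le> C * exp (A * Im z)"
proof -
  obtain a' b' c' d' \<alpha> \<beta> \<delta> where
    *: "a' * d' - b' * c' = 1" "\<alpha> > 0" "\<delta> > 0" "\<alpha> = gcd m c" "c = c' * \<alpha>"
    "\<And>z. z \<in> uhp \<Longrightarrow> kap (of_int m * moebius_map a b c d z) =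
       - \<i> * of_real (sqrt 3) * (kk a' b' (moebius_map \<alpha> \<beta> 0 \<delta> z) / kk c' d' (moebius_map \<alpha> \<beta> 0 \<delta> z))"
    "\<And>z. Im (moebius_map \<alpha> \<beta> 0 \<delta> z) = of_int \<alpha> / of_int \<delta> * Im z"
    using kap_cusp_aux[OF assms] by blast
  define k where "k = real_of_int \<alpha> / of_int \<delta>"
  have k: "k > 0" using *(2,3) by (simp add: k_def)
  have "\<not> (3 dvd c' \<and> 3 dvd d')"
  proof
    assume "3 dvd c' \<and> 3 dvd d'"
    hence "3 dvd a' * d' - b' * c'" by auto
    thus False using *(1) by simp
  qed
  then obtain C where C: "\<And>\<tau>. Im \<tau> \<ge> 2 \<Longrightarrow> norm (kk a' b' \<tau> / kk c' d' \<tau>) \<le> C * exp (pi * (2 / 9) * Im \<tau>)"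
    using kk_ratio_growth by blast
  have "norm (kap (of_int m * moebius_map a b c d z)) \<le> (sqrt 3 * C) * exp ((pi * (2 / 9) * k) * Im z)"
    if z: "Im z \<ge> 2 / k" for z
  proof -
    have "Im z \<ge> 2 / k" "2 / k > 0" using z k by auto
    hence "Im z > 0" by linarith
    hence "z \<in> uhp" by (simp add: uhp_def)
    moreover have "Im (moebius_map \<alpha> \<beta> 0 \<delta> z) \<ge> 2"
      using z k unfolding *(7) k_def[symmetric] by (simp add: field_simps)
    note C[OF this]
    ultimately have "norm (kap (of_int m * moebius_map a b c d z)) \<le>
        sqrt 3 * (C * exp (pi * (2 / 9) * Im (moebius_map \<alpha> \<beta> 0 \<delta> z)))"
      unfolding *(6)[OF \<open>z \<in> uhp\<close>] norm_mult by simp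
    thus ?thesis
      unfolding *(7) k_def[symmetric] by (simp only: mult_ac)
  qed
  thus ?thesis by blast
qed

text \<open>If 3 divided \<open>c'\<close>, it would divide \<open>c\<close> and hence
  \<open>\<alpha> = gcd m c\<close>, and then 9 would divide \<open>c = c' * \<alpha>\<close>. So
  the first index of the denominator is prime to 3, and the denominator dominates.\<close>

lemma kap_bounded:
  fixes a b c d m :: int
  assumes "a * d - b * c = 1" "m > 0" "3 dvd m" "\<not> 9 dvd c"
  shows "\<exists>B C. \<forall>z. Im z \<ge> B \<longrightarrow> norm (kap (of_int m * moebius_map a b c d z)) \<le> C"
proof -
  obtain a' b' c' d' \<alpha> \<beta> \<delta> where
    *: "a' * d' - b' * c' = 1" "\<alpha> > 0" "\<delta> > 0" "\<alpha> = gcd m c" "c = c' * \<alpha>"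
    "\<And>z. z \<in> uhp \<Longrightarrow> kap (of_int m * moebius_map a b c d z) =
       - \<i> * of_real (sqrt 3) * (kk a' b' (moebius_map \<alpha> \<beta> 0 \<delta> z) / kk c' d' (moebius_map \<alpha> \<beta> 0 \<delta> z))"
    "\<And>z. Im (moebius_map \<alpha> \<beta> 0 \<delta> z) = of_int \<alpha> / of_int \<delta> * Im z"
    using kap_cusp_aux[OF assms(1,2)] by blast
  define k where "k = real_of_int \<alpha> / of_int \<delta>"
  have k: "k > 0" using *(2,3) by (simp add: k_def)
  have c': "\<not> 3 dvd c'"
  proof
    assume "3 dvd c'"
    hence "3 dvd c" using *(5) by simp
    hence "3 dvd \<alpha>" using assms(3) *(4) by simp
    with \<open>3 dvd c'\<close> have "3 * 3 dvd c' * \<alpha>" by (rule mult_dvd_mono)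
    thus False using assms(4) *(5) by simp
  qed
  have "norm (kap (of_int m * moebius_map a b c d z)) \<le> sqrt 3 * 18"
    if z: "Im z \<ge> 2 / k" for z
  proof -
    have "Im z \<ge> 2 / k" "2 / k > 0" using z k by auto
    hence "Im z > 0" by linarith
    hence "z \<in> uhp" by (simp add: uhp_def)
    moreover have "Im (moebius_map \<alpha> \<beta> 0 \<delta> z) \<ge> 2"
      using z k unfolding *(7) k_def[symmetric] by (simp add: field_simps)
    note kk_ratio_bounded[OF c' this]
    ultimately show ?thesis
      unfolding *(6)[OF \<open>z \<in> uhp\<close>] norm_mult by simp
  qed
  thus ?thesis by blast
qed

section \<open>Pullbacks and \<open>q\<close>-expansions\<close>

lemma filterlim_moebius:
  assumes det: "a * d - b * c > 0" and z: "z \<in> uhp"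
  shows "filterlim (moebius_map a b c d) (at (moebius_map a b c d z)) (at z)"
proof -
  let ?g = "moebius_map a b c d"
  have "?g analytic_on {z}"
    using moebius_analytic[OF det] z analytic_on_analytic_at by blast
  hence "?g \<midarrow>z\<rightarrow> ?g z"
    by (intro isContD analytic_at_imp_isCont)
  moreover have "\<forall>\<^sub>F w in at z. ?g w \<noteq> ?g z"
    using eventually_at_in_open[OF open_uhp z]
    by eventually_elim (metis DiffE det insertI1 moebius_inverse z)
  ultimately show ?thesis
    by (simp add: filterlim_at)
qed

text \<open>The field operations on \<open>mero_uhp\<close> are pointwise only off a discrete set,
  so exceptional sets have to be carried back along the Moebius map before a pullback can be shown
  to respect these operations.\<close>

lemma cosparse_moebius:
  assumes "\<forall>\<^sub>\<approx>z\<in>uhp. P z" and det: "a * d - b * c > 0"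
  shows "\<forall>\<^sub>\<approx>z\<in>uhp. P (moebius_map a b c d z)"
  unfolding eventually_cosparse_open_eq[OF open_uhp]
proof
  fix z assume z: "z \<in> uhp"
  have "\<forall>\<^sub>F w in at (moebius_map a b c d z). P w"
    using assms(1) moebius_in_uhp[OF det z] unfolding eventually_cosparse_open_eq[OF open_uhp] by blast
  thus "\<forall>\<^sub>F w in at z. P (moebius_map a b c d w)"
    using filterlim_moebius[OF det z] by (simp add: filterlim_iff)
qed

lemma eval_pullback_cosparse:
  assumes "a * d - b * c > 0"
  shows "\<forall>\<^sub>\<approx>z\<in>uhp. eval_uhp (pullback a b c d f) z = eval_uhp f (moebius_map a b c d z)"
  using eventually_in_uhp by eventually_elim (rule eval_pullback[OF assms])

lemma mero_of_eqI:
  assumes "f meromorphic_on uhp" "\<forall>\<^sub>\<approx>z\<in>uhp. eval_uhp F z = f z"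
  shows "F = mero_of f"
  by (rule mero_uhp_eqI) (use assms(2) eval_mero_of_cosparse[OF assms(1)] in \<open>eventually_elim, simp\<close>)

lemma mero_of_add:
  assumes "f meromorphic_on uhp" "g meromorphic_on uhp"
  shows "mero_of f + mero_of g = mero_of (\<lambda>z. f z + g z)"
  by (rule mero_of_eqI, intro meromorphic_intros assms)
     (use eval_plus_cosparse[of "mero_of f" "mero_of g"] eval_mero_of_cosparse[OF assms(1)]
        eval_mero_of_cosparse[OF assms(2)] in \<open>eventually_elim, simp\<close>)

lemma mero_of_mult:
  assumes "f meromorphic_on uhp" "g meromorphic_on uhp"
  shows "mero_of f * mero_of g = mero_of (\<lambda>z. f z * g z)"
  by (rule mero_of_eqI, intro meromorphic_intros assms)
     (use eval_times_cosparse[of "mero_of f" "mero_of g"] eval_mero_of_cosparse[OF assms(1)]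
        eval_mero_of_cosparse[OF assms(2)] in \<open>eventually_elim, simp\<close>)

lemma pullback_add:
  assumes "a * d - b * c > 0"
  shows "pullback a b c d (f + g) = pullback a b c d f + pullback a b c d g"
  by (rule mero_uhp_eqI)
     (use eval_pullback_cosparse[OF assms, of "f + g"] eval_pullback_cosparse[OF assms, of f]
        eval_pullback_cosparse[OF assms, of g] cosparse_moebius[OF eval_plus_cosparse[of f g] assms]
        eval_plus_cosparse[of "pullback a b c d f" "pullback a b c d g"] in \<open>eventually_elim, simp\<close>)

lemma pullback_mult:
  assumes "a * d - b * c > 0"
  shows "pullback a b c d (f * g) = pullback a b c d f * pullback a b c d g"
  by (rule mero_uhp_eqI)
     (use eval_pullback_cosparse[OF assms, of "f * g"] eval_pullback_cosparse[OF assms, of f]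
        eval_pullback_cosparse[OF assms, of g] cosparse_moebius[OF eval_times_cosparse[of f g] assms]
        eval_times_cosparse[of "pullback a b c d f" "pullback a b c d g"] in \<open>eventually_elim, simp\<close>)

lemma pullback_uminus:
  assumes "a * d - b * c > 0"
  shows "pullback a b c d (- f) = - pullback a b c d f"
  by (rule mero_uhp_eqI)
     (use eval_pullback_cosparse[OF assms, of "- f"] eval_pullback_cosparse[OF assms, of f]
        cosparse_moebius[OF eval_uminus_cosparse[of f] assms]
        eval_uminus_cosparse[of "pullback a b c d f"] in \<open>eventually_elim, simp\<close>)

lemma pullback_inverse:
  assumes "a * d - b * c > 0"
  shows "pullback a b c d (inverse f) = inverse (pullback a b c d f)"
  by (rule mero_uhp_eqI)
     (use eval_pullback_cosparse[OF assms, of "inverse f"] eval_pullback_cosparse[OF assms, of f]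
        cosparse_moebius[OF eval_inverse_cosparse[of f] assms]
        eval_inverse_cosparse[of "pullback a b c d f"] in \<open>eventually_elim, simp\<close>)

section \<open>Constant functions\<close>

definition cm :: "complex \<Rightarrow> mero_uhp" where "cm c = mero_of (\<lambda>_. c)"

lemma eval_mero_of_holomorphic:
  assumes "f holomorphic_on uhp" "z \<in> uhp"
  shows "eval_uhp (mero_of f) z = f z"
  using assms by (intro eval_mero_of_nicely analytic_on_imp_nicely_meromorphic_on)
    (auto simp: analytic_on_open)

lemma eval_cm: "z \<in> uhp \<Longrightarrow> eval_uhp (cm c) z = c"
  unfolding cm_def by (rule eval_mero_of_holomorphic) auto

lemma eval_cm_cosparse: "\<forall>\<^sub>\<approx>z\<in>uhp. eval_uhp (cm c) z = c"
  using eventually_in_uhp by eventually_elim (rule eval_cm)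

lemma cm_0 [simp]: "cm 0 = 0" by (simp add: cm_def zero_mero_uhp_def)
lemma cm_1 [simp]: "cm 1 = 1" by (simp add: cm_def one_mero_uhp_def)
lemma cm_add: "cm (a + b) = cm a + cm b"
  unfolding cm_def by (rule mero_of_add[symmetric]) auto
lemma cm_mult: "cm (a * b) = cm a * cm b"
  unfolding cm_def by (rule mero_of_mult[symmetric]) auto
lemma cm_minus: "cm (- a) = - cm a"
  using cm_add[of a "- a"] by (simp add: eq_neg_iff_add_eq_0 add.commute)
lemma cm_inverse: "cm (inverse a) = inverse (cm a)"
proof (cases "a = 0")
  case False
  hence "cm a * cm (inverse a) = 1" by (simp flip: cm_mult)
  thus ?thesis by (simp add: inverse_unique)
qed simp
lemma cm_of_nat: "cm (of_nat n) = of_nat n"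
  by (induction n) (auto simp: cm_add)
lemma cm_of_int: "cm (of_int n) = of_int n"
  by (cases n rule: int_cases2) (auto simp: cm_of_nat cm_minus)
lemma cm_of_rat: "cm (of_rat r) = of_rat r"
  by (cases r) (simp add: of_rat_rat divide_inverse cm_mult cm_inverse cm_of_int)

lemma pullback_cm:
  assumes "a * d - b * c > 0"
  shows "pullback a b c d (cm k) = cm k"
  by (rule mero_uhp_eqI)
     (use eval_pullback_cosparse[OF assms, of "cm k"] eval_cm_cosparse[of k]
        cosparse_moebius[OF eval_cm_cosparse[of k] assms] in \<open>eventually_elim, simp\<close>)

lemma pullback_mero_of:
  assumes "a * d - b * c > 0" "f holomorphic_on uhp"
  shows "pullback a b c d (mero_of f) = mero_of (\<lambda>z. f (moebius_map a b c d z))"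
proof (rule mero_of_eqI)
  have "moebius_map a b c d holomorphic_on uhp"
    using moebius_analytic[OF assms(1)] by (rule analytic_imp_holomorphic)
  hence "(f \<circ> moebius_map a b c d) holomorphic_on uhp"
    using assms moebius_in_uhp by (intro holomorphic_on_compose_gen[of _ _ _ uhp]) auto
  thus "(\<lambda>z. f (moebius_map a b c d z)) meromorphic_on uhp"
    by (auto simp: o_def analytic_on_open intro!: analytic_on_imp_meromorphic_on)
  show "\<forall>\<^sub>\<approx>z\<in>uhp. eval_uhp (pullback a b c d (mero_of f)) z = f (moebius_map a b c d z)"
    using eventually_in_uhp by eventually_elim
      (simp add: eval_pullback[OF assms(1)] eval_mero_of_holomorphic[OF assms(2)]
         moebius_in_uhp[OF assms(1)])
qed

section \<open>Arithmetic of \<open>q\<close>-expansions\<close>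

lemma norm_ee_div: "h > 0 \<Longrightarrow> norm (ee (z / of_nat h)) = exp (- 2 * pi * Im z / real h)"
  by (simp add: norm_ee)

lemma has_q_expansion_iff:
  "has_q_expansion h f F \<longleftrightarrow> (\<exists>G. G has_laurent_expansion F \<and>
     (\<exists>B. \<forall>z. Im z \<ge> B \<longrightarrow> eval_uhp f z = G (ee (z / of_nat h))))"
  unfolding has_q_expansion_def eventually_filtercomap_at_top_linorder
  by (simp add: ee_def)

lemma ee_surj:
  assumes "q \<noteq> 0" "h > 0"
  obtains z where "ee (z / of_nat h) = q" "Im z = - real h * ln (norm q) / (2 * pi)"
proof
  define z where "z = of_nat h * Ln q / (2 * of_real pi * \<i>)"
  have "2 * of_real pi * \<i> * (z / of_nat h) = Ln q"
    using assms by (simp add: z_def)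
  thus "ee (z / of_nat h) = q"
    unfolding ee_def using assms by simp
  have "z = of_real (real h / (2 * pi)) * (- \<i> * Ln q)"
    using assms by (simp add: z_def field_simps)
  also have "Im \<dots> = - real h * ln (norm q) / (2 * pi)"
    using assms by (simp add: Re_Ln)
  finally show "Im z = - real h * ln (norm q) / (2 * pi)" .
qed

text \<open>Under \<open>ee (z / of_nat h)\<close> the half planes \<open>Im z \<ge> B\<close>
  correspond to punctured discs about 0; this lemma and \<open>Im_imp_eventually_at_0\<close>
  translate between the two.\<close>

lemma eventually_at_0_imp_Im:
  assumes "\<forall>\<^sub>F q in at (0 :: complex). P q" "h > 0"
  shows "\<exists>B>0. \<forall>z. Im z \<ge> B \<longrightarrow> P (ee (z / of_nat h))"
proof -
  obtain r where r: "r > 0" "\<And>q. q \<noteq> 0 \<Longrightarrow> norm q < r \<Longrightarrow> P q"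
    using assms(1) by (auto simp: eventually_at)
  define B where "B = 1 + real h * \<bar>ln r\<bar>"
  have "P (ee (z / of_nat h))" if "Im z \<ge> B" for z
  proof (rule r(2))
    have "\<bar>ln r\<bar> < Im z / real h"
      using that assms(2) by (simp add: B_def field_simps)
    also have "\<dots> \<le> 2 * pi * (Im z / real h)"
    proof -
      have "0 \<le> real h * \<bar>ln r\<bar>" by simp
      hence "0 \<le> Im z" using that unfolding B_def by linarith
      thus ?thesis using pi_gt3 mult_right_mono[of 1 "2 * pi" "Im z / real h"] by simp
    qed
    finally have "- 2 * pi * Im z / real h < ln r" by simp
    hence "exp (- 2 * pi * Im z / real h) < exp (ln r)" by (simp only: exp_less_cancel_iff)
    thus "norm (ee (z / of_nat h)) < r"
      using r(1) assms(2) by (simp add: norm_ee_div)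
  qed simp
  moreover have "B > 0" by (simp add: B_def add_pos_nonneg)
  ultimately show ?thesis by blast
qed

lemma Im_imp_eventually_at_0:
  assumes "\<And>z. Im z \<ge> B \<Longrightarrow> P (ee (z / of_nat h))" "h > 0"
  shows "\<forall>\<^sub>F q in at (0 :: complex). P q"
proof -
  define r where "r = exp (- 2 * pi * B / real h)"
  have "P q" if q: "q \<noteq> 0" "norm q < r" for q
  proof -
    obtain z where z: "ee (z / of_nat h) = q" using ee_surj[OF q(1) assms(2)] by metis
    have "exp (- 2 * pi * Im z / real h) < exp (- 2 * pi * B / real h)"
      using norm_ee_div[OF assms(2), of z] q(2) z by (simp add: r_def)
    hence "Im z > B" using assms(2) by (simp add: divide_less_cancel)
    thus ?thesis using assms(1)[of z] z by simp
  qed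
  thus ?thesis unfolding eventually_at by (intro exI[of _ r]) (auto simp: r_def)
qed

text \<open>Identities obtained from the field operations hold off a discrete set only, while the
  definition asks for equality at every point high up. There \<open>G\<close> is analytic, so
  \<open>eval_uhp f\<close> has a finite limit, hence no pole, and by the normalisation it takes the
  limit as its value.\<close>

lemma has_q_expansionI:
  assumes h: "h > 0" and G: "G has_laurent_expansion F"
    and ev: "\<forall>\<^sub>\<approx>z\<in>uhp. Im z \<ge> B \<longrightarrow> eval_uhp f z = G (ee (z / of_nat h))"
  shows "has_q_expansion h f F"
proof -
  obtain r where r: "r > 0" "G analytic_on ball 0 r - {0}"
    using has_laurent_expansion_isolated_0[OF G] by (auto simp: isolated_singularity_at_def)
  have "\<forall>\<^sub>F q in at 0. q \<in> ball 0 r - {0}"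
    using r(1) eventually_at_in_open[of "ball 0 r" 0] by simp
  then obtain B' where B': "B' > 0" "\<And>z. Im z \<ge> B' \<Longrightarrow> ee (z / of_nat h) \<in> ball 0 r - {0}"
    using eventually_at_0_imp_Im[of "\<lambda>q. q \<in> ball 0 r - {0}" h] h by blast
  have "eval_uhp f z = G (ee (z / of_nat h))" if z: "Im z \<ge> 1 + max B B'" for z
  proof -
    have zu: "z \<in> uhp" using z B'(1) by (simp add: uhp_def)
    have "(\<lambda>w. ee (w / of_nat h)) analytic_on {z}"
      using h unfolding ee_def by (intro analytic_intros) auto
    moreover have "G analytic_on {ee (z / of_nat h)}"
      using analytic_on_subset[OF r(2)] B'(2)[of z] z by auto
    ultimately have "(G \<circ> (\<lambda>w. ee (w / of_nat h))) analytic_on {z}"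
      by (intro analytic_on_compose_gen[where T = "{ee (z / of_nat h)}"]) auto
    hence lim: "(\<lambda>w. G (ee (w / of_nat h))) \<midarrow>z\<rightarrow> G (ee (z / of_nat h))"
      using analytic_at_imp_isCont by (force simp: isCont_def o_def)
    have "open {w. Im w > max B B'}" by (rule open_halfspace_Im_gt)
    hence "\<forall>\<^sub>F w in at z. w \<in> {w. Im w > max B B'}"
      by (rule eventually_at_in_open') (use z in auto)
    moreover have "\<forall>\<^sub>F w in at z. Im w \<ge> B \<longrightarrow> eval_uhp f w = G (ee (w / of_nat h))"
      using ev zu unfolding eventually_cosparse_open_eq[OF open_uhp] by blast
    ultimately have "\<forall>\<^sub>F w in at z. G (ee (w / of_nat h)) = eval_uhp f w"
      by eventually_elim auto
    hence lim': "eval_uhp f \<midarrow>z\<rightarrow> G (ee (z / of_nat h))"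
      using lim by (rule Lim_transform_eventually[rotated])
    hence "\<not> is_pole (eval_uhp f) z"
      unfolding is_pole_def using not_tendsto_and_filterlim_at_infinity[OF _ lim'] by auto
    hence "eval_uhp f \<midarrow>z\<rightarrow> eval_uhp f z"
      using eval_uhp_nicely_meromorphic[of f] zu by (auto simp: nicely_meromorphic_on_def)
    with lim' show ?thesis by (metis LIM_unique)
  qed
  thus ?thesis unfolding has_q_expansion_iff using G by blast
qed

lemma has_q_expansion_unique:
  assumes "has_q_expansion h f F" "has_q_expansion h f F'" "h > 0"
  shows "F = F'"
proof -
  obtain G B where G: "G has_laurent_expansion F" "\<And>z. Im z \<ge> B \<Longrightarrow> eval_uhp f z = G (ee (z / of_nat h))"
    using assms(1) unfolding has_q_expansion_iff by blast
  obtain G' B' where G': "G' has_laurent_expansion F'" "\<And>z. Im z \<ge> B' \<Longrightarrow> eval_uhp f z = G' (ee (z / of_nat h))"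
    using assms(2) unfolding has_q_expansion_iff by blast
  have "\<forall>\<^sub>F q in at 0. G q = G' q"
    by (rule Im_imp_eventually_at_0[OF _ assms(3), of "max B B'"]) (use G(2) G'(2) in force)
  hence "G has_laurent_expansion F'"
    using G'(1) has_laurent_expansion_cong by blast
  thus ?thesis using G(1) has_laurent_expansion_unique by blast
qed

lemma has_q_expansion_cm: "has_q_expansion h (cm c) (fls_const c)"
proof -
  have "\<forall>z. Im z \<ge> 1 \<longrightarrow> eval_uhp (cm c) z = c"
    by (auto simp: eval_cm uhp_def)
  thus ?thesis unfolding has_q_expansion_iff
    by (intro exI[of _ "\<lambda>_. c"] conjI has_laurent_expansion_const exI[of _ 1])
qed

lemma has_q_expansion_add:
  assumes "has_q_expansion h f F" "has_q_expansion h g G" "h > 0"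
  shows "has_q_expansion h (f + g) (F + G)"
proof -
  obtain u B where u: "u has_laurent_expansion F" "\<And>z. Im z \<ge> B \<Longrightarrow> eval_uhp f z = u (ee (z / of_nat h))"
    using assms(1) unfolding has_q_expansion_iff by blast
  obtain v B' where v: "v has_laurent_expansion G" "\<And>z. Im z \<ge> B' \<Longrightarrow> eval_uhp g z = v (ee (z / of_nat h))"
    using assms(2) unfolding has_q_expansion_iff by blast
  show ?thesis
  proof (rule has_q_expansionI[OF assms(3) has_laurent_expansion_add[OF u(1) v(1)], of "max B B'"])
    show "\<forall>\<^sub>\<approx>z\<in>uhp. max B B' \<le> Im z \<longrightarrow> eval_uhp (f + g) z = u (ee (z / of_nat h)) + v (ee (z / of_nat h))"
      using eval_plus_cosparse[of f g] by eventually_elim (simp add: u(2) v(2))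
  qed
qed

lemma has_q_expansion_mult:
  assumes "has_q_expansion h f F" "has_q_expansion h g G" "h > 0"
  shows "has_q_expansion h (f * g) (F * G)"
proof -
  obtain u B where u: "u has_laurent_expansion F" "\<And>z. Im z \<ge> B \<Longrightarrow> eval_uhp f z = u (ee (z / of_nat h))"
    using assms(1) unfolding has_q_expansion_iff by blast
  obtain v B' where v: "v has_laurent_expansion G" "\<And>z. Im z \<ge> B' \<Longrightarrow> eval_uhp g z = v (ee (z / of_nat h))"
    using assms(2) unfolding has_q_expansion_iff by blast
  show ?thesis
  proof (rule has_q_expansionI[OF assms(3) has_laurent_expansion_mult[OF u(1) v(1)], of "max B B'"])
    show "\<forall>\<^sub>\<approx>z\<in>uhp. max B B' \<le> Im z \<longrightarrow> eval_uhp (f * g) z = u (ee (z / of_nat h)) * v (ee (z / of_nat h))"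
      using eval_times_cosparse[of f g] by eventually_elim (simp add: u(2) v(2))
  qed
qed

lemma has_q_expansion_inverse:
  assumes "has_q_expansion h f F" "h > 0"
  shows "has_q_expansion h (inverse f) (inverse F)"
proof -
  obtain u B where u: "u has_laurent_expansion F" "\<And>z. Im z \<ge> B \<Longrightarrow> eval_uhp f z = u (ee (z / of_nat h))"
    using assms(1) unfolding has_q_expansion_iff by blast
  show ?thesis
  proof (rule has_q_expansionI[OF assms(2) has_laurent_expansion_inverse[OF u(1)], of B])
    show "\<forall>\<^sub>\<approx>z\<in>uhp. B \<le> Im z \<longrightarrow> eval_uhp (inverse f) z = inverse (u (ee (z / of_nat h)))"
      using eval_inverse_cosparse[of f] by eventually_elim (simp add: u(2))
  qed
qed

lemma has_q_expansion_uminus: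
  assumes "has_q_expansion h f F" "h > 0"
  shows "has_q_expansion h (- f) (- F)"
  using has_q_expansion_mult[OF has_q_expansion_cm[of h "-1"] assms] assms(2)
  by (simp add: cm_minus)

lemma has_q_expansion_power:
  assumes "has_q_expansion h f F" "h > 0"
  shows "has_q_expansion h (f ^ n) (F ^ n)"
proof (induction n)
  case 0
  show ?case using has_q_expansion_cm[of h 1] by simp
next
  case (Suc n)
  show ?case using has_q_expansion_mult[OF assms(1) Suc assms(2)] by simp
qed

lemma has_q_expansion_sum:
  assumes "\<And>i. i \<in> I \<Longrightarrow> has_q_expansion h (f i) (F i)" "h > 0"
  shows "has_q_expansion h (\<Sum>i\<in>I. f i) (\<Sum>i\<in>I. F i)"
  using assms(1)
proof (induction I rule: infinite_finite_induct)
  case (insert i I)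
  thus ?case using has_q_expansion_add[of h "f i" "F i"] assms(2) by simp
qed (use has_q_expansion_cm[of h 0] in auto)

text \<open>Identity theorem: the zeros of a nonzero function are isolated, but a zero expansion
  makes it vanish on a half plane.\<close>

lemma has_q_expansion_0_imp:
  assumes "has_q_expansion h f 0" "h > 0"
  shows "f = 0"
proof (rule ccontr)
  assume "f \<noteq> 0"
  obtain u B where u: "u has_laurent_expansion 0" "\<And>z. Im z \<ge> B \<Longrightarrow> eval_uhp f z = u (ee (z / of_nat h))"
    using assms(1) unfolding has_q_expansion_iff by blast
  have "\<forall>\<^sub>F q in at 0. u q = 0"
    using u(1) by (auto simp: has_laurent_expansion_def elim: eventually_mono)
  from eventually_at_0_imp_Im[OF this assms(2)] obtain B' where
    B': "B' > 0" "\<And>z. Im z \<ge> B' \<Longrightarrow> u (ee (z / of_nat h)) = 0" by blast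
  have "\<not> (\<forall>\<^sub>\<approx>z\<in>uhp. eval_uhp f z = 0)"
  proof
    assume "\<forall>\<^sub>\<approx>z\<in>uhp. eval_uhp f z = 0"
    hence "\<forall>\<^sub>\<approx>z\<in>uhp. eval_uhp f z = eval_uhp 0 z"
      using eval_zero_cosparse by eventually_elim simp
    hence "f = 0"
      by (rule mero_uhp_eqI)
    with \<open>f \<noteq> 0\<close> show False by contradiction
  qed
  hence "\<forall>\<^sub>\<approx>z\<in>uhp. eval_uhp f z \<noteq> 0"
    using meromorphic_imp_constant_or_avoid[OF eval_uhp_meromorphic[of f] open_uhp connected_uhp]
    by blast
  moreover define z0 where "z0 = \<i> * of_real (max B B' + 1)"
  have "z0 \<in> uhp" using B'(1) by (simp add: z0_def uhp_def)
  ultimately have "\<forall>\<^sub>F w in at z0. eval_uhp f w \<noteq> 0"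
    unfolding eventually_cosparse_open_eq[OF open_uhp] by blast
  moreover have "\<forall>\<^sub>F w in at z0. w \<in> {w. Im w > max B B'}"
    by (rule eventually_at_in_open', rule open_halfspace_Im_gt) (simp add: z0_def less_max_iff_disj max_def)
  ultimately have "\<forall>\<^sub>F w in at z0. False"
    by eventually_elim (use u(2) B'(2) in auto)
  thus False by simp
qed

text \<open>Periodicity makes \<open>f\<close> a function of \<open>q = ee (z / of_nat h)\<close> on
  a punctured disc, and boundedness makes the singularity at \<open>q = 0\<close> removable.\<close>

lemma periodic_lift:
  fixes f :: "complex \<Rightarrow> complex"
  assumes hol: "f holomorphic_on {z. Im z > B}"
    and per: "\<And>z. Im z > B \<Longrightarrow> f (z + of_nat h) = f z"
    and bd: "\<And>z. Im z \<ge> B' \<Longrightarrow> norm (f z) \<le> C" and h: "h > 0"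
  shows "\<exists>G. G holomorphic_on ball 0 (exp (- 2 * pi * B / real h)) \<and>
           (\<forall>z. Im z > B \<longrightarrow> f z = G (ee (z / of_nat h)))"
proof -
  define r where "r = exp (- 2 * pi * B / real h)"
  have r: "r > 0" by (simp add: r_def)
  have nat: "f (z + of_nat k * of_nat h) = f z" if "Im z > B" for z k
  proof (induction k)
    case (Suc k)
    have "f (z + of_nat (Suc k) * of_nat h) = f ((z + of_nat k * of_nat h) + of_nat h)"
      by (simp add: algebra_simps)
    thus ?case using Suc per[of "z + of_nat k * of_nat h"] that by simp
  qed simp
  have int: "f (z + of_int k * of_nat h) = f z" if "Im z > B" for z k
  proof (cases "k \<ge> 0")
    case True
    thus ?thesis using nat[OF that, of "nat k"] by simp
  next
    case False
    thus ?thesis using nat[of "z + of_int k * of_nat h" "nat (- k)"] that by simp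
  qed
  define G where "G q = f (of_nat h * Ln q / (2 * of_real pi * \<i>))" for q
  have G: "f z = G (ee (z / of_nat h))" if z: "Im z > B" for z
  proof -
    have "exp (2 * of_real pi * \<i> * (z / of_nat h)) \<noteq> 0" by simp
    define L where "L = Ln (ee (z / of_nat h))"
    define w where "w = L / (2 * of_real pi * \<i>)"
    have "ee w = ee (z / of_nat h)"
      by (simp add: ee_def w_def L_def)
    then obtain k where k: "w = z / of_nat h + of_int k"
      unfolding ee_eq_iff by blast
    have "of_nat h * L / (2 * of_real pi * \<i>) = of_nat h * w"
      by (simp add: w_def)
    also have "\<dots> = z + of_int k * of_nat h"
      using h by (simp add: k field_simps)
    finally show ?thesis
      using int[OF z, of k] by (simp add: G_def L_def)
  qed
  have "G analytic_on {q0}" if q0: "q0 \<in> ball 0 r - {0}" for q0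
  proof -
    \<comment> \<open>A branch of the logarithm that is holomorphic near \<open>q0\<close>; the
      principal branch alone is discontinuous on the negative real axis.\<close>
    define l where "l q = of_nat h * (Ln (q / q0) + Ln q0) / (2 * of_real pi * \<i>)" for q
    define U where "U = {q. q / q0 \<notin> \<real>\<^sub>\<le>\<^sub>0} \<inter> (ball 0 r - {0})"
    have cont: "continuous_on UNIV (\<lambda>q. q / q0)"
      using q0 by (intro continuous_intros) auto
    have "open ((\<lambda>q. q / q0) -` (- \<real>\<^sub>\<le>\<^sub>0))"
      using cont by (intro open_vimage) (auto simp: open_Compl)
    moreover have "(\<lambda>q. q / q0) -` (- \<real>\<^sub>\<le>\<^sub>0) = {q. q / q0 \<notin> \<real>\<^sub>\<le>\<^sub>0}" by auto
    ultimately have U: "open U" unfolding U_def by (intro open_Int open_Diff) auto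
    have q0U: "q0 \<in> U" using q0 by (auto simp: U_def)
    have ee_l: "ee (l q / of_nat h) = q" if "q \<in> U" for q
    proof -
      have "2 * of_real pi * \<i> * (l q / of_nat h) = Ln (q / q0) + Ln q0"
        using h by (simp add: l_def)
      hence "ee (l q / of_nat h) = exp (Ln (q / q0)) * exp (Ln q0)"
        by (simp add: ee_def exp_add)
      thus ?thesis using that q0 by (auto simp: U_def)
    qed
    have Im_l: "Im (l q) > B" if "q \<in> U" for q
    proof -
      have "exp (- 2 * pi * Im (l q) / real h) = norm q"
        using norm_ee_div[OF h, of "l q"] ee_l[OF that] by simp
      also have "\<dots> < exp (- 2 * pi * B / real h)"
        using that by (simp add: U_def r_def)
      finally show ?thesis using h by (simp add: divide_less_cancel)
    qed
    have "l holomorphic_on U"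
      unfolding l_def[abs_def] using q0 by (intro holomorphic_intros) (auto simp: U_def)
    hence "(f \<circ> l) holomorphic_on U"
      using hol by (rule holomorphic_on_compose_gen) (use Im_l in auto)
    moreover have "(f \<circ> l) q = G q" if "q \<in> U" for q
      using G[OF Im_l[OF that]] ee_l[OF that] by simp
    ultimately have "G holomorphic_on U"
      using holomorphic_cong by (metis (no_types, lifting))
    thus ?thesis using U q0U analytic_on_open analytic_on_subset by (metis empty_subsetI insert_subset)
  qed
  hence "G analytic_on ball 0 r - {0}"
    using analytic_on_analytic_at by blast
  hence Ghol: "G holomorphic_on ball 0 r - {0}"
    by (rule analytic_imp_holomorphic)
  have "\<forall>\<^sub>F q in at 0. norm (G q) \<le> C"
  proof (rule Im_imp_eventually_at_0[OF _ h])
    show "norm (G (ee (z / of_nat h))) \<le> C" if "Im z \<ge> max B' (B + 1)" for z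
      using bd[of z] G[of z] that by simp
  qed
  then obtain G' where G': "G' holomorphic_on ball 0 r" "\<And>q. q \<in> ball 0 r - {0} \<Longrightarrow> G' q = G q"
    using holomorphic_on_extend_bounded[OF Ghol] r by (auto simp: interior_open)
  have "f z = G' (ee (z / of_nat h))" if "Im z > B" for z
  proof -
    have "norm (ee (z / of_nat h)) < r"
      unfolding norm_ee_div[OF h] r_def using that h by (simp add: divide_strict_right_mono)
    thus ?thesis using G[OF that] G'(2)[of "ee (z / of_nat h)"] by simp
  qed
  thus ?thesis using G'(1) unfolding r_def by blast
qed

text \<open>A substitute for the existence of an expansion: it passes through upper triangular
  pullbacks, and for periodic functions it is equivalent to having an expansion. Holomorphy above
  some height excludes poles accumulating at the cusp.\<close>

definition mod_growth :: "mero_uhp \<Rightarrow> bool" where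
  "mod_growth f \<longleftrightarrow> (\<exists>A B C. B > 0 \<and> eval_uhp f holomorphic_on {z. Im z > B} \<and>
     (\<forall>z. Im z > B \<longrightarrow> norm (eval_uhp f z) \<le> C * exp (A * Im z)))"

lemma fls_bound:
  assumes "G has_laurent_expansion F"
  shows "\<exists>C n. \<forall>\<^sub>F q in at 0. norm (G q) \<le> C * norm (1 / q ^ n)"
proof -
  define n where "n = nat (- fls_subdegree F)"
  have sub: "fls_subdegree (fls_shift (- int n) F) \<ge> 0"
    by (cases "F = 0") (auto simp: n_def)
  have "(\<lambda>q. G q * q powi int n) \<midarrow>0\<rightarrow> fls_nth (fls_shift (- int n) F) 0"
    by (rule has_laurent_expansion_imp_tendsto_0[OF has_laurent_expansion_shift[OF assms] sub])
  hence "(\<lambda>q. norm (G q * q ^ n)) \<midarrow>0\<rightarrow> norm (fls_nth (fls_shift (- int n) F) 0)"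
    by (intro tendsto_norm) simp
  hence "\<forall>\<^sub>F q in at 0. norm (G q * q ^ n) < norm (fls_nth (fls_shift (- int n) F) 0) + 1"
    by (rule order_tendstoD) simp
  moreover have "\<forall>\<^sub>F q in at (0::complex). q \<noteq> 0"
    by (simp add: eventually_at_filter)
  ultimately have "\<forall>\<^sub>F q in at 0. norm (G q) \<le> (norm (fls_nth (fls_shift (- int n) F) 0) + 1) * norm (1 / q ^ n)"
    by eventually_elim (simp add: norm_mult norm_divide field_simps)
  thus ?thesis by blast
qed

lemma has_q_expansion_imp_mod_growth:
  assumes "has_q_expansion h f F" "h > 0"
  shows "mod_growth f"
proof -
  obtain G B where G: "G has_laurent_expansion F" "\<And>z. Im z \<ge> B \<Longrightarrow> eval_uhp f z = G (ee (z / of_nat h))"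
    using assms(1) unfolding has_q_expansion_iff by blast
  obtain r where r: "r > 0" "G analytic_on ball 0 r - {0}"
    using has_laurent_expansion_isolated_0[OF G(1)] by (auto simp: isolated_singularity_at_def)
  have "\<forall>\<^sub>F q in at 0. q \<in> ball 0 r - {0}"
    using r(1) eventually_at_in_open[of "ball 0 r" 0] by simp
  then obtain B1 where B1: "B1 > 0" "\<And>z. Im z \<ge> B1 \<Longrightarrow> ee (z / of_nat h) \<in> ball 0 r - {0}"
    using eventually_at_0_imp_Im[of "\<lambda>q. q \<in> ball 0 r - {0}" h] assms(2) by blast
  obtain C n where "\<forall>\<^sub>F q in at 0. norm (G q) \<le> C * norm (1 / q ^ n)"
    using fls_bound[OF G(1)] by blast
  from eventually_at_0_imp_Im[OF this assms(2)] obtain B2 where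
    B2: "B2 > 0" "\<And>z. Im z \<ge> B2 \<Longrightarrow> norm (G (ee (z / of_nat h))) \<le> C * norm (1 / ee (z / of_nat h) ^ n)"
    by blast
  define M where "M = max B (max B1 B2)"
  have "G holomorphic_on ball 0 r - {0}"
    by (rule analytic_imp_holomorphic[OF r(2)])
  hence "(G \<circ> (\<lambda>z. ee (z / of_nat h))) holomorphic_on {z. Im z > M}"
    using assms(2) by (intro holomorphic_on_compose_gen[where t = "ball 0 r - {0}"] holomorphic_intros)
      (use B1(2) in \<open>auto simp: M_def\<close>)
  moreover have "(G \<circ> (\<lambda>z. ee (z / of_nat h))) z = eval_uhp f z" if "z \<in> {z. Im z > M}" for z
    using that G(2)[of z] by (simp add: M_def)
  ultimately have "eval_uhp f holomorphic_on {z. Im z > M}"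
    by (rule holomorphic_transform)
  moreover have "norm (eval_uhp f z) \<le> C * exp ((2 * pi * n / h) * Im z)" if "Im z > M" for z
  proof -
    have "norm (1 / ee (z / of_nat h) ^ n) = exp ((2 * pi * n / h) * Im z)"
      using assms(2) by (simp add: norm_divide norm_power norm_ee_div exp_minus field_simps flip: exp_of_nat_mult)
    thus ?thesis using B2(2)[of z] G(2)[of z] that by (simp add: M_def)
  qed
  moreover have "M > 0" using B1(1) by (simp add: M_def)
  ultimately show ?thesis unfolding mod_growth_def by blast
qed

text \<open>Multiplication by a high power of \<open>ee (z / of_nat h)\<close> turns exponential
  growth into boundedness; the holomorphic lift is then divided by that power of
  \<open>q\<close>.\<close>

lemma mod_growth_imp_has_q_expansion:
  assumes "mod_growth f" "h > 0" and per: "\<And>z. z \<in> uhp \<Longrightarrow> eval_uhp f (z + of_nat h) = eval_uhp f z"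
  shows "\<exists>F. has_q_expansion h f F"
proof -
  obtain A B C where *: "B > 0" "eval_uhp f holomorphic_on {z. Im z > B}"
     "\<And>z. Im z > B \<Longrightarrow> norm (eval_uhp f z) \<le> C * exp (A * Im z)"
    using assms(1) unfolding mod_growth_def by blast
  obtain n :: nat where n: "real n \<ge> A * h / (2 * pi)"
    using real_arch_simple by blast
  have An: "A \<le> 2 * pi * n / h"
    using n assms(2) by (simp add: field_simps)
  have C: "C \<ge> 0"
  proof -
    have "0 \<le> norm (eval_uhp f (\<i> * of_real (B + 1)))" by simp
    also have "\<dots> \<le> C * exp (A * Im (\<i> * of_real (B + 1)))" by (rule *(3)) simp
    finally show ?thesis by (simp add: zero_le_mult_iff)
  qed
  define g where "g z = eval_uhp f z * ee (z / of_nat h) ^ n" for z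
  have "\<exists>G. G holomorphic_on ball 0 (exp (- 2 * pi * B / real h)) \<and>
           (\<forall>z. Im z > B \<longrightarrow> g z = G (ee (z / of_nat h)))"
  proof (rule periodic_lift[OF _ _ _ assms(2)])
    show "g holomorphic_on {z. Im z > B}"
      unfolding g_def[abs_def] using assms(2) by (intro holomorphic_intros *(2)) auto
    show "g (z + of_nat h) = g z" if "Im z > B" for z
      using per[of z] that *(1) assms(2) by (simp add: g_def uhp_def add_divide_distrib ee_add)
    show "norm (g z) \<le> C" if "Im z \<ge> B + 1" for z
    proof -
      have "norm (g z) = norm (eval_uhp f z) * exp (- (2 * pi * n / h) * Im z)"
        using assms(2) by (simp add: g_def norm_mult norm_power norm_ee_div mult_ac flip: exp_of_nat_mult)
      also have "\<dots> \<le> (C * exp (A * Im z)) * exp (- (2 * pi * n / h) * Im z)"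
        using *(3)[of z] that by (intro mult_right_mono) auto
      also have "\<dots> = C * exp ((A - 2 * pi * n / h) * Im z)"
        by (simp add: exp_add[symmetric] algebra_simps)
      also have "\<dots> \<le> C * 1"
        using C An that *(1) by (intro mult_left_mono) (auto simp: mult_nonpos_nonneg)
      finally show ?thesis by simp
    qed
  qed
  then obtain G where G: "G holomorphic_on ball 0 (exp (- 2 * pi * B / real h))"
    "\<And>z. Im z > B \<Longrightarrow> g z = G (ee (z / of_nat h))" by blast
  have "G analytic_on {0}"
    using G(1) by (auto simp: analytic_at intro!: exI[of _ "ball 0 (exp (- 2 * pi * B / real h))"])
  then obtain F where "G has_fps_expansion F"
    using analytic_at_imp_has_fps_expansion_0 by blast
  hence "G has_laurent_expansion fps_to_fls F"
    by (rule has_laurent_expansion_fps)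
  from has_laurent_expansion_shift'[OF this, of "int n"]
  have "(\<lambda>q. G q * q powi - int n) has_laurent_expansion fls_shift (int n) (fps_to_fls F)" .
  moreover have "\<forall>z. Im z \<ge> B + 1 \<longrightarrow> eval_uhp f z = G (ee (z / of_nat h)) * ee (z / of_nat h) powi - int n"
    using G(2) by (auto simp: g_def power_int_minus field_simps)
  ultimately show ?thesis unfolding has_q_expansion_iff by blast
qed

lemma eval_pullback_upper:
  assumes "\<alpha> > 0" "\<delta> > 0" "z \<in> uhp"
  shows "eval_uhp (pullback \<alpha> \<beta> 0 \<delta> f) z = eval_uhp f ((of_int \<alpha> * z + of_int \<beta>) / of_int \<delta>)"
  using eval_pullback[of \<alpha> \<delta> \<beta> 0 z f] assms by (simp add: moebius_map_def)

lemma mod_growth_pullback_upper: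
  assumes "mod_growth f" "\<alpha> > 0" "\<delta> > 0"
  shows "mod_growth (pullback \<alpha> \<beta> 0 \<delta> f)"
proof -
  obtain A B C where *: "B > 0" "eval_uhp f holomorphic_on {z. Im z > B}"
     "\<And>z. Im z > B \<Longrightarrow> norm (eval_uhp f z) \<le> C * exp (A * Im z)"
    using assms(1) unfolding mod_growth_def by blast
  define k where "k = real_of_int \<alpha> / of_int \<delta>"
  define g where "g z = (of_int \<alpha> * z + of_int \<beta>) / of_int \<delta>" for z :: complex
  have k: "k > 0" using assms by (simp add: k_def)
  have Im_g: "Im (g z) = k * Im z" for z
    by (simp add: g_def k_def)
  have Bk: "B / k > 0" using k *(1) by simp
  have eq: "eval_uhp (pullback \<alpha> \<beta> 0 \<delta> f) z = eval_uhp f (g z)" if "Im z > B / k" for z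
    using eval_pullback_upper[OF assms(2,3), of z \<beta> f] that Bk by (simp add: g_def uhp_def)
  have gB: "Im (g z) > B" if "Im z > B / k" for z
    using that k by (simp add: Im_g field_simps)
  have "(eval_uhp f \<circ> g) holomorphic_on {z. Im z > B / k}"
    using assms(3) gB unfolding g_def[abs_def]
    by (intro holomorphic_on_compose_gen[OF _ *(2)] holomorphic_intros) auto
  hence "eval_uhp (pullback \<alpha> \<beta> 0 \<delta> f) holomorphic_on {z. Im z > B / k}"
    by (rule holomorphic_transform) (simp add: eq)
  moreover have "norm (eval_uhp (pullback \<alpha> \<beta> 0 \<delta> f) z) \<le> C * exp (A * k * Im z)" if "Im z > B / k" for z
    using *(3)[OF gB[OF that]] eq[OF that] by (simp add: Im_g mult_ac)
  ultimately show ?thesis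
    unfolding mod_growth_def using Bk by blast
qed

definition gamma0_invariant :: "nat \<Rightarrow> mero_uhp \<Rightarrow> bool" where
  "gamma0_invariant N f \<longleftrightarrow> (\<forall>a b c d. a * d - b * c = 1 \<and> int N dvd c \<longrightarrow> pullback a b c d f = f)"

text \<open>The number in the last hypothesis is the lower left entry of the second matrix times the
  inverse of the first, so this product lies in \<open>\<Gamma>\<^sub>0(N)\<close>.\<close>

lemma pullback_eq_of_cong:
  assumes f: "gamma0_invariant N f" and "a * d - b * c = 1" "a' * d' - b' * c' = 1"
    and "int N dvd c' * d - d' * c"
  shows "pullback a' b' c' d' f = pullback a b c d f"
proof -
  define A B C D where "A = a' * d - b' * c" and "B = b' * a - a' * b"
    and "C = c' * d - d' * c" and "D = d' * a - c' * b"
  have "A * D - B * C = (a * d - b * c) * (a' * d' - b' * c')"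
    by (simp add: A_def B_def C_def D_def algebra_simps)
  hence det: "A * D - B * C = 1" using assms by simp
  have "pullback A B C D f = f"
    using f det assms(4) unfolding gamma0_invariant_def C_def by blast
  hence "pullback a b c d f = pullback a b c d (pullback A B C D f)" by simp
  also have "\<dots> = pullback (A * a + B * c) (A * b + B * d) (C * a + D * c) (C * b + D * d) f"
    by (rule pullback_pullback) (use det assms in auto)
  also have "A * a + B * c = a' * (a * d - b * c)"
    by (simp add: A_def B_def algebra_simps)
  also have "A * b + B * d = b' * (a * d - b * c)"
    by (simp add: A_def B_def algebra_simps)
  also have "C * a + D * c = c' * (a * d - b * c)"
    by (simp add: C_def D_def algebra_simps)
  also have "C * b + D * d = d' * (a * d - b * c)"
    by (simp add: C_def D_def algebra_simps)
  finally show ?thesis using assms by simp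
qed

text \<open>Conjugating the translation by \<open>N\<close> with the given matrix produces the lower
  left entry \<open>- N * c * c\<close>, so the conjugate lies in
  \<open>\<Gamma>\<^sub>0(N)\<close>: the width of every cusp divides \<open>N\<close>.\<close>

lemma pullback_periodic:
  assumes f: "gamma0_invariant N f" and det: "a * d - b * c = 1" and z: "z \<in> uhp"
  shows "eval_uhp (pullback a b c d f) (z + of_nat N) = eval_uhp (pullback a b c d f) z"
proof -
  have "pullback 1 (int N) 0 1 (pullback a b c d f) =
          pullback (a * 1 + b * 0) (a * int N + b * 1) (c * 1 + d * 0) (c * int N + d * 1) f"
    by (rule pullback_pullback) (use det in auto)
  also have "\<dots> = pullback a b c d f"
  proof (rule pullback_eq_of_cong[OF f det])
    show "(a * 1 + b * 0) * (c * int N + d * 1) - (a * int N + b * 1) * (c * 1 + d * 0) = 1"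
      using det by (simp add: algebra_simps)
    have "(c * 1 + d * 0) * d - (c * int N + d * 1) * c = int N * (- c * c)"
      by (simp add: algebra_simps)
    thus "int N dvd (c * 1 + d * 0) * d - (c * int N + d * 1) * c" by simp
  qed
  finally have "eval_uhp (pullback 1 (int N) 0 1 (pullback a b c d f)) z = eval_uhp (pullback a b c d f) z"
    by simp
  thus ?thesis
    using eval_pullback_upper[of 1 1 z "int N" "pullback a b c d f"] z by simp
qed

text \<open>Reduces meromorphy at the cusps to growth estimates, since the periodicity required for
  an expansion is automatic.\<close>

lemma X0_functions_complex_iff:
  assumes "N > 0"
  shows "f \<in> X0_functions_complex N \<longleftrightarrow> gamma0_invariant N f \<and>
           (\<forall>a b c d. a * d - b * c = 1 \<longrightarrow> mod_growth (pullback a b c d f))"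
proof
  assume "f \<in> X0_functions_complex N"
  thus "gamma0_invariant N f \<and> (\<forall>a b c d. a * d - b * c = 1 \<longrightarrow> mod_growth (pullback a b c d f))"
    using has_q_expansion_imp_mod_growth[OF _ assms]
    unfolding X0_functions_complex_def gamma0_invariant_def by blast
next
  assume *: "gamma0_invariant N f \<and> (\<forall>a b c d. a * d - b * c = 1 \<longrightarrow> mod_growth (pullback a b c d f))"
  have "\<exists>F. has_q_expansion N (pullback a b c d f) F" if "a * d - b * c = 1" for a b c d
    using * that by (intro mod_growth_imp_has_q_expansion assms pullback_periodic) auto
  thus "f \<in> X0_functions_complex N"
    using * unfolding X0_functions_complex_def gamma0_invariant_def by blast
qed

lemma X0c_invariant: "f \<in> X0_functions_complex N \<Longrightarrow> gamma0_invariant N f"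
  unfolding X0_functions_complex_def gamma0_invariant_def by blast

lemma X0c_add:
  assumes "f \<in> X0_functions_complex N" "g \<in> X0_functions_complex N" "N > 0"
  shows "f + g \<in> X0_functions_complex N"
  using assms has_q_expansion_add[OF _ _ assms(3)] unfolding X0_functions_complex_def
  by (auto simp: pullback_add) metis

lemma X0c_mult:
  assumes "f \<in> X0_functions_complex N" "g \<in> X0_functions_complex N" "N > 0"
  shows "f * g \<in> X0_functions_complex N"
  using assms has_q_expansion_mult[OF _ _ assms(3)] unfolding X0_functions_complex_def
  by (auto simp: pullback_mult) metis

lemma X0c_cm: "cm k \<in> X0_functions_complex N"
  using has_q_expansion_cm unfolding X0_functions_complex_def by (auto simp: pullback_cm)

lemma X0c_inverse:
  assumes "f \<in> X0_functions_complex N" "N > 0"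
  shows "inverse f \<in> X0_functions_complex N"
  using assms has_q_expansion_inverse[OF _ assms(2)] unfolding X0_functions_complex_def
  by (auto simp: pullback_inverse) metis

lemma X0c_uminus:
  assumes "f \<in> X0_functions_complex N" "N > 0"
  shows "- f \<in> X0_functions_complex N"
  using X0c_mult[OF X0c_cm[of "-1"] assms] by (simp add: cm_minus)

lemma X0c_diff:
  assumes "f \<in> X0_functions_complex N" "g \<in> X0_functions_complex N" "N > 0"
  shows "f - g \<in> X0_functions_complex N"
  using X0c_add[OF assms(1) X0c_uminus[OF assms(2,3)] assms(3)] by simp

section \<open>Expansions with rational coefficients\<close>

lemma Rats_fps_inverse:
  fixes f :: "'a :: field_char_0 fps"
  assumes "\<And>n. fps_nth f n \<in> \<rat>"
  shows "fps_nth (inverse f) n \<in> \<rat>"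
proof (induction n rule: less_induct)
  case (less n)
  show ?case
  proof (cases "fps_nth f 0 = 0")
    case True
    thus ?thesis by (simp add: fps_inverse_eq_0)
  next
    case False
    show ?thesis
    proof (cases "n = 0")
      case False': False
      have "(\<Sum>i=0..n. fps_nth f i * fps_nth (inverse f) (n - i)) = 0"
        using arg_cong[OF inverse_mult_eq_1'[OF False], of "\<lambda>F. fps_nth F n"] False'
        by (simp add: fps_mult_nth)
      hence "fps_nth f 0 * fps_nth (inverse f) n =
               - (\<Sum>i=1..n. fps_nth f i * fps_nth (inverse f) (n - i))"
        by (simp add: sum.atLeast_Suc_atMost[of 0] add_eq_0_iff)
      also have "\<dots> \<in> \<rat>"
        by (intro Rats_minus_iff[THEN iffD2] Rats_sum Rats_mult assms less.IH) auto
      finally have "fps_nth f 0 * fps_nth (inverse f) n / fps_nth f 0 \<in> \<rat>"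
        by (intro Rats_divide assms)
      thus ?thesis using False by simp
    qed (use assms in auto)
  qed
qed

definition rat_fls :: "complex fls \<Rightarrow> bool" where
  "rat_fls F \<longleftrightarrow> (\<forall>n. fls_nth F n \<in> \<rat>)"

lemma rat_fls_const: "c \<in> \<rat> \<Longrightarrow> rat_fls (fls_const c)"
  by (simp add: rat_fls_def)

lemma rat_fls_add: "rat_fls F \<Longrightarrow> rat_fls G \<Longrightarrow> rat_fls (F + G)"
  by (simp add: rat_fls_def)

lemma rat_fls_uminus: "rat_fls F \<Longrightarrow> rat_fls (- F)"
  by (simp add: rat_fls_def)

lemma rat_fls_mult: "rat_fls F \<Longrightarrow> rat_fls G \<Longrightarrow> rat_fls (F * G)"
  by (auto simp: rat_fls_def fls_times_nth(1) intro!: Rats_sum Rats_mult)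

lemma rat_fls_inverse:
  assumes "rat_fls F"
  shows "rat_fls (inverse F)"
proof -
  have "fps_nth (fls_base_factor_to_fps F) n \<in> \<rat>" for n
    using assms by (simp add: rat_fls_def)
  from Rats_fps_inverse[OF this] show ?thesis
    by (auto simp: rat_fls_def fls_inverse_def)
qed

lemma X0_rat_iff:
  "f \<in> X0_functions_rat N \<longleftrightarrow> f \<in> X0_functions_complex N \<and> (\<exists>F. has_q_expansion 1 f F \<and> rat_fls F)"
  by (auto simp: X0_functions_rat_def rat_fls_def)

lemma rat_adjoin_subset_X0_rat:
  assumes "S \<subseteq> X0_functions_rat N" "N > 0"
  shows "rat_adjoin S \<subseteq> X0_functions_rat N"
proof
  fix f assume "f \<in> rat_adjoin S"
  thus "f \<in> X0_functions_rat N"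
  proof induction
    case (rat r)
    show ?case unfolding X0_rat_iff cm_of_rat[symmetric]
      using X0c_cm has_q_expansion_cm rat_fls_const Rats_of_rat by blast
  next
    case (base s)
    thus ?case using assms by blast
  next
    case (add u v)
    thus ?case unfolding X0_rat_iff
      using X0c_add has_q_expansion_add rat_fls_add assms(2) zero_less_one by blast
  next
    case (mult u v)
    thus ?case unfolding X0_rat_iff
      using X0c_mult has_q_expansion_mult rat_fls_mult assms(2) zero_less_one by blast
  next
    case (uminus u)
    thus ?case unfolding X0_rat_iff
      using X0c_uminus has_q_expansion_uminus rat_fls_uminus assms(2) zero_less_one by blast
  next
    case (inverse u)
    thus ?case unfolding X0_rat_iff
      using X0c_inverse has_q_expansion_inverse rat_fls_inverse assms(2) zero_less_one by blast
  qed
qed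

section \<open>Liouville's theorem for \<open>\<Gamma>\<^sub>0(N)\<close>\<close>

text \<open>By \<open>pullback_eq_of_cong\<close> a pullback depends only on the lower row modulo
  \<open>N\<close>, which takes finitely many values.\<close>

lemma finite_pullbacks:
  assumes "gamma0_invariant N f" "N > 0"
  shows "finite {pullback a b c d f | a b c d. a * d - b * c = 1}"
proof -
  let ?P = "\<lambda>x. SOME g. \<exists>a b c d. a * d - b * c = 1 \<and> c mod int N = fst x \<and> d mod int N = snd x \<and> g = pullback a b c d f"
  have "{pullback a b c d f | a b c d. a * d - b * c = 1} \<subseteq> ?P ` ({0..<int N} \<times> {0..<int N})"
  proof safe
    fix a b c d :: int assume det: "a * d - b * c = 1"
    let ?x = "(c mod int N, d mod int N)"
    have "\<exists>g a' b' c' d'. a' * d' - b' * c' = 1 \<and> c' mod int N = fst ?x \<and> d' mod int N = snd ?x \<and> g = pullback a' b' c' d' f"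
      using det by auto
    from someI_ex[OF this] obtain a' b' c' d' where *: "a' * d' - b' * c' = 1"
      "c' mod int N = c mod int N" "d' mod int N = d mod int N" "?P ?x = pullback a' b' c' d' f"
      by auto
    have "(c' * d - d' * c) mod int N = (c * d - d * c) mod int N"
      using *(2,3) by (intro mod_diff_cong mod_mult_cong) auto
    hence "int N dvd c' * d - d' * c" by (simp add: mod_0_imp_dvd mult.commute)
    hence "pullback a' b' c' d' f = pullback a b c d f"
      by (rule pullback_eq_of_cong[OF assms(1) det *(1)])
    hence "pullback a b c d f = ?P ?x" using *(4) by simp
    thus "pullback a b c d f \<in> ?P ` ({0..<int N} \<times> {0..<int N})"
      using assms(2) by (intro image_eqI[where x = ?x]) auto
  qed
  thus ?thesis by (rule finite_subset) auto
qed

lemma finite_small_denominators: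
  assumes "z \<in> uhp"
  shows "finite {(c, d). norm (of_int c * z + of_int d) \<le> 1}"
proof -
  have Im: "Im z > 0" using assms by (simp add: uhp_def)
  define R where "R = nat \<lceil>1 / Im z\<rceil>"
  define T where "T = nat \<lceil>1 + real R * norm z\<rceil>"
  have "{(c, d). norm (of_int c * z + of_int d) \<le> 1} \<subseteq> {- int R..int R} \<times> {- int T..int T}"
  proof safe
    fix c d assume le: "norm (of_int c * z + of_int d) \<le> 1"
    have "\<bar>Im (of_int c * z + of_int d)\<bar> \<le> 1"
      using abs_Im_le_cmod le by (rule order_trans)
    hence "\<bar>of_int c\<bar> \<le> 1 / Im z" using Im by (simp add: abs_mult field_simps)
    hence cR: "\<bar>real_of_int c\<bar> \<le> real R" unfolding R_def by linarith
    thus "c \<in> {- int R..int R}" by auto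
    have "norm (of_int d :: complex) \<le> norm (of_int c * z + of_int d) + norm (of_int c * z)"
      using norm_triangle_ineq4[of "of_int c * z + of_int d" "of_int c * z"] by simp
    also have "\<dots> \<le> 1 + real R * norm z"
      using le cR by (intro add_mono) (auto simp: norm_mult intro: mult_right_mono)
    finally have "\<bar>real_of_int d\<bar> \<le> real T" unfolding T_def by simp linarith
    thus "d \<in> {- int T..int T}" by auto
  qed
  thus ?thesis by (rule finite_subset) auto
qed

text \<open>Among all lower rows \<open>(c, d)\<close> the norm of \<open>c * z + d\<close> is
  minimised, which maximises the imaginary part of the image; a translation then adjusts the real
  part. Only finitely many rows compete, and \<open>(0, 1)\<close> is one of them.\<close>

lemma fundamental_domain:
  assumes z: "z \<in> uhp"
  shows "\<exists>a b c d w. a * d - b * c = 1 \<and> z = moebius_map a b c d w \<and> Im w \<ge> 1 / 2 \<and> \<bar>Re w\<bar> \<le> 1 / 2"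
proof -
  define S where "S = {(c, d). norm (of_int c * z + of_int d) \<le> 1} \<inter> {(c, d). \<exists>a b. a * d - b * c = 1}"
  have "finite S" unfolding S_def using finite_small_denominators[OF z] by blast
  moreover have "(0, 1) \<in> S" by (auto simp: S_def intro: exI[of _ 1])
  moreover define F where "F x = norm (of_int (fst x) * z + of_int (snd x))" for x :: "int \<times> int"
  ultimately have "Min (F ` S) \<in> F ` S" "\<And>y. y \<in> S \<Longrightarrow> Min (F ` S) \<le> F y"
    by (auto intro!: Min_in)
  then obtain x where x: "x \<in> S" "\<And>y. y \<in> S \<Longrightarrow> F x \<le> F y"
    by (metis imageE)
  obtain a b c d where xcd: "x = (c, d)" and det: "a * d - b * c = 1" and le1: "norm (of_int c * z + of_int d) \<le> 1"
    using x(1) unfolding S_def by (cases x) auto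
  have min: "norm (of_int c * z + of_int d) \<le> norm (of_int c' * z + of_int d')"
    if "a' * d' - b' * c' = 1" for a' b' c' d'
  proof (cases "norm (of_int c' * z + of_int d') \<le> 1")
    case True
    thus ?thesis using x(2)[of "(c', d')"] that xcd unfolding S_def F_def by auto
  qed (use le1 in auto)
  define m where "m = - round (Re (moebius_map a b c d z))"
  define a1 b1 where "a1 = a + m * c" and "b1 = b + m * d"
  have det1: "a1 * d - b1 * c = 1" using det by (simp add: a1_def b1_def algebra_simps)
  define w where "w = moebius_map a1 b1 c d z"
  have nz: "of_int c * z + of_int d \<noteq> 0"
    by (rule moebius_denom_nonzero[OF _ z, of a d b]) (use det in auto)
  have w: "w = moebius_map a b c d z + of_int m"
    using nz by (simp add: w_def moebius_map_def a1_def b1_def field_simps)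
  have Re: "\<bar>Re w\<bar> \<le> 1 / 2"
    using of_int_round_abs_le[of "Re (moebius_map a b c d z)"] by (simp add: w m_def abs_minus_commute)
  have wu: "w \<in> uhp" unfolding w_def by (rule moebius_in_uhp) (use det1 z in auto)
  \<comment> \<open>Minimality is applied to the matrix followed by the inversion, whose lower row
    is \<open>(a1, b1)\<close>; this gives \<open>norm w \<ge> 1\<close>.\<close>
  have "norm (of_int c * z + of_int d) \<le> norm (of_int a1 * z + of_int b1)"
    by (rule min[of "- c" b1 "- d" a1]) (use det1 in \<open>simp add: algebra_simps\<close>)
  hence "norm w \<ge> 1"
    using nz by (simp add: w_def moebius_map_def norm_divide)
  hence "1 \<le> (norm w) ^ 2" by simp
  also have "\<dots> = (Re w) ^ 2 + (Im w) ^ 2" by (rule cmod_power2)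
  also have "(Re w) ^ 2 \<le> (1 / 2) ^ 2" using Re by (metis abs_le_square_iff abs_of_nonneg zero_le_divide_1_iff zero_le_numeral)
  finally have "(1 / 2) ^ 2 \<le> (Im w) ^ 2" by (simp add: power2_eq_square)
  hence Im: "1 / 2 \<le> Im w" using wu by (intro power2_le_imp_le[of "1/2"]) (auto simp: uhp_def)
  have "z = moebius_map d (- b1) (- c) a1 w"
    unfolding w_def by (rule moebius_inverse[symmetric]) (use det1 z in auto)
  moreover have "d * a1 - (- b1) * (- c) = 1" using det1 by (simp add: algebra_simps)
  ultimately show ?thesis using Im Re by blast
qed

definition bounded_at_inf :: "mero_uhp \<Rightarrow> bool" where
  "bounded_at_inf f \<longleftrightarrow> (\<exists>B C. \<forall>z. Im z \<ge> B \<longrightarrow> norm (eval_uhp f z) \<le> C)"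

lemma holomorphic_pullback:
  assumes "eval_uhp f holomorphic_on uhp" "a * d - b * c > 0"
  shows "eval_uhp (pullback a b c d f) holomorphic_on uhp"
proof -
  have "(eval_uhp f \<circ> moebius_map a b c d) holomorphic_on uhp"
    using analytic_imp_holomorphic[OF moebius_analytic[OF assms(2)]] assms(1) moebius_in_uhp[OF assms(2)]
    by (intro holomorphic_on_compose_gen[of _ _ _ uhp]) auto
  thus ?thesis
    by (rule holomorphic_transform) (simp add: eval_pullback[OF assms(2)])
qed

text \<open>The finitely many pullbacks of \<open>f\<close> lift to holomorphic functions on the
  unit disc. Since \<open>SL\<^sub>2(\<int>)\<close> permutes them and moves every point to height
  at least 1/2, the maximum of all their norms is attained by some lift in the closed disc of radius
  \<open>r < 1\<close>. The maximum modulus principle makes that lift constant.\<close>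

theorem Liouville_gamma0:
  assumes f: "gamma0_invariant N f" and N: "N > 0" and hol: "eval_uhp f holomorphic_on uhp"
    and bd: "\<And>a b c d. a * d - b * c = 1 \<Longrightarrow> bounded_at_inf (pullback a b c d f)"
  shows "\<exists>c. f = cm c"
proof -
  define O' where "O' = {pullback a b c d f | a b c d. a * d - b * c = 1}"
  have fin: "finite O'" unfolding O'_def by (rule finite_pullbacks[OF f N])
  have "(1 :: int) * 1 - 0 * 0 = 1" by simp
  hence "pullback 1 0 0 1 f \<in> O'" unfolding O'_def by blast
  hence ne: "O' \<noteq> {}" by blast
  have "\<exists>G. G holomorphic_on ball 0 1 \<and> (\<forall>z\<in>uhp. eval_uhp g z = G (ee (z / of_nat N)))"
    if gO: "g \<in> O'" for g
  proof -
    obtain a b c d where g: "g = pullback a b c d f" and det: "a * d - b * c = 1"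
      using gO unfolding O'_def by blast
    obtain B' C where "\<And>z. Im z \<ge> B' \<Longrightarrow> norm (eval_uhp g z) \<le> C"
      using bd[OF det] unfolding bounded_at_inf_def g by blast
    hence "\<exists>G. G holomorphic_on ball 0 (exp (- 2 * pi * 0 / real N)) \<and>
           (\<forall>z. Im z > 0 \<longrightarrow> eval_uhp g z = G (ee (z / of_nat N)))"
      using holomorphic_pullback[OF hol, of a d b c] pullback_periodic[OF f det] det N
      by (intro periodic_lift) (auto simp: uhp_def g)
    thus ?thesis by (auto simp: uhp_def)
  qed
  then obtain G where G: "\<And>g. g \<in> O' \<Longrightarrow> G g holomorphic_on ball 0 1"
      "\<And>g z. g \<in> O' \<Longrightarrow> z \<in> uhp \<Longrightarrow> eval_uhp g z = G g (ee (z / of_nat N))"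
    by metis
  \<comment> \<open>The norm of \<open>ee (z / of_nat N)\<close> at height
    \<open>Im z = 1 / 2\<close>.\<close>
  define r where "r = exp (- 2 * pi * (1 / 2) / real N)"
  have r: "0 < r" "r < 1" using N by (auto simp: r_def divide_less_0_iff)
  have "\<exists>q\<in>cball 0 r. \<forall>q'\<in>cball 0 r. norm (G g q') \<le> norm (G g q)" if "g \<in> O'" for g
  proof (rule continuous_attains_sup)
    have "continuous_on (ball 0 1) (G g)"
      using G(1)[OF that] by (rule holomorphic_on_imp_continuous_on)
    hence "continuous_on (cball 0 r) (G g)"
      by (rule continuous_on_subset) (use r in auto)
    thus "continuous_on (cball 0 r) (\<lambda>q. norm (G g q))" by (intro continuous_intros)
  qed (use r in auto)
  then obtain Q where Q: "\<And>g. g \<in> O' \<Longrightarrow> Q g \<in> cball 0 r"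
    "\<And>g q'. g \<in> O' \<Longrightarrow> q' \<in> cball 0 r \<Longrightarrow> norm (G g q') \<le> norm (G g (Q g))"
    by metis
  define M where "M = Max ((\<lambda>g. norm (G g (Q g))) ` O')"
  have "M \<in> (\<lambda>g. norm (G g (Q g))) ` O'"
    unfolding M_def using fin ne by (intro Max_in) auto
  then obtain g0 where g0: "g0 \<in> O'" "M = norm (G g0 (Q g0))" by blast
  have M: "norm (G g q) \<le> M" if "g \<in> O'" "q \<in> cball 0 r" for g q
  proof -
    have "norm (G g q) \<le> norm (G g (Q g))" by (rule Q(2)[OF that])
    also have "\<dots> \<le> M" unfolding M_def using fin that(1) by (intro Max_ge) auto
    finally show ?thesis .
  qed
  have evM: "norm (eval_uhp g z) \<le> M" if g: "g \<in> O'" and z: "z \<in> uhp" for g z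
  proof -
    obtain a b c d where gf: "g = pullback a b c d f" and det: "a * d - b * c = 1"
      using g unfolding O'_def by blast
    obtain a' b' c' d' w where w: "a' * d' - b' * c' = 1" "z = moebius_map a' b' c' d' w" "Im w \<ge> 1 / 2"
      using fundamental_domain[OF z] by blast
    have wu: "w \<in> uhp" using w(3) by (simp add: uhp_def)
    let ?g' = "pullback a' b' c' d' g"
    have "?g' = pullback (a * a' + b * c') (a * b' + b * d') (c * a' + d * c') (c * b' + d * d') f"
      unfolding gf by (rule pullback_pullback) (use det w(1) in auto)
    moreover have "(a * a' + b * c') * (c * b' + d * d') - (a * b' + b * d') * (c * a' + d * c') =
        (a * d - b * c) * (a' * d' - b' * c')"
      by (simp add: algebra_simps)
    ultimately have g': "?g' \<in> O'" unfolding O'_def using det w(1) by force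
    have "eval_uhp g z = eval_uhp ?g' w"
      using eval_pullback[of a' d' b' c' w g] w wu by simp
    also have "\<dots> = G ?g' (ee (w / of_nat N))" by (rule G(2)[OF g' wu])
    also have "norm \<dots> \<le> M"
    proof (rule M[OF g'])
      have "exp (- 2 * pi * Im w / real N) \<le> r"
        unfolding r_def using w(3) N by (simp add: divide_right_mono)
      thus "ee (w / of_nat N) \<in> cball 0 r" using norm_ee_div[OF N, of w] by simp
    qed
    finally show ?thesis .
  qed
  have "G g0 constant_on ball 0 1"
  proof (rule maximum_modulus_principle[where \<xi> = "Q g0"])
    show "Q g0 \<in> ball 0 1" using Q(1)[OF g0(1)] r by auto
    fix q :: complex assume q: "q \<in> ball 0 1"
    show "norm (G g0 q) \<le> norm (G g0 (Q g0))"
    proof (cases "q = 0")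
      case True
      thus ?thesis using Q(2)[OF g0(1), of 0] r by simp
    next
      case False
      obtain z where z: "ee (z / of_nat N) = q" using ee_surj[OF False N] by metis
      have "exp (- 2 * pi * Im z / real N) < 1" using norm_ee_div[OF N, of z] z q by simp
      hence "0 < 2 * pi * Im z / real N" by simp
      hence "z \<in> uhp" using N by (simp add: uhp_def zero_less_divide_iff zero_less_mult_iff)
      from evM[OF g0(1) this] G(2)[OF g0(1) this] show ?thesis by (simp add: z g0(2))
    qed
  qed (use G(1)[OF g0(1)] in auto)
  then obtain C where C: "\<And>q. q \<in> ball 0 1 \<Longrightarrow> G g0 q = C"
    by (auto simp: constant_on_def)
  have "eval_uhp g0 z = eval_uhp (cm C) z" if "z \<in> uhp" for z
  proof -
    have "exp (- 2 * pi * Im z / real N) < 1"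
      using that N by (simp add: uhp_def divide_less_0_iff mult_less_0_iff)
    hence "ee (z / of_nat N) \<in> ball 0 1" using norm_ee_div[OF N, of z] by simp
    thus ?thesis using G(2)[OF g0(1) that] C eval_cm[OF that] by simp
  qed
  hence g0C: "g0 = cm C"
    by (intro mero_uhp_eqI) (use eventually_in_uhp in \<open>eventually_elim, simp\<close>)
  obtain a b c d where gf: "g0 = pullback a b c d f" and det: "a * d - b * c = 1"
    using g0(1) unfolding O'_def by blast
  \<comment> \<open>The constant pullback is carried back to \<open>f\<close> by the inverse
    matrix.\<close>
  have "pullback d (- b) (- c) a g0 =
      pullback (a * d + b * (- c)) (a * (- b) + b * a) (c * d + d * (- c)) (c * (- b) + d * a) f"
    unfolding gf by (rule pullback_pullback) (use det in \<open>auto simp: mult.commute\<close>)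
  also have "\<dots> = pullback 1 0 0 1 f" using det by (simp add: algebra_simps)
  also have "\<dots> = f" using f unfolding gamma0_invariant_def by simp
  finally have "f = pullback d (- b) (- c) a (cm C)" by (simp add: g0C)
  also have "\<dots> = cm C" by (rule pullback_cm) (use det in \<open>simp add: mult.commute\<close>)
  finally show ?thesis by blast
qed

section \<open>Eta quotients on \<open>X\<^sub>0(45)\<close>\<close>

text \<open>In terms of the Dedekind eta function, \<open>k1\<close> is
  \<open>\<eta>(z) / \<eta>(9z)\<close> and \<open>k2\<close> is
  \<open>\<eta>(5z) / \<eta>(45z)\<close>.\<close>

definition k1 :: "complex \<Rightarrow> complex" where "k1 z = kap (3 * z)"
definition k2 :: "complex \<Rightarrow> complex" where "k2 z = kap (15 * z)"

lemma k1_holomorphic: "k1 holomorphic_on uhp"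
  unfolding k1_def[abs_def] by (intro holomorphic_intros) (auto simp: uhp_def open_halfspace_Im_gt)

lemma k2_holomorphic: "k2 holomorphic_on uhp"
  unfolding k2_def[abs_def] by (intro holomorphic_intros) (auto simp: uhp_def open_halfspace_Im_gt)

lemma mod3_unit:
  fixes a d n :: int
  assumes "a * d - 3 * n = 1"
  obtains s j l where "s = 1 \<or> s = - 1" "a = s + 3 * j" "d = s + 3 * l"
proof -
  have "(a * d) mod 3 = (1 + 3 * n) mod 3" using assms by (simp add: algebra_simps)
  hence *: "((a mod 3) * (d mod 3)) mod 3 = 1" by (simp add: mod_mult_eq)
  have "a mod 3 \<in> {0, 1, 2}" "d mod 3 \<in> {0, 1, 2}" by (rule mod3_cases)+
  with * have "a mod 3 = 1 \<and> d mod 3 = 1 \<or> a mod 3 = 2 \<and> d mod 3 = 2" by auto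
  thus ?thesis
  proof
    assume "a mod 3 = 1 \<and> d mod 3 = 1"
    hence "a = 1 + 3 * (a div 3)" "d = 1 + 3 * (d div 3)" by presburger+
    thus ?thesis using that by blast
  next
    assume "a mod 3 = 2 \<and> d mod 3 = 2"
    hence "a = - 1 + 3 * (a div 3 + 1)" "d = - 1 + 3 * (d div 3 + 1)" by presburger+
    thus ?thesis using that by blast
  qed
qed

text \<open>The entries \<open>b\<close> and \<open>e\<close> occur with weights 1 and 5 in one
  exponent and with 5 and 1 in the other, so the exponents add up to a multiple of 6. Both
  multipliers are thus cube roots of unity, inverse to each other, which leaves the cubes and the
  product of \<open>k1\<close> and \<open>k2\<close> invariant.\<close>

lemma k12_transform:
  assumes det: "a * d - b * (45 * e) = 1" and z: "z \<in> uhp"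
  obtains u v where "k1 (moebius_map a b (45 * e) d z) = z6 u * k1 z"
    "k2 (moebius_map a b (45 * e) d z) = z6 v * k2 z" "6 dvd u + v" "even u" "even v"
proof -
  have "a * d - 3 * (b * (15 * e)) = 1" using det by simp
  then obtain s j l where s: "s = 1 \<or> s = - 1" "a = s + 3 * j" "d = s + 3 * l"
    using mod3_unit by blast
  have z3: "3 * z \<in> uhp" and z15: "15 * z \<in> uhp" using z by (auto simp: uhp_def)
  have nz: "of_int (45 * e) * z + of_int d \<noteq> 0"
    by (rule moebius_denom_nonzero[OF _ z, of a d b]) (use det in auto)
  have "3 * moebius_map a b (45 * e) d z = moebius_map a (3 * b) (3 * (5 * e)) d (3 * z)"
    by (simp add: moebius_map_def algebra_simps)
  moreover have "kap (moebius_map a (3 * b) (3 * (5 * e)) d (3 * z)) =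
      z6 (b * (3 + a) + 3 * j - 5 * e * (3 - d) - 3 * l) * kap (3 * z)"
    by (rule kap_transform[OF _ z3 s]) (use det in simp)
  ultimately have 1: "k1 (moebius_map a b (45 * e) d z) =
      z6 (b * (3 + a) + 3 * j - 5 * e * (3 - d) - 3 * l) * k1 z"
    by (simp only: k1_def)
  have "15 * moebius_map a b (45 * e) d z = moebius_map a (3 * (5 * b)) (3 * e) d (15 * z)"
    by (simp add: moebius_map_def algebra_simps)
  moreover have "kap (moebius_map a (3 * (5 * b)) (3 * e) d (15 * z)) =
      z6 (5 * b * (3 + a) + 3 * j - e * (3 - d) - 3 * l) * kap (15 * z)"
    by (rule kap_transform[OF _ z15 s]) (use det in simp)
  ultimately have 2: "k2 (moebius_map a b (45 * e) d z) =
      z6 (5 * b * (3 + a) + 3 * j - e * (3 - d) - 3 * l) * k2 z"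
    by (simp only: k2_def)
  \<comment> \<open>If \<open>a\<close> is even, then \<open>b\<close> and \<open>e\<close> are odd
    because the determinant is odd, and likewise for \<open>d\<close>; with the parities of
    \<open>j\<close> and \<open>l\<close> this makes each exponent even.\<close>
  have par: "odd (a * d - b * (45 * e))" "odd s"
    using det s(1) by auto
  have "even a \<longleftrightarrow> odd j" "even d \<longleftrightarrow> odd l" using s(2,3) par(2) by auto
  hence "even (b * (3 + a) + 3 * j - 5 * e * (3 - d) - 3 * l)"
    "even (5 * b * (3 + a) + 3 * j - e * (3 - d) - 3 * l)"
    using par(1) by auto
  moreover have "(b * (3 + a) + 3 * j - 5 * e * (3 - d) - 3 * l) + (5 * b * (3 + a) + 3 * j - e * (3 - d) - 3 * l)
      = 6 * (b * (3 + a) + j - e * (3 - d) - l)"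
    by (simp add: algebra_simps)
  hence "6 dvd (b * (3 + a) + 3 * j - 5 * e * (3 - d) - 3 * l) + (5 * b * (3 + a) + 3 * j - e * (3 - d) - 3 * l)"
    by simp
  ultimately show ?thesis using that[OF 1 2] by blast
qed

text \<open>Multiplying the matrix on the left by \<open>diag(3, 1)\<close> gives a matrix of the
  kind in \<open>kap_transform\<close> applied to \<open>15 * z\<close>, while
  \<open>diag(15, 1)\<close> leads back to \<open>3 * z\<close>. The roots of unity have trivial
  cubes, and their product is \<open>z6 24 = 1\<close>.\<close>

lemma k12_W:
  assumes z: "z \<in> uhp"
  shows "k1 (moebius_map 10 1 45 5 z) = z6 4 * k2 z" "k2 (moebius_map 10 1 45 5 z) = z6 20 * k1 z"
proof -
  have z3: "3 * z \<in> uhp" and z15: "15 * z \<in> uhp" using z by (auto simp: uhp_def)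
  have nz: "45 * z + 5 \<noteq> 0" "9 * z + 1 \<noteq> 0"
    using moebius_denom_nonzero[OF _ z, of 10 5 1 45] moebius_denom_nonzero[OF _ z, of 1 1 0 9] by auto
  have "3 * moebius_map 10 1 45 5 z = moebius_map 2 (3 * 1) (3 * 1) 5 (15 * z)"
    using nz by (simp add: moebius_map_def field_simps)
  moreover have "kap (moebius_map 2 (3 * 1) (3 * 1) 5 (15 * z)) = z6 (1 * (3 + 2) + 3 * 1 - 1 * (3 - 5) - 3 * 2) * kap (15 * z)"
    by (rule kap_transform[OF _ z15, where s = "-1"]) auto
  ultimately show "k1 (moebius_map 10 1 45 5 z) = z6 4 * k2 z"
    by (simp add: k1_def k2_def)
  have "45 * z + 5 = 5 * (9 * z + 1)" by (simp add: algebra_simps)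
  hence "15 * moebius_map 10 1 45 5 z = moebius_map 10 (3 * 1) (3 * 1) 1 (3 * z)"
    using nz by (simp add: moebius_map_def field_simps)
  moreover have "kap (moebius_map 10 (3 * 1) (3 * 1) 1 (3 * z)) = z6 (1 * (3 + 10) + 3 * 3 - 1 * (3 - 1) - 3 * 0) * kap (3 * z)"
    by (rule kap_transform[OF _ z3, where s = 1]) auto
  ultimately show "k2 (moebius_map 10 1 45 5 z) = z6 20 * k1 z"
    by (simp add: k1_def k2_def)
qed

text \<open>In terms of the Dedekind eta function, \<open>hf = (\<eta>(z) / \<eta>(9z))\<^sup>3\<close> and
  \<open>kf = (\<eta>(5z) / \<eta>(45z))\<^sup>3\<close>.\<close>
definition hf :: mero_uhp where "hf = mero_of (\<lambda>z. k1 z ^ 3)"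
definition kf :: mero_uhp where "kf = mero_of (\<lambda>z. k2 z ^ 3)"
definition pf :: mero_uhp where "pf = mero_of (\<lambda>z. k1 z * k2 z)"

section \<open>Functions on \<open>X_0(45)\<close> from holomorphic functions on the upper half
  plane\<close>

definition exp_growth :: "(complex \<Rightarrow> complex) \<Rightarrow> bool" where
  "exp_growth u \<longleftrightarrow> (\<exists>A B C. \<forall>z. Im z \<ge> B \<longrightarrow> norm (u z) \<le> C * exp (A * Im z))"

definition bounded_inf :: "(complex \<Rightarrow> complex) \<Rightarrow> bool" where
  "bounded_inf u \<longleftrightarrow> (\<exists>B C. \<forall>z. Im z \<ge> B \<longrightarrow> norm (u z) \<le> C)"

lemma exp_growth_mult:
  assumes "exp_growth u" "exp_growth v"
  shows "exp_growth (\<lambda>z. u z * v z)"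
proof -
  obtain A B C where u: "\<And>z. Im z \<ge> B \<Longrightarrow> norm (u z) \<le> C * exp (A * Im z)"
    using assms(1) unfolding exp_growth_def by blast
  obtain A' B' C' where v: "\<And>z. Im z \<ge> B' \<Longrightarrow> norm (v z) \<le> C' * exp (A' * Im z)"
    using assms(2) unfolding exp_growth_def by blast
  have "norm (u z * v z) \<le> (C * C') * exp ((A + A') * Im z)" if "Im z \<ge> max B B'" for z
  proof -
    have "norm (u z) \<le> C * exp (A * Im z)" "norm (v z) \<le> C' * exp (A' * Im z)"
      using u v that by auto
    hence "norm (u z) * norm (v z) \<le> (C * exp (A * Im z)) * (C' * exp (A' * Im z))"
      by (intro mult_mono) (auto intro: order_trans[OF norm_ge_zero])
    thus ?thesis by (simp add: norm_mult exp_add algebra_simps)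
  qed
  thus ?thesis unfolding exp_growth_def by blast
qed

lemma exp_growth_const: "exp_growth (\<lambda>_. c)"
  unfolding exp_growth_def by (intro exI[of _ 0] exI[of _ "norm c"]) auto

lemma exp_growth_power: "exp_growth u \<Longrightarrow> exp_growth (\<lambda>z. u z ^ n)"
  by (induction n) (auto intro: exp_growth_mult exp_growth_const)

lemma bounded_inf_mult:
  assumes "bounded_inf u" "bounded_inf v"
  shows "bounded_inf (\<lambda>z. u z * v z)"
proof -
  obtain B C where u: "\<And>z. Im z \<ge> B \<Longrightarrow> norm (u z) \<le> C"
    using assms(1) unfolding bounded_inf_def by blast
  obtain B' C' where v: "\<And>z. Im z \<ge> B' \<Longrightarrow> norm (v z) \<le> C'"
    using assms(2) unfolding bounded_inf_def by blast
  have "norm (u z * v z) \<le> C * C'" if "Im z \<ge> max B B'" for z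
  proof -
    have "norm (u z) \<le> C" "norm (v z) \<le> C'" using u v that by auto
    thus ?thesis unfolding norm_mult
      by (intro mult_mono) (auto intro: order_trans[OF norm_ge_zero])
  qed
  thus ?thesis unfolding bounded_inf_def by blast
qed

lemma bounded_inf_const: "bounded_inf (\<lambda>_. c)"
  unfolding bounded_inf_def by (intro exI[of _ 0] exI[of _ "norm c"]) auto

lemma bounded_inf_power: "bounded_inf u \<Longrightarrow> bounded_inf (\<lambda>z. u z ^ n)"
  by (induction n) (auto intro: bounded_inf_mult bounded_inf_const)

lemma bounded_inf_add:
  assumes "bounded_inf u" "bounded_inf v"
  shows "bounded_inf (\<lambda>z. u z + v z)"
proof -
  obtain B C where u: "\<And>z. Im z \<ge> B \<Longrightarrow> norm (u z) \<le> C"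
    using assms(1) unfolding bounded_inf_def by blast
  obtain B' C' where v: "\<And>z. Im z \<ge> B' \<Longrightarrow> norm (v z) \<le> C'"
    using assms(2) unfolding bounded_inf_def by blast
  have "norm (u z + v z) \<le> C + C'" if "Im z \<ge> max B B'" for z
    using u[of z] v[of z] that norm_triangle_ineq[of "u z" "v z"] by auto
  thus ?thesis unfolding bounded_inf_def by blast
qed

lemma bounded_at_inf_bounded_inf: "bounded_at_inf f \<longleftrightarrow> bounded_inf (eval_uhp f)"
  by (simp add: bounded_at_inf_def bounded_inf_def)

lemma bounded_inf_cong:
  assumes "\<And>z. z \<in> uhp \<Longrightarrow> u z = v z" "bounded_inf u"
  shows "bounded_inf v"
proof -
  obtain B C where u: "\<And>z. Im z \<ge> B \<Longrightarrow> norm (u z) \<le> C"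
    using assms(2) unfolding bounded_inf_def by blast
  have "norm (v z) \<le> C" if "Im z \<ge> max 1 B" for z
    using u[of z] assms(1)[of z] that by (auto simp: uhp_def)
  thus ?thesis unfolding bounded_inf_def by blast
qed

lemma mero_of_cong:
  assumes "\<And>z. z \<in> uhp \<Longrightarrow> u z = v z"
  shows "mero_of u = mero_of v"
proof -
  have "remove_sings u z = remove_sings v z" if "z \<in> uhp" for z
  proof (rule remove_sings_cong)
    show "\<forall>\<^sub>F w in at z. u w = v w"
      using eventually_at_in_open'[OF open_uhp that] by eventually_elim (rule assms)
  qed simp
  thus ?thesis unfolding mero_of_def by (metis (no_types, lifting))
qed

lemma X0c_mero_of:
  assumes hol: "u holomorphic_on uhp"
    and inv: "\<And>a b e d z. a * d - b * (45 * e) = 1 \<Longrightarrow> z \<in> uhp \<Longrightarrow> u (moebius_map a b (45 * e) d z) = u z"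
    and gr: "\<And>a b c d. a * d - b * c = 1 \<Longrightarrow> exp_growth (\<lambda>z. u (moebius_map a b c d z))"
  shows "mero_of u \<in> X0_functions_complex 45"
  unfolding X0_functions_complex_iff[OF zero_less_numeral] gamma0_invariant_def
proof (intro conjI allI impI)
  fix a b c d :: int assume *: "a * d - b * c = 1 \<and> int 45 dvd c"
  then obtain e where e: "c = 45 * e" by auto
  have "pullback a b c d (mero_of u) = mero_of (\<lambda>z. u (moebius_map a b c d z))"
    by (rule pullback_mero_of) (use * hol in auto)
  also have "\<dots> = mero_of u"
    by (rule mero_of_cong) (use * e inv in auto)
  finally show "pullback a b c d (mero_of u) = mero_of u" .
next
  fix a b c d :: int assume det: "a * d - b * c = 1"
  have eq: "eval_uhp (pullback a b c d (mero_of u)) z = u (moebius_map a b c d z)" if "z \<in> uhp" for z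
    using eval_pullback[of a d b c z "mero_of u"] moebius_in_uhp[of a d b c z] det that
      eval_mero_of_holomorphic[OF hol] by simp
  obtain A B C where g: "\<And>z. Im z \<ge> B \<Longrightarrow> norm (u (moebius_map a b c d z)) \<le> C * exp (A * Im z)"
    using gr[OF det] unfolding exp_growth_def by blast
  have "eval_uhp (mero_of u) holomorphic_on uhp"
    using hol by (rule holomorphic_transform) (simp add: eval_mero_of_holomorphic[OF hol])
  hence "eval_uhp (pullback a b c d (mero_of u)) holomorphic_on uhp"
    by (rule holomorphic_pullback) (use det in auto)
  hence "eval_uhp (pullback a b c d (mero_of u)) holomorphic_on {z. Im z > max 1 B}"
    by (rule holomorphic_on_subset) (auto simp: uhp_def)
  moreover have "norm (eval_uhp (pullback a b c d (mero_of u)) z) \<le> C * exp (A * Im z)" if "Im z > max 1 B" for z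
    using g[of z] eq[of z] that by (auto simp: uhp_def)
  ultimately show "mod_growth (pullback a b c d (mero_of u))"
    unfolding mod_growth_def by (intro exI[of _ A] exI[of _ "max 1 B"] exI[of _ C]) auto
qed

lemma k1_grow: "a * d - b * c = 1 \<Longrightarrow> exp_growth (\<lambda>z. k1 (moebius_map a b c d z))"
  using kap_growth[of a d b c 3] by (simp add: exp_growth_def k1_def)

lemma k2_grow: "a * d - b * c = 1 \<Longrightarrow> exp_growth (\<lambda>z. k2 (moebius_map a b c d z))"
  using kap_growth[of a d b c 15] by (simp add: exp_growth_def k2_def)

lemma k1_bounded_inf: "a * d - b * c = 1 \<Longrightarrow> \<not> 9 dvd c \<Longrightarrow> bounded_inf (\<lambda>z. k1 (moebius_map a b c d z))"
  using kap_bounded[of a d b c 3] by (simp add: bounded_inf_def k1_def)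

lemma k2_bounded_inf: "a * d - b * c = 1 \<Longrightarrow> \<not> 9 dvd c \<Longrightarrow> bounded_inf (\<lambda>z. k2 (moebius_map a b c d z))"
  using kap_bounded[of a d b c 15] by (simp add: bounded_inf_def k2_def)

lemma hf_X0c: "hf \<in> X0_functions_complex 45"
  unfolding hf_def
proof (rule X0c_mero_of)
  fix a b e d :: int and z assume "a * d - b * (45 * e) = 1" "z \<in> uhp"
  then obtain u where u: "k1 (moebius_map a b (45 * e) d z) = z6 u * k1 z" "even u"
    using k12_transform by metis
  have "z6 u ^ 3 = 1" unfolding z6_power by (rule z6_eq_1) (use u(2) in \<open>auto elim!: evenE\<close>)
  thus "k1 (moebius_map a b (45 * e) d z) ^ 3 = k1 z ^ 3"
    by (simp add: u(1) power_mult_distrib)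
qed (auto intro!: holomorphic_intros k1_holomorphic exp_growth_power k1_grow)

lemma kf_X0c: "kf \<in> X0_functions_complex 45"
  unfolding kf_def
proof (rule X0c_mero_of)
  fix a b e d :: int and z assume "a * d - b * (45 * e) = 1" "z \<in> uhp"
  then obtain u where u: "k2 (moebius_map a b (45 * e) d z) = z6 u * k2 z" "even u"
    using k12_transform by metis
  have "z6 u ^ 3 = 1" unfolding z6_power by (rule z6_eq_1) (use u(2) in \<open>auto elim!: evenE\<close>)
  thus "k2 (moebius_map a b (45 * e) d z) ^ 3 = k2 z ^ 3"
    by (simp add: u(1) power_mult_distrib)
qed (auto intro!: holomorphic_intros k2_holomorphic exp_growth_power k2_grow)

lemma pf_X0c: "pf \<in> X0_functions_complex 45"
  unfolding pf_def
proof (rule X0c_mero_of)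
  fix a b e d :: int and z assume "a * d - b * (45 * e) = 1" "z \<in> uhp"
  then obtain u v where u: "k1 (moebius_map a b (45 * e) d z) = z6 u * k1 z"
    "k2 (moebius_map a b (45 * e) d z) = z6 v * k2 z" "6 dvd u + v"
    using k12_transform by metis
  have "z6 u * z6 v = 1" unfolding z6_add[symmetric] by (rule z6_eq_1[OF u(3)])
  thus "k1 (moebius_map a b (45 * e) d z) * k2 (moebius_map a b (45 * e) d z) = k1 z * k2 z"
    by (simp add: u(1,2))
qed (auto intro!: holomorphic_intros k1_holomorphic k2_holomorphic exp_growth_mult k1_grow k2_grow)

text \<open>The matrix of determinant 5 given by \<open>A = 2\<close> and
  \<open>B = C = D = 1\<close>.\<close>

definition w5 :: "mero_uhp \<Rightarrow> mero_uhp" where "w5 f = pullback 10 1 45 5 f"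

lemma atkin_lehner_45_5:
  assumes "f \<in> X0_functions_complex 45" "atkin_lehner_matrix 45 5 (A, B, C, D)"
  shows "atkin_lehner 45 5 f = pullback (A * 5) B (45 * C) (D * 5) f"
  using atkin_lehner_eq[of 5 45 f A B C D] assms by simp

lemma atkin_lehner_w5: "f \<in> X0_functions_complex 45 \<Longrightarrow> atkin_lehner 45 5 f = w5 f"
  using atkin_lehner_45_5[of f 2 1 1 1] by (simp add: atkin_lehner_matrix_def w5_def)

lemma w5_add: "w5 (f + g) = w5 f + w5 g" by (simp add: w5_def pullback_add)
lemma w5_mult: "w5 (f * g) = w5 f * w5 g" by (simp add: w5_def pullback_mult)
lemma w5_uminus: "w5 (- f) = - w5 f" by (simp add: w5_def pullback_uminus)
lemma w5_diff: "w5 (f - g) = w5 f - w5 g" using w5_add[of f "- g"] by (simp add: w5_uminus)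
lemma w5_inverse: "w5 (inverse f) = inverse (w5 f)" by (simp add: w5_def pullback_inverse)
lemma w5_divide: "w5 (f / g) = w5 f / w5 g" by (simp add: divide_inverse w5_mult w5_inverse)
lemma w5_cm: "w5 (cm c) = cm c" by (simp add: w5_def pullback_cm)
lemma w5_mero_of:
  assumes "u holomorphic_on uhp" "\<And>z. z \<in> uhp \<Longrightarrow> u (moebius_map 10 1 45 5 z) = v z"
  shows "w5 (mero_of u) = mero_of v"
proof -
  have "w5 (mero_of u) = mero_of (\<lambda>z. u (moebius_map 10 1 45 5 z))"
    unfolding w5_def by (rule pullback_mero_of) (use assms(1) in auto)
  also have "\<dots> = mero_of v"
    by (rule mero_of_cong) (rule assms(2))
  finally show ?thesis .
qed

lemma w5_hf: "w5 hf = kf"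
  unfolding hf_def kf_def
proof (rule w5_mero_of)
  show "k1 (moebius_map 10 1 45 5 z) ^ 3 = k2 z ^ 3" if "z \<in> uhp" for z
    using k12_W[OF that] z6_eq_1[of 12] by (simp add: power_mult_distrib z6_power)
qed (intro holomorphic_intros k1_holomorphic)

lemma w5_kf: "w5 kf = hf"
  unfolding hf_def kf_def
proof (rule w5_mero_of)
  show "k2 (moebius_map 10 1 45 5 z) ^ 3 = k1 z ^ 3" if "z \<in> uhp" for z
    using k12_W[OF that] z6_eq_1[of 60] by (simp add: power_mult_distrib z6_power)
qed (intro holomorphic_intros k2_holomorphic)

lemma w5_pf: "w5 pf = pf"
  unfolding pf_def
proof (rule w5_mero_of)
  show "k1 (moebius_map 10 1 45 5 z) * k2 (moebius_map 10 1 45 5 z) = k1 z * k2 z" if "z \<in> uhp" for z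
    using k12_W[OF that] z6_add[of 4 20] z6_eq_1[of 24] by simp
qed (intro holomorphic_intros k1_holomorphic k2_holomorphic)

lemma hf_kf: "hf * kf = pf ^ 3"
proof -
  have m: "k1 meromorphic_on uhp" "k2 meromorphic_on uhp"
    using k1_holomorphic k2_holomorphic by (auto simp: analytic_on_open intro!: analytic_on_imp_meromorphic_on)
  have "mero_of k1 * mero_of k2 = pf" unfolding pf_def by (rule mero_of_mult[OF m])
  moreover have "mero_of u ^ 3 = mero_of (\<lambda>z. u z ^ 3)" if "u meromorphic_on uhp" for u
    using that by (simp add: power3_eq_cube mero_of_mult meromorphic_intros)
  hence "mero_of k1 ^ 3 = hf" "mero_of k2 ^ 3 = kf" using m by (simp_all add: hf_def kf_def)
  ultimately show ?thesis by (metis power_mult_distrib)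
qed

lemma mero_of_eval: "mero_of (eval_uhp f) = f"
  by (rule mero_of_eqI[symmetric, OF eval_uhp_meromorphic]) simp

section \<open>Pointwise arithmetic of holomorphic functions, and functions regular outside the
  poles of \<open>pf\<close>\<close>

lemma eval_add_holomorphic:
  assumes "eval_uhp f holomorphic_on uhp" "eval_uhp g holomorphic_on uhp" "z \<in> uhp"
  shows "eval_uhp (f + g) z = eval_uhp f z + eval_uhp g z"
proof -
  have "f + g = mero_of (\<lambda>z. eval_uhp f z + eval_uhp g z)" by (rule plus_mero_uhp_def)
  thus ?thesis using eval_mero_of_holomorphic[of "\<lambda>z. eval_uhp f z + eval_uhp g z" z] assms
    by (simp add: holomorphic_intros)
qed

lemma eval_mult_holomorphic:
  assumes "eval_uhp f holomorphic_on uhp" "eval_uhp g holomorphic_on uhp" "z \<in> uhp"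
  shows "eval_uhp (f * g) z = eval_uhp f z * eval_uhp g z"
proof -
  have "f * g = mero_of (\<lambda>z. eval_uhp f z * eval_uhp g z)" by (rule times_mero_uhp_def)
  thus ?thesis using eval_mero_of_holomorphic[of "\<lambda>z. eval_uhp f z * eval_uhp g z" z] assms
    by (simp add: holomorphic_intros)
qed

lemma holomorphic_add:
  assumes "eval_uhp f holomorphic_on uhp" "eval_uhp g holomorphic_on uhp"
  shows "eval_uhp (f + g) holomorphic_on uhp"
proof -
  have "(\<lambda>z. eval_uhp f z + eval_uhp g z) holomorphic_on uhp" by (intro holomorphic_intros assms)
  thus ?thesis by (rule holomorphic_transform) (simp add: eval_add_holomorphic assms)
qed

lemma holomorphic_mult:
  assumes "eval_uhp f holomorphic_on uhp" "eval_uhp g holomorphic_on uhp"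
  shows "eval_uhp (f * g) holomorphic_on uhp"
proof -
  have "(\<lambda>z. eval_uhp f z * eval_uhp g z) holomorphic_on uhp" by (intro holomorphic_intros assms)
  thus ?thesis by (rule holomorphic_transform) (simp add: eval_mult_holomorphic assms)
qed

lemma holomorphic_cm: "eval_uhp (cm c) holomorphic_on uhp"
  by (rule holomorphic_transform[OF holomorphic_on_const]) (simp add: eval_cm)

lemma bounded_at_inf_add:
  assumes "eval_uhp f holomorphic_on uhp" "eval_uhp g holomorphic_on uhp" "bounded_at_inf f" "bounded_at_inf g"
  shows "bounded_at_inf (f + g)"
  unfolding bounded_at_inf_bounded_inf
  by (rule bounded_inf_cong[OF _ bounded_inf_add[OF assms(3,4)[unfolded bounded_at_inf_bounded_inf]]]) (simp add: eval_add_holomorphic assms)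

lemma bounded_at_inf_mult:
  assumes "eval_uhp f holomorphic_on uhp" "eval_uhp g holomorphic_on uhp" "bounded_at_inf f" "bounded_at_inf g"
  shows "bounded_at_inf (f * g)"
  unfolding bounded_at_inf_bounded_inf
  by (rule bounded_inf_cong[OF _ bounded_inf_mult[OF assms(3,4)[unfolded bounded_at_inf_bounded_inf]]]) (simp add: eval_mult_holomorphic assms)

lemma bounded_at_inf_cm: "bounded_at_inf (cm c)"
  unfolding bounded_at_inf_bounded_inf by (rule bounded_inf_cong[OF _ bounded_inf_const]) (simp add: eval_cm)

text \<open>The cusps \<open>a/c\<close> with \<open>9 dvd c\<close>, which are left out, are \<open>\<infinity>\<close> and its image under \<open>w5\<close>. Hence a
  regular function is determined up to a constant by its principal part at \<open>\<infinity>\<close>.\<close>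
definition reg :: "mero_uhp \<Rightarrow> bool" where
  "reg f \<longleftrightarrow> f \<in> X0_functions_complex 45 \<and> w5 f = f \<and> eval_uhp f holomorphic_on uhp \<and>
     (\<forall>a b c d. a * d - b * c = 1 \<and> \<not> 9 dvd c \<longrightarrow> bounded_at_inf (pullback a b c d f))"

lemma reg_cm: "reg (cm c)"
  by (auto simp: reg_def X0c_cm w5_cm holomorphic_cm pullback_cm bounded_at_inf_cm)

lemma reg_add: "reg f \<Longrightarrow> reg g \<Longrightarrow> reg (f + g)"
  by (auto simp: reg_def X0c_add w5_add holomorphic_add pullback_add holomorphic_pullback intro!: bounded_at_inf_add)

lemma reg_mult: "reg f \<Longrightarrow> reg g \<Longrightarrow> reg (f * g)"
  by (auto simp: reg_def X0c_mult w5_mult holomorphic_mult pullback_mult holomorphic_pullback intro!: bounded_at_inf_mult)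

lemma reg_power: "reg f \<Longrightarrow> reg (f ^ n)"
  by (induction n) (use reg_cm[of 1] reg_mult in auto)

lemma reg_uminus: "reg f \<Longrightarrow> reg (- f)"
  using reg_mult[OF reg_cm[of "-1"], of f] by (simp add: cm_minus)

lemma reg_sum: "(\<And>i. i \<in> I \<Longrightarrow> reg (f i)) \<Longrightarrow> reg (\<Sum>i\<in>I. f i)"
  by (induction I rule: infinite_finite_induct) (use reg_cm[of 0] reg_add in auto)

lemma bounded_pullback_mero_of:
  assumes "u holomorphic_on uhp" "a * d - b * c = 1" "bounded_inf (\<lambda>z. u (moebius_map a b c d z))"
  shows "bounded_at_inf (pullback a b c d (mero_of u))"
  unfolding bounded_at_inf_bounded_inf
  by (rule bounded_inf_cong[OF _ assms(3)])
     (use eval_pullback[of a d b c _ "mero_of u"] moebius_in_uhp[of a d b c] assms(2)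
        eval_mero_of_holomorphic[OF assms(1)] in simp)

lemma holomorphic_mero_of: "u holomorphic_on uhp \<Longrightarrow> eval_uhp (mero_of u) holomorphic_on uhp"
  by (rule holomorphic_transform) (simp_all add: eval_mero_of_holomorphic)

lemma hf_holomorphic: "eval_uhp hf holomorphic_on uhp"
  unfolding hf_def by (intro holomorphic_mero_of holomorphic_intros k1_holomorphic)

lemma kf_holomorphic: "eval_uhp kf holomorphic_on uhp"
  unfolding kf_def by (intro holomorphic_mero_of holomorphic_intros k2_holomorphic)

lemma pf_holomorphic: "eval_uhp pf holomorphic_on uhp"
  unfolding pf_def by (intro holomorphic_mero_of holomorphic_intros k1_holomorphic k2_holomorphic)

lemma reg_pf: "reg pf"
  unfolding reg_def
  using pf_X0c w5_pf pf_holomorphic k1_bounded_inf k2_bounded_inf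
  by (auto simp: pf_def intro!: bounded_pullback_mero_of bounded_inf_mult holomorphic_intros k1_holomorphic k2_holomorphic)

lemma reg_hf_kf: "reg (hf + kf)"
proof -
  have "bounded_at_inf (pullback a b c d hf)" "bounded_at_inf (pullback a b c d kf)"
    if "a * d - b * c = 1" "\<not> 9 dvd c" for a b c d
    using k1_bounded_inf[OF that] k2_bounded_inf[OF that] that(1) unfolding hf_def kf_def
    by (auto intro!: bounded_pullback_mero_of bounded_inf_power holomorphic_intros k1_holomorphic k2_holomorphic)
  thus ?thesis
    unfolding reg_def using hf_X0c kf_X0c w5_hf w5_kf hf_holomorphic kf_holomorphic
    by (auto simp: X0c_add w5_add add.commute holomorphic_add pullback_add holomorphic_pullback intro!: bounded_at_inf_add)
qed

text \<open>If \<open>45 dvd c\<close>, the pullback is \<open>f\<close> itself. Otherwise the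
  matrix, multiplied on the right by the one with rows \<open>(5, j)\<close> and
  \<open>(0, 1)\<close>, becomes an Atkin-Lehner matrix for 5 and fixes \<open>f\<close>; so the
  pullback is \<open>f\<close> in the variable \<open>(z - j) / 5\<close>.\<close>

lemma bounded_at_inf_pullback_9:
  assumes f: "f \<in> X0_functions_complex 45" "w5 f = f" "bounded_at_inf f"
    and det: "a * d - b * c = 1" and c9: "9 dvd c"
  shows "bounded_at_inf (pullback a b c d f)"
proof (cases "5 dvd c")
  case True
  have "45 dvd c" using True c9 by presburger
  thus ?thesis using X0c_invariant[OF f(1)] f(3) det by (simp add: gamma0_invariant_def)
next
  case False
  obtain c2 where c2: "c = 9 * c2" using c9 by blast
  have "coprime 5 c"
    by (rule prime_imp_coprime) (use False in auto)
  then obtain x y where xy: "x * 5 + y * c = 1"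
    by (metis bezout_int coprime_iff_gcd_eq_1)
  \<comment> \<open>Chosen so that 5 divides \<open>j * c + d\<close>, as the lower right entry of
    an Atkin-Lehner matrix requires.\<close>
  define j where "j = - d * y"
  have jc: "j * c + d = (d * x) * 5"
  proof -
    have "j * c + d = d * (1 - y * c)" by (simp add: j_def algebra_simps)
    also have "1 - y * c = x * 5" using xy by simp
    finally show ?thesis by simp
  qed
  have det5: "(a * 5) * (j * c + d) - (j * a + b) * (45 * c2) = 5"
    using det by (simp add: c2 algebra_simps)
  have "atkin_lehner_matrix 45 5 (a, j * a + b, c2, d * x)"
    using det5 unfolding jc by (simp add: atkin_lehner_matrix_def)
  from atkin_lehner_45_5[OF f(1) this] have "pullback (a * 5) (j * a + b) (45 * c2) (d * x * 5) f = f"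
    using atkin_lehner_w5[OF f(1)] f(2) by simp
  moreover have "pullback 5 j 0 1 (pullback a b c d f) =
      pullback (a * 5 + b * 0) (a * j + b * 1) (c * 5 + d * 0) (c * j + d * 1) f"
    by (rule pullback_pullback) (use det in auto)
  moreover have "c * 5 = 45 * c2" "c * j + d = d * x * 5" using jc c2 by (simp_all add: mult.commute)
  ultimately have eq: "pullback 5 j 0 1 (pullback a b c d f) = f"
    by (simp add: mult.commute)
  have ev: "eval_uhp (pullback a b c d f) z = eval_uhp f ((z - of_int j) / 5)" if "z \<in> uhp" for z
  proof -
    have "(z - of_int j) / 5 \<in> uhp" using that by (simp add: uhp_def)
    from eval_pullback_upper[of 5 1 _ j "pullback a b c d f", OF _ _ this]
    have "eval_uhp f ((z - of_int j) / 5) = eval_uhp (pullback a b c d f) ((5 * ((z - of_int j) / 5) + of_int j) / 1)"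
      by (simp add: eq)
    also have "(5 * ((z - of_int j) / 5) + of_int j) / 1 = z" by (simp add: field_simps)
    finally show ?thesis ..
  qed
  obtain B C where BC: "\<And>z. Im z \<ge> B \<Longrightarrow> norm (eval_uhp f z) \<le> C"
    using f(3) unfolding bounded_at_inf_def by blast
  have "norm (eval_uhp (pullback a b c d f) z) \<le> C" if "Im z \<ge> max 1 (5 * B)" for z
    using ev[of z] BC[of "(z - of_int j) / 5"] that by (auto simp: uhp_def)
  thus ?thesis unfolding bounded_at_inf_def by blast
qed

theorem reg_bounded_constant:
  assumes "reg f" "bounded_at_inf f"
  shows "\<exists>c. f = cm c"
proof (rule Liouville_gamma0)
  show "gamma0_invariant 45 f" "eval_uhp f holomorphic_on uhp"
    using assms(1) X0c_invariant by (auto simp: reg_def)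
  show "bounded_at_inf (pullback a b c d f)" if "a * d - b * c = 1" for a b c d
    using assms bounded_at_inf_pullback_9[of f a d b c] that by (cases "9 dvd c") (auto simp: reg_def)
qed simp

section \<open>Clearing the poles of invariant functions\<close>

definition pev :: "mero_uhp \<Rightarrow> complex poly \<Rightarrow> mero_uhp" where
  "pev x D = poly (map_poly cm D) x"

lemma pev_0 [simp]: "pev x 0 = 0"
  by (simp add: pev_def)

lemma pev_pCons: "pev x (pCons a D) = cm a + x * pev x D"
  by (simp add: pev_def map_poly_pCons)

lemma pev_add: "pev x (D + E) = pev x D + pev x E"
proof (induction D E rule: poly_induct2)
  case (pCons a D b E)
  thus ?case by (simp add: pev_pCons cm_add algebra_simps)
qed simp

lemma pev_smult: "pev x (smult c D) = cm c * pev x D"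
  by (induction D) (simp_all add: pev_pCons cm_mult algebra_simps)

lemma pev_mult: "pev x (D * E) = pev x D * pev x E"
  by (induction D) (simp_all add: pev_pCons pev_add pev_smult algebra_simps)

lemma pev_1 [simp]: "pev x 1 = 1"
  using pev_pCons[of x 1 0] by (simp add: one_pCons)

lemma pev_power: "pev x (D ^ n) = pev x D ^ n"
  by (induction n) (simp_all add: pev_mult)

lemma pev_linear: "pev x [:- c, 1:] = x - cm c"
  by (simp add: pev_pCons cm_minus)

lemma pev_monom: "pev x (monom c n) = cm c * x ^ n"
  by (induction n) (simp_all add: monom_0 monom_Suc pev_pCons algebra_simps)

lemma pev_sum: "pev x (\<Sum>i\<in>I. D i) = (\<Sum>i\<in>I. pev x (D i))"
  by (induction I rule: infinite_finite_induct) (simp_all add: pev_add)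

lemma X0c_pev: "x \<in> X0_functions_complex N \<Longrightarrow> N > 0 \<Longrightarrow> pev x D \<in> X0_functions_complex N"
  by (induction D) (use X0c_cm[of 0] in \<open>auto simp: pev_pCons X0c_cm X0c_add X0c_mult\<close>)

lemma w5_pev: "w5 (pev x D) = pev (w5 x) D"
  by (induction D) (use w5_cm[of 0] in \<open>auto simp: pev_pCons w5_add w5_mult w5_cm\<close>)

lemma pullback_pev:
  assumes "a * d - b * c > 0"
  shows "pullback a b c d (pev x D) = pev (pullback a b c d x) D"
  by (induction D) (use pullback_cm[OF assms, of 0] assms in
    \<open>auto simp: pev_pCons pullback_add pullback_mult pullback_cm\<close>)

lemma holomorphic_pev: "eval_uhp x holomorphic_on uhp \<Longrightarrow> eval_uhp (pev x D) holomorphic_on uhp"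
  by (induction D) (use holomorphic_cm[of 0] in
    \<open>auto simp: pev_pCons holomorphic_add holomorphic_mult holomorphic_cm\<close>)

lemma bounded_at_inf_pev:
  assumes "eval_uhp x holomorphic_on uhp" "bounded_at_inf x"
  shows "bounded_at_inf (pev x D)"
  by (induction D) (use bounded_at_inf_cm[of 0] assms in
    \<open>auto simp: pev_pCons bounded_at_inf_cm holomorphic_cm holomorphic_pev holomorphic_mult
       intro!: bounded_at_inf_add bounded_at_inf_mult\<close>)

lemma eval_uminus_cm: "z \<in> uhp \<Longrightarrow> eval_uhp (- cm c) z = - c"
  using eval_cm[of z "- c"] by (simp add: cm_minus)

lemma eval_diff_cm:
  assumes "eval_uhp u holomorphic_on uhp" "z \<in> uhp"
  shows "eval_uhp (u - cm c) z = eval_uhp u z - c"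
  using eval_add_holomorphic[OF assms(1) holomorphic_cm[of "- c"] assms(2)] assms(2)
  by (simp add: cm_minus eval_uminus_cm)

lemma holomorphic_diff_cm:
  "eval_uhp u holomorphic_on uhp \<Longrightarrow> eval_uhp (u - cm c) holomorphic_on uhp"
  using holomorphic_add[OF _ holomorphic_cm[of "- c"], of u] by (simp add: cm_minus)

lemma holomorphic_power: "eval_uhp u holomorphic_on uhp \<Longrightarrow> eval_uhp (u ^ n) holomorphic_on uhp"
  by (induction n) (use holomorphic_cm[of 1] in \<open>auto intro: holomorphic_mult\<close>)

lemma eval_power_holomorphic:
  assumes "eval_uhp u holomorphic_on uhp" "z \<in> uhp"
  shows "eval_uhp (u ^ n) z = eval_uhp u z ^ n"
  by (induction n)
     (use eval_cm[OF assms(2), of 1] in \<open>auto simp: eval_mult_holomorphic holomorphic_power assms\<close>)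

text \<open>Absence of a pole, in a form that passes through products and pullbacks; at points of
  \<open>uhp\<close> it amounts to analyticity.\<close>

definition loc_bounded :: "mero_uhp \<Rightarrow> complex \<Rightarrow> bool" where
  "loc_bounded f z \<longleftrightarrow> (\<exists>C. \<forall>\<^sub>F w in at z. norm (eval_uhp f w) \<le> C)"

lemma loc_bounded_mult:
  assumes "loc_bounded f z" "loc_bounded g z" "z \<in> uhp"
  shows "loc_bounded (f * g) z"
proof -
  obtain C where C: "\<forall>\<^sub>F w in at z. norm (eval_uhp f w) \<le> C"
    using assms(1) unfolding loc_bounded_def by blast
  obtain C' where C': "\<forall>\<^sub>F w in at z. norm (eval_uhp g w) \<le> C'"
    using assms(2) unfolding loc_bounded_def by blast
  have "\<forall>\<^sub>F w in at z. eval_uhp (f * g) w = eval_uhp f w * eval_uhp g w"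
    using eval_times_cosparse[of f g] assms(3) unfolding eventually_cosparse_open_eq[OF open_uhp] by blast
  hence "\<forall>\<^sub>F w in at z. norm (eval_uhp (f * g) w) \<le> C * C'"
    using C C'
  proof eventually_elim
    case (elim w)
    thus ?case unfolding elim(1) norm_mult
      by (intro mult_mono) (auto intro: order_trans[OF norm_ge_zero])
  qed
  thus ?thesis unfolding loc_bounded_def by blast
qed

lemma loc_bounded_analytic:
  assumes "eval_uhp f analytic_on {z}"
  shows "loc_bounded f z"
proof -
  have "eval_uhp f \<midarrow>z\<rightarrow> eval_uhp f z"
    using analytic_at_imp_isCont[OF assms] by (simp add: isCont_def)
  hence "(\<lambda>w. norm (eval_uhp f w)) \<midarrow>z\<rightarrow> norm (eval_uhp f z)" by (rule tendsto_norm)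
  hence "\<forall>\<^sub>F w in at z. norm (eval_uhp f w) < norm (eval_uhp f z) + 1"
    by (rule order_tendstoD) simp
  hence "\<forall>\<^sub>F w in at z. norm (eval_uhp f w) \<le> norm (eval_uhp f z) + 1"
    by eventually_elim simp
  thus ?thesis unfolding loc_bounded_def by blast
qed

lemma analytic_at_uhp:
  assumes "eval_uhp f holomorphic_on uhp" "z \<in> uhp"
  shows "eval_uhp f analytic_on {z}"
  using assms analytic_on_open[OF open_uhp] analytic_on_analytic_at by blast

lemma loc_bounded_imp_analytic:
  assumes "loc_bounded f z" "z \<in> uhp"
  shows "eval_uhp f analytic_on {z}"
proof (rule nicely_meromorphic_on_imp_analytic_at[OF eval_uhp_nicely_meromorphic assms(2)])
  obtain C where C: "\<forall>\<^sub>F w in at z. norm (eval_uhp f w) \<le> C"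
    using assms(1) unfolding loc_bounded_def by blast
  show "\<not> is_pole (eval_uhp f) z"
  proof
    assume "is_pole (eval_uhp f) z"
    hence "filterlim (\<lambda>w. norm (eval_uhp f w)) at_top (at z)"
      unfolding is_pole_def by (rule filterlim_at_infinity_imp_norm_at_top)
    hence "\<forall>\<^sub>F w in at z. norm (eval_uhp f w) > C"
      by (auto simp: filterlim_at_top_dense)
    with C have "\<forall>\<^sub>F w in at z. False" by eventually_elim auto
    thus False by simp
  qed
qed

lemma loc_bounded_pullback:
  assumes "loc_bounded f (moebius_map a b c d z)" "a * d - b * c > 0" "z \<in> uhp"
  shows "loc_bounded (pullback a b c d f) z"
proof -
  obtain C where C: "\<forall>\<^sub>F w in at (moebius_map a b c d z). norm (eval_uhp f w) \<le> C"
    using assms(1) unfolding loc_bounded_def by blast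
  have "\<forall>\<^sub>F w in at z. norm (eval_uhp f (moebius_map a b c d w)) \<le> C"
    by (rule eventually_compose_filterlim[OF C filterlim_moebius[OF assms(2,3)]])
  moreover have "\<forall>\<^sub>F w in at z. w \<in> uhp" by (rule eventually_at_in_open'[OF open_uhp assms(3)])
  ultimately have "\<forall>\<^sub>F w in at z. norm (eval_uhp (pullback a b c d f) w) \<le> C"
    by eventually_elim (simp add: eval_pullback[OF assms(2)])
  thus ?thesis unfolding loc_bounded_def by blast
qed

text \<open>With \<open>c\<close> the value of \<open>u\<close> at \<open>z\<close>, the function
  \<open>u - c\<close> vanishes at \<open>z\<close>, so its \<open>n\<close>-th power cancels a pole
  of order at most \<open>n\<close>.\<close>

lemma kill_pole:
  assumes u: "eval_uhp u holomorphic_on uhp" and z: "z \<in> uhp"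
  shows "\<exists>D. D \<noteq> 0 \<and> loc_bounded (pev u D * g) z"
proof -
  have "eval_uhp g meromorphic_on {z}"
    using eval_uhp_meromorphic[of g] by (rule meromorphic_on_subset) (use z in simp)
  then obtain F where F: "(\<lambda>w. eval_uhp g (z + w)) has_laurent_expansion F"
    using meromorphic_on_imp_has_laurent_expansion[of "eval_uhp g" "{z}" z] by auto
  obtain C n where C: "\<forall>\<^sub>F q in at 0. norm (eval_uhp g (z + q)) \<le> C * norm (1 / q ^ n)"
    using fls_bound[OF F] by blast
  define c where "c = eval_uhp u z"
  define C' where "C' = norm (deriv (eval_uhp u) z) + 1"
  have "(eval_uhp u has_field_derivative deriv (eval_uhp u) z) (at z)"
    using u z by (intro holomorphic_derivI[OF u open_uhp z])
  hence "(\<lambda>q. (eval_uhp u (z + q) - c) / q) \<midarrow>0\<rightarrow> deriv (eval_uhp u) z"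
    by (simp add: DERIV_def c_def)
  hence "(\<lambda>q. norm ((eval_uhp u (z + q) - c) / q)) \<midarrow>0\<rightarrow> norm (deriv (eval_uhp u) z)"
    by (rule tendsto_norm)
  hence "\<forall>\<^sub>F q in at 0. norm ((eval_uhp u (z + q) - c) / q) < norm (deriv (eval_uhp u) z) + 1"
    by (rule order_tendstoD) simp
  moreover have "\<forall>\<^sub>F q in at (0::complex). q \<noteq> 0" by (simp add: eventually_at_filter)
  ultimately have "\<forall>\<^sub>F q in at 0. norm (eval_uhp u (z + q) - c) ^ n * norm (eval_uhp g (z + q)) \<le> C' ^ n * C"
    using C
  proof eventually_elim
    case (elim q)
    have "norm (eval_uhp u (z + q) - c) \<le> C' * norm q"
      using elim(1,2) by (simp add: C'_def norm_divide field_simps less_imp_le)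
    hence "norm (eval_uhp u (z + q) - c) ^ n \<le> (C' * norm q) ^ n"
      by (intro power_mono) auto
    hence "norm (eval_uhp u (z + q) - c) ^ n * norm (eval_uhp g (z + q)) \<le>
             (C' * norm q) ^ n * (C * norm (1 / q ^ n))"
      using elim(3) by (intro mult_mono) (auto simp: C'_def)
    also have "\<dots> = C' ^ n * C"
      using elim(2) by (simp add: norm_divide norm_power power_mult_distrib)
    finally show ?case .
  qed
  hence ev: "\<forall>\<^sub>F w in at z. norm (eval_uhp u w - c) ^ n * norm (eval_uhp g w) \<le> C' ^ n * C"
    unfolding eventually_at_to_0[of _ z] by (simp only: add.commute[of _ z])
  let ?P = "(u - cm c) ^ n"
  have "\<forall>\<^sub>F w in at z. eval_uhp (?P * g) w = eval_uhp ?P w * eval_uhp g w"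
    using eval_times_cosparse[of ?P g] z unfolding eventually_cosparse_open_eq[OF open_uhp] by blast
  moreover have "\<forall>\<^sub>F w in at z. w \<in> uhp" by (rule eventually_at_in_open'[OF open_uhp z])
  ultimately have "\<forall>\<^sub>F w in at z. norm (eval_uhp (?P * g) w) \<le> C' ^ n * C"
    using ev by eventually_elim
      (simp add: eval_power_holomorphic holomorphic_diff_cm u eval_diff_cm norm_mult norm_power)
  hence "loc_bounded (pev u ([:- c, 1:] ^ n) * g) z"
    unfolding loc_bounded_def pev_power pev_linear by blast
  thus ?thesis by (intro exI[of _ "[:- c, 1:] ^ n"]) auto
qed

text \<open>Holomorphy above some height is included so that products can be evaluated pointwise
  there.\<close>

definition hol_bounded_inf :: "mero_uhp \<Rightarrow> bool" where
  "hol_bounded_inf f \<longleftrightarrow> (\<exists>B C. B > 0 \<and> eval_uhp f holomorphic_on {z. Im z > B} \<and> (\<forall>z. Im z > B \<longrightarrow> norm (eval_uhp f z) \<le> C))"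

lemma eval_mult_at:
  assumes "eval_uhp f analytic_on {z}" "eval_uhp g analytic_on {z}" "z \<in> uhp"
  shows "eval_uhp (f * g) z = eval_uhp f z * eval_uhp g z"
proof -
  have "(\<lambda>z. eval_uhp f z * eval_uhp g z) meromorphic_on uhp"
    by (intro meromorphic_intros eval_uhp_meromorphic)
  hence "eval_uhp (f * g) z = remove_sings (\<lambda>z. eval_uhp f z * eval_uhp g z) z"
    using assms(3) by (simp add: times_mero_uhp_def eval_mero_of)
  also have "\<dots> = eval_uhp f z * eval_uhp g z"
    by (rule remove_sings_at_analytic) (intro analytic_intros assms)
  finally show ?thesis .
qed

lemma holomorphic_mult_inf:
  assumes "eval_uhp f holomorphic_on {z. Im z > B}" "eval_uhp g holomorphic_on {z. Im z > B}" "B > 0"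
  shows "eval_uhp (f * g) holomorphic_on {z. Im z > B}"
    and "Im z > B \<Longrightarrow> eval_uhp (f * g) z = eval_uhp f z * eval_uhp g z"
proof -
  have an: "eval_uhp f analytic_on {z}" "eval_uhp g analytic_on {z}" if "Im z > B" for z
    using assms(1,2) that analytic_on_open[OF open_halfspace_Im_gt[of B]] analytic_on_analytic_at
    by blast+
  have ev: "eval_uhp (f * g) z = eval_uhp f z * eval_uhp g z" if "Im z > B" for z
    by (rule eval_mult_at[OF an[OF that]]) (use that assms(3) in \<open>auto simp: uhp_def\<close>)
  have "(\<lambda>z. eval_uhp f z * eval_uhp g z) holomorphic_on {z. Im z > B}"
    by (intro holomorphic_intros assms)
  thus "eval_uhp (f * g) holomorphic_on {z. Im z > B}"
    by (rule holomorphic_transform) (use ev in auto)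
  show "Im z > B \<Longrightarrow> eval_uhp (f * g) z = eval_uhp f z * eval_uhp g z" by (rule ev)
qed

lemma hol_bounded_inf_mult:
  assumes "hol_bounded_inf f" "hol_bounded_inf g"
  shows "hol_bounded_inf (f * g)"
proof -
  obtain B C where f: "B > 0" "eval_uhp f holomorphic_on {z. Im z > B}" "\<And>z. Im z > B \<Longrightarrow> norm (eval_uhp f z) \<le> C"
    using assms(1) unfolding hol_bounded_inf_def by blast
  obtain B' C' where g: "B' > 0" "eval_uhp g holomorphic_on {z. Im z > B'}" "\<And>z. Im z > B' \<Longrightarrow> norm (eval_uhp g z) \<le> C'"
    using assms(2) unfolding hol_bounded_inf_def by blast
  define M where "M = max B B'"
  have hol: "eval_uhp f holomorphic_on {z. Im z > M}" "eval_uhp g holomorphic_on {z. Im z > M}"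
    by (rule holomorphic_on_subset[OF f(2)] holomorphic_on_subset[OF g(2)]; auto simp: M_def)+
  have M: "M > 0" using f(1) by (simp add: M_def)
  have "norm (eval_uhp (f * g) z) \<le> C * C'" if "Im z > M" for z
  proof -
    have "norm (eval_uhp f z) \<le> C" "norm (eval_uhp g z) \<le> C'" using f(3) g(3) that by (auto simp: M_def)
    thus ?thesis unfolding holomorphic_mult_inf(2)[OF hol M that] norm_mult
      by (intro mult_mono) (auto intro: order_trans[OF norm_ge_zero])
  qed
  thus ?thesis unfolding hol_bounded_inf_def using holomorphic_mult_inf(1)[OF hol M] M by blast
qed

lemma hol_bounded_inf_bounded:
  assumes "eval_uhp f holomorphic_on uhp" "bounded_at_inf f"
  shows "hol_bounded_inf f"
proof -
  obtain B C where BC: "\<And>z. Im z \<ge> B \<Longrightarrow> norm (eval_uhp f z) \<le> C"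
    using assms(2) unfolding bounded_at_inf_def by blast
  have "eval_uhp f holomorphic_on {z. Im z > max 1 B}"
    by (rule holomorphic_on_subset[OF assms(1)]) (auto simp: uhp_def)
  thus ?thesis unfolding hol_bounded_inf_def using BC
    by (intro exI[of _ "max 1 B"] exI[of _ C]) auto
qed

lemma hol_bounded_inf_imp_bounded: "hol_bounded_inf f \<Longrightarrow> bounded_at_inf f"
proof -
  assume "hol_bounded_inf f"
  then obtain B C where BC: "\<And>z. Im z > B \<Longrightarrow> norm (eval_uhp f z) \<le> C"
    unfolding hol_bounded_inf_def by blast
  have "norm (eval_uhp f z) \<le> C" if "Im z \<ge> B + 1" for z using BC[of z] that by auto
  thus ?thesis unfolding bounded_at_inf_def by blast
qed

text \<open>The analogue of \<open>kill_pole\<close> at a cusp: with \<open>c\<close> the value of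
  the lift of \<open>u\<close> at \<open>q = 0\<close>, the function \<open>u - c\<close> is
  \<open>O(q)\<close>, and a power of it outweighs exponential growth.\<close>

lemma kill_cusp:
  assumes u: "eval_uhp u holomorphic_on uhp" "bounded_at_inf u"
    and per: "\<And>z. z \<in> uhp \<Longrightarrow> eval_uhp u (z + of_nat h) = eval_uhp u z" and h: "h > 0"
    and g: "mod_growth g"
  shows "\<exists>D. D \<noteq> 0 \<and> hol_bounded_inf (pev u D * g)"
proof -
  obtain B0 C0 where B0: "\<And>z. Im z \<ge> B0 \<Longrightarrow> norm (eval_uhp u z) \<le> C0"
    using u(2) unfolding bounded_at_inf_def by blast
  have "\<exists>G. G holomorphic_on ball 0 (exp (- 2 * pi * 0 / real h)) \<and>
           (\<forall>z. Im z > 0 \<longrightarrow> eval_uhp u z = G (ee (z / of_nat h)))"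
    by (rule periodic_lift[OF _ _ B0 h]) (use u(1) per in \<open>auto simp: uhp_def\<close>)
  then obtain G where G: "G holomorphic_on ball 0 1" "\<And>z. Im z > 0 \<Longrightarrow> eval_uhp u z = G (ee (z / of_nat h))"
    by auto
  define c where "c = G 0"
  have "(G has_field_derivative deriv G 0) (at 0)"
    by (rule holomorphic_derivI[OF G(1)]) auto
  hence "(\<lambda>q. (G q - c) / q) \<midarrow>0\<rightarrow> deriv G 0"
    by (simp add: DERIV_def c_def)
  hence "(\<lambda>q. norm ((G q - c) / q)) \<midarrow>0\<rightarrow> norm (deriv G 0)"
    by (rule tendsto_norm)
  hence "\<forall>\<^sub>F q in at 0. norm ((G q - c) / q) < norm (deriv G 0) + 1"
    by (rule order_tendstoD) simp
  from eventually_at_0_imp_Im[OF this h] obtain B1 where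
    B1: "B1 > 0" "\<And>z. Im z \<ge> B1 \<Longrightarrow> norm ((G (ee (z / of_nat h)) - c) / ee (z / of_nat h)) < norm (deriv G 0) + 1"
    by blast
  define C1 where "C1 = norm (deriv G 0) + 1"
  have u1: "norm (eval_uhp u z - c) \<le> C1 * exp (- 2 * pi * Im z / real h)" if "Im z \<ge> B1" for z
  proof -
    have "norm (eval_uhp u z - c) / norm (ee (z / of_nat h)) < C1"
      using B1(2)[OF that] G(2)[of z] B1(1) that by (simp add: C1_def norm_divide)
    thus ?thesis unfolding norm_ee_div[OF h] by (simp add: pos_divide_less_eq less_imp_le)
  qed
  obtain A B C where g: "B > 0" "eval_uhp g holomorphic_on {z. Im z > B}"
     "\<And>z. Im z > B \<Longrightarrow> norm (eval_uhp g z) \<le> C * exp (A * Im z)"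
    using g unfolding mod_growth_def by blast
  obtain n :: nat where n: "real n \<ge> A * h / (2 * pi)"
    using real_arch_simple by blast
  have An: "A \<le> 2 * pi * n / h"
    using n h by (simp add: field_simps)
  have C: "C \<ge> 0"
  proof -
    have "0 \<le> norm (eval_uhp g (\<i> * of_real (B + 1)))" by simp
    also have "\<dots> \<le> C * exp (A * Im (\<i> * of_real (B + 1)))" by (rule g(3)) simp
    finally show ?thesis by (simp add: zero_le_mult_iff)
  qed
  define M where "M = max B B1"
  have M: "M > 0" using g(1) by (simp add: M_def)
  let ?P = "(u - cm c) ^ n"
  have hol: "eval_uhp ?P holomorphic_on {z. Im z > M}" "eval_uhp g holomorphic_on {z. Im z > M}"
    by (rule holomorphic_on_subset[OF holomorphic_power[OF holomorphic_diff_cm[OF u(1)]]]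
          holomorphic_on_subset[OF g(2)]; use M in \<open>auto simp: M_def uhp_def\<close>)+
  have "norm (eval_uhp (?P * g) z) \<le> C1 ^ n * C" if z: "Im z > M" for z
  proof -
    have zu: "z \<in> uhp" using z M by (simp add: uhp_def)
    have "norm (eval_uhp (?P * g) z) = norm (eval_uhp u z - c) ^ n * norm (eval_uhp g z)"
      using holomorphic_mult_inf(2)[OF hol M z] zu u(1)
      by (simp add: eval_power_holomorphic holomorphic_diff_cm eval_diff_cm norm_mult norm_power)
    also have "\<dots> \<le> (C1 * exp (- 2 * pi * Im z / real h)) ^ n * (C * exp (A * Im z))"
      using u1[of z] g(3)[of z] z by (intro mult_mono power_mono) (auto simp: M_def C1_def)
    also have "\<dots> = (C1 ^ n * C) * exp ((A - 2 * pi * n / h) * Im z)"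
    proof -
      have "exp (- 2 * pi * Im z / real h) ^ n = exp (real n * (- 2 * pi * Im z / real h))"
        by (simp only: exp_of_nat_mult)
      moreover have "real n * (- 2 * pi * Im z / real h) + A * Im z = (A - 2 * pi * n / h) * Im z"
        by (simp add: algebra_simps)
      ultimately have "exp (- 2 * pi * Im z / real h) ^ n * exp (A * Im z) = exp ((A - 2 * pi * n / h) * Im z)"
        by (simp only: flip: exp_add)
      thus ?thesis by (simp only: power_mult_distrib mult_ac)
    qed
    also have "\<dots> \<le> (C1 ^ n * C) * 1"
      using C An zu by (intro mult_left_mono) (auto simp: mult_nonpos_nonneg uhp_def C1_def)
    finally show ?thesis by simp
  qed
  hence "hol_bounded_inf (pev u ([:- c, 1:] ^ n) * g)"
    unfolding pev_power pev_linear hol_bounded_inf_def using holomorphic_mult_inf(1)[OF hol M] M by blast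
  thus ?thesis by (intro exI[of _ "[:- c, 1:] ^ n"]) auto
qed

text \<open>The product of the individual polynomials works, since each condition survives
  multiplication.\<close>

lemma common_poly:
  fixes P :: "'i \<Rightarrow> complex poly \<Rightarrow> bool"
  assumes "finite I" "\<And>i. i \<in> I \<Longrightarrow> \<exists>D. D \<noteq> 0 \<and> P i D"
    and "\<And>i D E. i \<in> I \<Longrightarrow> P i D \<Longrightarrow> P i (D * E)"
  shows "\<exists>D. D \<noteq> 0 \<and> (\<forall>i\<in>I. P i D)"
  using assms
proof (induction I rule: finite_induct)
  case empty
  show ?case by (intro exI[of _ 1]) auto
next
  case (insert i I)
  have "\<exists>D. D \<noteq> 0 \<and> (\<forall>i\<in>I. P i D)"
    by (rule insert.IH) (simp_all add: insert.prems)
  then obtain D where D: "D \<noteq> 0" "\<forall>i\<in>I. P i D" by blast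
  obtain E where E: "E \<noteq> 0" "P i E" using insert.prems(1) by blast
  have "P k (D * E)" if k: "k \<in> insert i I" for k
  proof (cases "k = i")
    case True
    have "P i (E * D)" by (rule insert.prems(2)) (use E in auto)
    thus ?thesis by (simp add: True mult.commute)
  next
    case False
    show ?thesis by (rule insert.prems(2)) (use D k False in auto)
  qed
  thus ?case using D(1) E(1) by (intro exI[of _ "D * E"]) auto
qed

text \<open>One polynomial has to serve for all pullbacks at once. Only finitely many pairs of
  pullbacks occur, each with finitely many poles in the compact box \<open>K\<close> and none above
  it. Cusps are treated where the pullback of \<open>pf\<close> is bounded, which covers all those
  with \<open>c\<close> not divisible by 9.\<close>

lemma kill_all_poles:
  assumes f: "f \<in> X0_functions_complex 45" "w5 f = f"
  shows "\<exists>D. D \<noteq> 0 \<and> reg (pev pf D * f)"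
proof -
  \<comment> \<open>Pairs, because the polynomial is evaluated at the pullback of \<open>pf\<close>
    by the same matrix.\<close>
  define T where "T = {(pullback a b c d f, pullback a b c d pf) | a b c d. a * d - b * c = 1}"
  have inv: "gamma0_invariant 45 f" "gamma0_invariant 45 pf"
    using X0c_invariant f(1) pf_X0c by auto
  have mg: "mod_growth (pullback a b c d f)" if "a * d - b * c = 1" for a b c d
    using f(1) that X0_functions_complex_iff[of 45 f] by auto
  have "T \<subseteq> {pullback a b c d f | a b c d. a * d - b * c = 1} \<times> {pullback a b c d pf | a b c d. a * d - b * c = 1}"
    unfolding T_def by blast
  hence finT: "finite T"
    by (rule finite_subset) (intro finite_cartesian_product finite_pullbacks[OF inv(1)] finite_pullbacks[OF inv(2)]; simp)
  have holu: "eval_uhp (snd x) holomorphic_on uhp" if "x \<in> T" for x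
    using that holomorphic_pullback[OF pf_holomorphic] unfolding T_def by force
  have mgT: "mod_growth (fst x)" if "x \<in> T" for x
    using that mg unfolding T_def by force
  have perT: "eval_uhp (snd x) (z + of_nat 45) = eval_uhp (snd x) z" if "x \<in> T" "z \<in> uhp" for x z
    using that pullback_periodic[OF inv(2)] unfolding T_def by force
  have "\<exists>B. \<forall>z. Im z > B \<and> z \<in> uhp \<longrightarrow> eval_uhp (fst x) analytic_on {z}" if xT: "x \<in> T" for x
  proof -
    obtain B where "eval_uhp (fst x) holomorphic_on {z. Im z > B}"
      using mgT[OF xT] unfolding mod_growth_def by blast
    hence "eval_uhp (fst x) analytic_on {z. Im z > B}"
      by (subst analytic_on_open) (auto simp: open_halfspace_Im_gt)
    hence "eval_uhp (fst x) analytic_on {z}" if "Im z > B" for z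
      by (rule analytic_on_subset) (use that in auto)
    thus ?thesis by blast
  qed
  hence "\<forall>x\<in>T. \<exists>B. \<forall>z. Im z > B \<and> z \<in> uhp \<longrightarrow> eval_uhp (fst x) analytic_on {z}" by simp
  from bchoice[OF this] obtain Bf where
    "\<forall>x\<in>T. \<forall>z. Im z > Bf x \<and> z \<in> uhp \<longrightarrow> eval_uhp (fst x) analytic_on {z}" ..
  hence Bf: "eval_uhp (fst x) analytic_on {z}" if "x \<in> T" "Im z > Bf x" "z \<in> uhp" for x z
    using that by simp
  define B where "B = Max (insert 1 (Bf ` T))"
  have B: "Bf x \<le> B" if "x \<in> T" for x
    unfolding B_def using finT that by (intro Max_ge) auto
  \<comment> \<open>\<open>SL\<^sub>2(\<int>)\<close> moves every point of the upper half plane into \<open>K\<close> or above it.\<close>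
  define K where "K = cbox (Complex (- 1 / 2) (1 / 2)) (Complex (1 / 2) B)"
  have Ku: "K \<subseteq> uhp" by (auto simp: K_def uhp_def in_cbox_complex_iff)
  have "\<exists>D. D \<noteq> 0 \<and> (\<forall>z\<in>K. loc_bounded (pev (snd x) D * fst x) z) \<and> (bounded_at_inf (snd x) \<longrightarrow> hol_bounded_inf (pev (snd x) D * fst x))"
    if x: "x \<in> T" for x
  proof -
    define I where "I = K \<inter> {z. \<not> eval_uhp (fst x) analytic_on {z}}"
    have "{z. \<not> eval_uhp (fst x) analytic_on {z}} sparse_in K"
      using meromorphic_on_imp_sparse_singularities[OF eval_uhp_meromorphic[of "fst x"]] Ku
      by (rule sparse_in_subset)
    hence finI: "finite I"
      unfolding I_def by (rule sparse_in_compact_finite) (simp add: K_def compact_cbox)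
    have step: "loc_bounded (pev (snd x) (D * E) * g) z" if "loc_bounded (pev (snd x) D * g) z" "z \<in> uhp" for D E g z
    proof -
      have "loc_bounded (pev (snd x) E) z"
        using that(2) by (intro loc_bounded_analytic analytic_at_uhp holomorphic_pev holu x)
      from loc_bounded_mult[OF this that] show ?thesis by (simp add: pev_mult mult_ac)
    qed
    have "\<exists>D. D \<noteq> 0 \<and> (\<forall>z\<in>I. loc_bounded (pev (snd x) D * fst x) z)"
      by (rule common_poly[OF finI]) (use kill_pole[OF holu[OF x]] step Ku in \<open>auto simp: I_def\<close>)
    then obtain D where D: "D \<noteq> 0" "\<And>z. z \<in> I \<Longrightarrow> loc_bounded (pev (snd x) D * fst x) z" by blast
    have DK: "loc_bounded (pev (snd x) D * fst x) z" if "z \<in> K" for z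
    proof (cases "z \<in> I")
      case False
      hence "loc_bounded (fst x) z" using that by (intro loc_bounded_analytic) (auto simp: I_def)
      moreover have "loc_bounded (pev (snd x) D) z"
        using that Ku by (intro loc_bounded_analytic analytic_at_uhp holomorphic_pev holu x) auto
      ultimately show ?thesis using that Ku by (intro loc_bounded_mult) auto
    qed (use D in auto)
    show ?thesis
    proof (cases "bounded_at_inf (snd x)")
      case True
      obtain E where E: "E \<noteq> 0" "hol_bounded_inf (pev (snd x) E * fst x)"
        using kill_cusp[OF holu[OF x] True perT[OF x] _ mgT[OF x]] by auto
      have "hol_bounded_inf (pev (snd x) D * (pev (snd x) E * fst x))"
        using holu[OF x] True by (intro hol_bounded_inf_mult hol_bounded_inf_bounded holomorphic_pev bounded_at_inf_pev E)
      hence "hol_bounded_inf (pev (snd x) (D * E) * fst x)" by (simp add: pev_mult mult_ac)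
      moreover have "loc_bounded (pev (snd x) (D * E) * fst x) z" if "z \<in> K" for z
        using step[OF DK[OF that]] that Ku by blast
      ultimately show ?thesis using D(1) E(1) by (intro exI[of _ "D * E"]) auto
    next
      case False
      thus ?thesis using D(1) DK by blast
    qed
  qed
  moreover have "(\<forall>z\<in>K. loc_bounded (pev (snd x) (D * E) * fst x) z) \<and> (bounded_at_inf (snd x) \<longrightarrow> hol_bounded_inf (pev (snd x) (D * E) * fst x))"
    if "x \<in> T" "(\<forall>z\<in>K. loc_bounded (pev (snd x) D * fst x) z) \<and> (bounded_at_inf (snd x) \<longrightarrow> hol_bounded_inf (pev (snd x) D * fst x))" for x D E
  proof -
    have eq: "pev (snd x) (D * E) * fst x = pev (snd x) E * (pev (snd x) D * fst x)"
      by (simp add: pev_mult mult_ac)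
    have "loc_bounded (pev (snd x) E) z" if "z \<in> K" for z
      using that Ku \<open>x \<in> T\<close> by (intro loc_bounded_analytic analytic_at_uhp holomorphic_pev holu) auto
    moreover have "hol_bounded_inf (pev (snd x) E)" if "bounded_at_inf (snd x)"
      using that \<open>x \<in> T\<close> by (intro hol_bounded_inf_bounded holomorphic_pev bounded_at_inf_pev holu)
    ultimately show ?thesis
      unfolding eq using that(2) Ku loc_bounded_mult hol_bounded_inf_mult by (meson subsetD)
  qed
  ultimately obtain D where D: "D \<noteq> 0"
    "\<And>x z. x \<in> T \<Longrightarrow> z \<in> K \<Longrightarrow> loc_bounded (pev (snd x) D * fst x) z"
    "\<And>x. x \<in> T \<Longrightarrow> bounded_at_inf (snd x) \<Longrightarrow> hol_bounded_inf (pev (snd x) D * fst x)"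
    using common_poly[OF finT, of "\<lambda>x D. (\<forall>z\<in>K. loc_bounded (pev (snd x) D * fst x) z) \<and>
       (bounded_at_inf (snd x) \<longrightarrow> hol_bounded_inf (pev (snd x) D * fst x))"] by blast
  define h where "h = pev pf D * f"
  have pb: "pullback a b c d h = pev (pullback a b c d pf) D * pullback a b c d f" if "a * d - b * c = 1" for a b c d
    using that by (simp add: h_def pullback_mult pullback_pev)
  have loc_bounded_h: "loc_bounded h z" if z: "z \<in> uhp" for z
  proof -
    obtain a b c d w where w: "a * d - b * c = 1" "z = moebius_map a b c d w" "Im w \<ge> 1 / 2" "\<bar>Re w\<bar> \<le> 1 / 2"
      using fundamental_domain[OF z] by blast
    have wu: "w \<in> uhp" using w(3) by (simp add: uhp_def)
    define x where "x = (pullback a b c d f, pullback a b c d pf)"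
    have xT: "x \<in> T" unfolding T_def x_def using w(1) by blast
    have "loc_bounded (pev (snd x) D * fst x) w"
    proof (cases "Im w \<le> B")
      case True
      hence "w \<in> K" using w(3,4) by (auto simp: K_def in_cbox_complex_iff)
      thus ?thesis using D(2) xT by blast
    next
      case False
      hence "eval_uhp (fst x) analytic_on {w}" using Bf[OF xT _ wu] B[OF xT] by simp
      hence "loc_bounded (fst x) w" by (rule loc_bounded_analytic)
      moreover have "loc_bounded (pev (snd x) D) w"
        by (intro loc_bounded_analytic analytic_at_uhp holomorphic_pev holu xT wu)
      ultimately show ?thesis using wu by (intro loc_bounded_mult)
    qed
    hence lw: "loc_bounded (pullback a b c d h) w" using pb[OF w(1)] by (simp add: x_def)
    have det': "d * a - (- b) * (- c) = 1" using w(1) by (simp add: algebra_simps)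
    have mw: "moebius_map d (- b) (- c) a z = w"
      unfolding w(2) by (rule moebius_inverse) (use w(1) wu in auto)
    have "loc_bounded (pullback d (- b) (- c) a (pullback a b c d h)) z"
    proof (rule loc_bounded_pullback)
      show "loc_bounded (pullback a b c d h) (moebius_map d (- b) (- c) a z)" unfolding mw by (rule lw)
    qed (use det' z in auto)
    also have "pullback d (- b) (- c) a (pullback a b c d h) =
        pullback (a * d + b * (- c)) (a * (- b) + b * a) (c * d + d * (- c)) (c * (- b) + d * a) h"
      by (rule pullback_pullback) (use w(1) det' in auto)
    also have "\<dots> = pullback 1 0 0 1 h" using w(1) by (simp add: algebra_simps)
    also have "\<dots> = h" unfolding pullback_def moebius_map_def by (simp add: mero_of_eval)
    finally show ?thesis .
  qed
  have hX: "h \<in> X0_functions_complex 45"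
    unfolding h_def by (intro X0c_mult X0c_pev pf_X0c f) auto
  have "w5 h = h" unfolding h_def by (simp add: w5_mult w5_pev w5_pf f(2))
  moreover have "eval_uhp h analytic_on uhp"
    using loc_bounded_imp_analytic[OF loc_bounded_h] analytic_on_analytic_at by blast
  hence "eval_uhp h holomorphic_on uhp" by (rule analytic_imp_holomorphic)
  moreover have "bounded_at_inf (pullback a b c d h)" if "a * d - b * c = 1" "\<not> 9 dvd c" for a b c d
  proof -
    have "(pullback a b c d f, pullback a b c d pf) \<in> T" unfolding T_def using that(1) by blast
    moreover have "bounded_at_inf (pullback a b c d pf)" using reg_pf that unfolding reg_def by blast
    ultimately have "hol_bounded_inf (pullback a b c d h)" using D(3) pb[OF that(1)] by force
    thus ?thesis by (rule hol_bounded_inf_imp_bounded)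
  qed
  ultimately have "reg h" unfolding reg_def using hX by blast
  thus ?thesis using D(1) unfolding h_def by blast
qed

section \<open>\<open>q\<close>-expansions of the eta quotients\<close>

text \<open>Euler's product of \<open>1 - q ^ (n * k)\<close> over \<open>k \<ge> 1\<close>, that
  is, \<open>\<eta>(n z)\<close> without its fractional power of \<open>q\<close>.\<close>

definition eul :: "nat \<Rightarrow> complex \<Rightarrow> complex" where
  "eul n q = qprod (q ^ n) (q ^ n)"

text \<open>Both Klein forms are multiplied by \<open>qprod (q ^ 3) (q ^ 3)\<close>. The numerator
  then contains all residues of exponents modulo 3 (\<open>qprod_trisect\<close>), the denominator
  all three cube roots of unity (\<open>qprod_cube\<close>), and both become Euler products.\<close>

lemma kap_product:
  assumes z: "z \<in> uhp"
  shows "kap (3 * z) = ee (- z / 3) * eul 1 (ee z) / eul 9 (ee z)"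
proof -
  define q where "q = ee z"
  define w where "w = ee (1 / 3)"
  have q: "norm q < 1" "q \<noteq> 0" using norm_ee_less_1[OF z] by (simp_all add: q_def)
  have q3: "norm (q ^ 3) < 1" using q by (simp add: norm_power power_less_one_iff)
  have ee3: "ee (3 * z) = q ^ 3" using ee_of_nat_mult[of 3 z] by (simp add: q_def)
  have cs: "cos (2 * pi / 3) = - 1 / 2" "sin (2 * pi / 3) = sqrt 3 / 2"
    by (simp_all add: cos_120 sin_120)
  have w: "w = Complex (- 1 / 2) (sqrt 3 / 2)"
  proof -
    have "w = cis (2 * pi / 3)" by (simp add: w_def ee_def cis_conv_exp mult_ac)
    thus ?thesis by (simp add: complex_eq_iff cs)
  qed
  have w2: "w ^ 2 + w + 1 = 0"
    by (simp add: w complex_eq_iff power2_eq_square)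
  have w0: "w \<noteq> 0" by (simp add: w_def)
  have w3: "1 / w = w ^ 2"
  proof -
    have "w ^ 2 * w = 1 + (w - 1) * (w ^ 2 + w + 1)" by (simp add: algebra_simps power2_eq_square)
    hence "w ^ 2 * w = 1" using w2 by simp
    thus ?thesis using w0 by (metis nonzero_mult_div_cancel_right)
  qed
  have w6: "ee (- 1 / 6) = - w"
  proof -
    have "ee (- 1 / 6) = ee (1 / 3 - 1 / 2)" by simp
    thus ?thesis by (simp only: ee_diff ee_half w_def) simp
  qed
  have kk10: "kk 1 0 (3 * z) * qprod (q ^ 3) (q ^ 3) = ee (- z / 3) * eul 1 q"
  proof -
    have "ee (1 / 3 * (1 / 3 * (3 * z) + 0 / 3) / 2) * ee (- z / 2) = ee (- z / 3)"
      by (simp flip: ee_add)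
    hence "kk 1 0 (3 * z) = ee (- z / 3) * th0 q (q ^ 3)"
      by (simp add: kk_def klein_def Theta_def ee3 flip: q_def mult.assoc)
    moreover have "q ^ 3 / q = q * q" using q(2) by (simp add: power3_eq_cube)
    ultimately have "kk 1 0 (3 * z) * qprod (q ^ 3) (q ^ 3) =
        ee (- z / 3) * (qprod q (q ^ 3) * qprod (q * q) (q ^ 3) * qprod (q * q ^ 2) (q ^ 3))"
      by (simp add: th0_def power3_eq_cube power2_eq_square mult_ac)
    thus ?thesis unfolding qprod_trisect[OF q(1)] by (simp add: eul_def)
  qed
  have kk01: "kk 0 1 (3 * z) * qprod (q ^ 3) (q ^ 3) = - w * (1 - w) * eul 9 q"
  proof -
    have "q ^ 3 / w = w ^ 2 * q ^ 3" using w3 by (metis divide_inverse inverse_eq_divide mult.commute)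
    hence "kk 0 1 (3 * z) = - w * (qprod w (q ^ 3) * qprod (w ^ 2 * q ^ 3) (q ^ 3))"
      using w6 by (simp add: kk_def klein_def Theta_def ee3 th0_def flip: w_def)
    hence "kk 0 1 (3 * z) * qprod (q ^ 3) (q ^ 3) = - w * (1 - w) *
        (qprod (q ^ 3) (q ^ 3) * qprod (w * q ^ 3) (q ^ 3) * qprod (w ^ 2 * q ^ 3) (q ^ 3))"
      by (simp add: qprod_rec[OF q3, of w] mult_ac)
    thus ?thesis unfolding qprod_cube[OF q3 w2] by (simp add: eul_def flip: power_mult)
  qed
  have nz: "qprod (q ^ 3) (q ^ 3) \<noteq> 0"
  proof -
    have "q ^ 3 * (q ^ 3) ^ n \<noteq> 1" for n
    proof -
      have "norm (q ^ 3 * (q ^ 3) ^ n) \<le> norm (q ^ 3) * 1"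
        unfolding norm_mult norm_power[of "q ^ 3" n] using q3 by (intro mult_left_mono power_le_one) auto
      thus ?thesis using q3 by auto
    qed
    thus ?thesis by (simp add: qprod_eq_0_iff[OF q3])
  qed
  \<comment> \<open>Origin of the constant in \<open>kap\<close>: it cancels this factor of the
    denominator and makes the leading coefficient of the expansion 1.\<close>
  have c: "- \<i> * of_real (sqrt 3) = - w * (1 - w)"
    by (simp add: w complex_eq_iff)
  have c0: "- w * (1 - w) \<noteq> 0"
    unfolding c[symmetric] by simp
  have "kap (3 * z) = - \<i> * of_real (sqrt 3) * (kk 1 0 (3 * z) * qprod (q ^ 3) (q ^ 3)) / (kk 0 1 (3 * z) * qprod (q ^ 3) (q ^ 3))"
    using nz by (simp add: kap_def)
  also have "\<dots> = ee (- z / 3) * eul 1 q / eul 9 q"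
    unfolding kk10 kk01 c using c0 by simp
  finally show ?thesis by (simp add: q_def)
qed

lemma eul_power: "eul n (q ^ m) = eul (m * n) q"
  by (simp add: eul_def power_mult)

lemma k1_product: "z \<in> uhp \<Longrightarrow> k1 z = ee (- z / 3) * eul 1 (ee z) / eul 9 (ee z)"
  unfolding k1_def by (rule kap_product)

lemma k2_product:
  assumes "z \<in> uhp"
  shows "k2 z = ee (- (5 * z) / 3) * eul 5 (ee z) / eul 45 (ee z)"
proof -
  have "5 * z \<in> uhp" using assms by (simp add: uhp_def)
  moreover have "ee (5 * z) = ee z ^ 5" using ee_of_nat_mult[of 5 z] by simp
  ultimately show ?thesis
    using kap_product[of "5 * z"] by (simp add: k2_def eul_power)
qed

text \<open>Otherwise let \<open>d < m\<close> be the order of \<open>F\<close>. Then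
  \<open>f q / q ^ d\<close> tends to a nonzero coefficient, while the bound forces the limit
  0.\<close>

lemma fps_expansion_O_power:
  fixes f :: "complex \<Rightarrow> complex"
  assumes F: "f has_fps_expansion F" and C: "\<forall>\<^sub>F q in at 0. norm (f q) \<le> C * norm q ^ m" and k: "k < m"
  shows "fps_nth F k = 0"
proof (rule ccontr)
  assume nz: "fps_nth F k \<noteq> 0"
  define d where "d = subdegree F"
  have F0: "F \<noteq> 0" using nz by auto
  have dm: "d < m" using nz k subdegree_leI[of F k] by (simp add: d_def)
  have "(\<lambda>q. f q * q powi - int d) has_laurent_expansion fls_shift (int d) (fps_to_fls F)"
    by (rule has_laurent_expansion_shift'[OF has_laurent_expansion_fps[OF F]])
  moreover have "fls_subdegree (fls_shift (int d) (fps_to_fls F)) \<ge> 0"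
    using F0 by (simp add: fls_subdegree_fls_to_fps d_def)
  ultimately have lim: "(\<lambda>q. f q * q powi - int d) \<midarrow>0\<rightarrow> fls_nth (fls_shift (int d) (fps_to_fls F)) 0"
    by (rule has_laurent_expansion_imp_tendsto_0)
  have "(\<lambda>q::complex. C * norm q ^ (m - d)) \<midarrow>0\<rightarrow> C * norm (0::complex) ^ (m - d)"
    by (intro tendsto_intros)
  hence lim0: "(\<lambda>q::complex. C * norm q ^ (m - d)) \<midarrow>0\<rightarrow> 0"
    using dm by (simp add: power_0_left)
  have "\<forall>\<^sub>F q in at (0::complex). q \<noteq> 0" by (simp add: eventually_at_filter)
  with C have "\<forall>\<^sub>F q in at 0. norm (f q * q powi - int d) \<le> C * norm q ^ (m - d)"
  proof eventually_elim
    case (elim q)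
    have "norm (f q * q powi - int d) = norm (f q) / norm q ^ d"
      by (simp add: power_int_minus norm_mult norm_inverse norm_power divide_inverse)
    also have "\<dots> \<le> C * norm q ^ m / norm q ^ d"
      using elim by (intro divide_right_mono) auto
    also have "\<dots> = C * norm q ^ (m - d)"
      using elim dm by (simp add: power_diff)
    finally show ?case .
  qed
  hence "(\<lambda>q. f q * q powi - int d) \<midarrow>0\<rightarrow> 0"
    using lim0 by (rule Lim_null_comparison)
  hence "fls_nth (fls_shift (int d) (fps_to_fls F)) 0 = 0"
    using lim LIM_unique by blast
  thus False using F0 by (simp add: d_def)
qed

text \<open>By \<open>norm_qprod_minus_1_le\<close> a product that starts with
  \<open>1 - q ^ m\<close> differs from 1 by \<open>O(q ^ m)\<close>, so cutting it off leaves the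
  lower coefficients unchanged.\<close>

lemma eul_tail:
  assumes "n > 0" "m > 0"
  shows "\<exists>T. (\<lambda>q. qprod (q ^ m) (q ^ n)) has_fps_expansion T \<and> (\<forall>k<m. fps_nth T k = (if k = 0 then 1 else 0))"
proof -
  have "(\<lambda>q. qprod (q ^ m) (q ^ n)) holomorphic_on ball 0 1"
    using assms by (intro holomorphic_intros) (auto simp: norm_power power_less_one_iff)
  hence "(\<lambda>q. qprod (q ^ m) (q ^ n)) analytic_on {0}"
    by (auto simp: analytic_at intro!: exI[of _ "ball 0 1"])
  then obtain T where T: "(\<lambda>q. qprod (q ^ m) (q ^ n)) has_fps_expansion T"
    using analytic_at_imp_has_fps_expansion_0 by blast
  have "(\<lambda>q. qprod (q ^ m) (q ^ n) - 1) has_fps_expansion T - 1"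
    by (intro fps_expansion_intros T)
  moreover have "\<forall>\<^sub>F q in at 0. norm (qprod (q ^ m) (q ^ n) - 1) \<le> 4 * norm q ^ m"
  proof -
    have "\<forall>\<^sub>F q in at (0::complex). q \<in> ball 0 (1 / 2)"
      by (rule eventually_at_in_open') auto
    thus ?thesis
    proof eventually_elim
      case (elim q)
      have q: "norm q \<le> 1 / 2" using elim by simp
      have n: "norm (q ^ n) \<le> 1 / 2"
        using q assms(1) power_decreasing[of 1 n "norm q"] by (simp add: norm_power)
      have m: "norm (q ^ m) \<le> 1 / 2"
        using q assms(2) power_decreasing[of 1 m "norm q"] by (simp add: norm_power)
      define y where "y = norm (q ^ m) / (1 - norm (q ^ n))"
      have "y \<le> norm (q ^ m) / (1 / 2)"
        unfolding y_def using n by (intro divide_left_mono) auto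
      hence y: "0 \<le> y" "y \<le> 2 * norm (q ^ m)" "y \<le> 1" using m n by (auto simp: y_def)
      have "norm (qprod (q ^ m) (q ^ n) - 1) \<le> exp y - 1"
        unfolding y_def by (rule norm_qprod_minus_1_le) (use n in auto)
      also have "\<dots> \<le> y + y ^ 2" using exp_bound[OF y(1,3)] by simp
      also have "\<dots> \<le> 2 * y" using y mult_left_le[of y y] by (simp add: power2_eq_square)
      also have "\<dots> \<le> 4 * norm q ^ m" using y by (simp add: norm_power)
      finally show ?case .
    qed
  qed
  ultimately have "fps_nth (T - 1) k = 0" if "k < m" for k
    using that by (rule fps_expansion_O_power)
  hence "\<forall>k<m. fps_nth T k = (if k = 0 then 1 else 0)" by auto
  thus ?thesis using T by blast
qed

section \<open>Truncated power series and Euler products\<close>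

definition fps_eq_upto :: "nat \<Rightarrow> complex fps \<Rightarrow> complex fps \<Rightarrow> bool" where
  "fps_eq_upto m F G \<longleftrightarrow> (\<forall>k<m. fps_nth F k = fps_nth G k)"

lemma fps_eq_upto_refl [simp]: "fps_eq_upto m F F" by (simp add: fps_eq_upto_def)
lemma fps_eq_upto_sym: "fps_eq_upto m F G \<Longrightarrow> fps_eq_upto m G F" by (simp add: fps_eq_upto_def)
lemma fps_eq_upto_trans [trans]: "fps_eq_upto m F G \<Longrightarrow> fps_eq_upto m G H \<Longrightarrow> fps_eq_upto m F H" by (simp add: fps_eq_upto_def)
lemma fps_eq_upto_mono: "fps_eq_upto m F G \<Longrightarrow> m' \<le> m \<Longrightarrow> fps_eq_upto m' F G" by (simp add: fps_eq_upto_def)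
lemma fps_eq_upto_diff: "fps_eq_upto m F G \<Longrightarrow> fps_eq_upto m F' G' \<Longrightarrow> fps_eq_upto m (F - F') (G - G')" by (simp add: fps_eq_upto_def)
lemma fps_eq_upto_mult: "fps_eq_upto m F G \<Longrightarrow> fps_eq_upto m F' G' \<Longrightarrow> fps_eq_upto m (F * F') (G * G')"
  by (auto simp: fps_eq_upto_def fps_mult_nth intro!: sum.cong)

text \<open>A proposed inverse is checked by multiplication, so no division of series has to be
  computed.\<close>

lemma fps_eq_upto_inverse:
  assumes "fps_eq_upto m (E * G) 1" "fps_nth E 0 \<noteq> 0"
  shows "fps_eq_upto m (inverse E) G"
proof -
  have "fps_eq_upto m (inverse E * (1 - E * G)) (inverse E * (1 - 1))"
    using assms(1) by (intro fps_eq_upto_mult fps_eq_upto_diff) auto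
  moreover have "inverse E * (1 - E * G) = inverse E - G"
    using inverse_mult_eq_1[OF assms(2)] by (simp add: right_diff_distrib mult.assoc[symmetric])
  ultimately show ?thesis by (simp add: fps_eq_upto_def)
qed

definition eulF :: "nat \<Rightarrow> complex fps" where "eulF n = fps_expansion (eul n) 0"

lemma eulF:
  assumes "n > 0"
  shows "eul n has_fps_expansion eulF n"
    and "fps_eq_upto (n * Suc M) (eulF n) (\<Prod>i<M. 1 - fps_X ^ (n * Suc i))"
proof -
  obtain T where T: "(\<lambda>q. qprod (q ^ (n * Suc M)) (q ^ n)) has_fps_expansion T"
    "\<forall>k<n * Suc M. fps_nth T k = (if k = 0 then 1 else 0)"
    using eul_tail[of n "n * Suc M"] assms by auto
  let ?P = "\<Prod>i<M. 1 - fps_X ^ (n * Suc i) :: complex fps"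
  have ex: "(\<lambda>q. (\<Prod>i<M. 1 - q ^ (n * Suc i)) * qprod (q ^ (n * Suc M)) (q ^ n)) has_fps_expansion ?P * T"
    by (intro fps_expansion_intros T)
  have "\<forall>\<^sub>F q in nhds (0::complex). q \<in> ball 0 1"
    by (rule eventually_nhds_in_open) auto
  hence ev: "\<forall>\<^sub>F q in nhds 0. (\<Prod>i<M. 1 - q ^ (n * Suc i)) * qprod (q ^ (n * Suc M)) (q ^ n) = eul n q"
  proof eventually_elim
    case (elim q)
    have "norm (q ^ n) < 1" using elim assms by (simp add: norm_power power_less_one_iff)
    from qprod_split[OF this, of "q ^ n" M] show ?case
      by (simp add: eul_def power_add power_mult[symmetric] mult_ac)
  qed
  have e: "eul n has_fps_expansion ?P * T"
    using iffD1[OF has_fps_expansion_cong[OF ev refl] ex] .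
  hence eq: "eulF n = ?P * T" unfolding eulF_def by (rule fps_expansion_eqI)
  show "eul n has_fps_expansion eulF n" using e eq by simp
  have "fps_eq_upto (n * Suc M) T 1" using T(2) by (simp add: fps_eq_upto_def)
  hence "fps_eq_upto (n * Suc M) (?P * T) (?P * 1)" by (intro fps_eq_upto_mult) auto
  thus "fps_eq_upto (n * Suc M) (eulF n) ?P" by (simp add: eq)
qed

lemma eulF_0: "n > 0 \<Longrightarrow> fps_nth (eulF n) 0 = 1"
  using eulF(2)[of n 0] by (simp add: fps_eq_upto_def)

lemma Rats_fps_mult:
  fixes F G :: "complex fps"
  assumes "\<And>k. fps_nth F k \<in> \<rat>" "\<And>k. fps_nth G k \<in> \<rat>"
  shows "fps_nth (F * G) k \<in> \<rat>"
  using assms by (auto simp: fps_mult_nth intro!: Rats_sum Rats_mult)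

lemma Rats_fps_power:
  fixes F :: "complex fps"
  assumes "\<And>k. fps_nth F k \<in> \<rat>"
  shows "fps_nth (F ^ n) k \<in> \<rat>"
proof (induction n arbitrary: k)
  case (Suc n)
  thus ?case unfolding power_Suc by (intro Rats_fps_mult assms)
qed (simp add: fps_one_nth)

lemma Rats_fps_prod:
  fixes F :: "nat \<Rightarrow> complex fps"
  assumes "\<And>i k. fps_nth (F i) k \<in> \<rat>"
  shows "fps_nth (\<Prod>i<M. F i) k \<in> \<rat>"
proof (induction M arbitrary: k)
  case (Suc M)
  thus ?case unfolding prod.lessThan_Suc by (intro Rats_fps_mult assms)
qed (simp add: fps_one_nth)

text \<open>The coefficient of index \<open>k\<close> already appears in a finite product of
  \<open>k\<close> factors with integer coefficients.\<close>

lemma Rats_eulF: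
  assumes "n > 0"
  shows "fps_nth (eulF n) k \<in> \<rat>"
proof -
  have "k < n * Suc k" using assms by (cases n) auto
  hence "fps_nth (eulF n) k = fps_nth (\<Prod>i<k. 1 - fps_X ^ (n * Suc i)) k"
    using eulF(2)[OF assms, of k] by (simp add: fps_eq_upto_def)
  also have "\<dots> \<in> \<rat>"
    by (rule Rats_fps_prod) (simp add: fps_X_power_nth fps_one_nth)
  finally show ?thesis .
qed

text \<open>The expansions of \<open>hf\<close>, \<open>kf\<close> and \<open>pf\<close> without
  their leading powers, of exponents -1, -5 and -2; all have constant term 1.\<close>

definition h0F :: "complex fps" where "h0F = (eulF 1 * inverse (eulF 9)) ^ 3"
definition k0F :: "complex fps" where "k0F = (eulF 5 * inverse (eulF 45)) ^ 3"
definition p0F :: "complex fps" where "p0F = eulF 1 * inverse (eulF 9) * (eulF 5 * inverse (eulF 45))"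

lemma eul_quotient_expansion:
  assumes "n > 0" "m > 0"
  shows "(\<lambda>q. eul n q / eul m q) has_fps_expansion eulF n * inverse (eulF m)"
  unfolding divide_inverse using eulF(1)[OF assms(1)] eulF(1)[OF assms(2)] eulF_0[OF assms(2)]
  by (intro has_fps_expansion_mult has_fps_expansion_inverse) auto

lemma has_q_expansion_mero_of:
  assumes hol: "u holomorphic_on uhp" and G: "G has_laurent_expansion F"
    and eq: "\<And>z. z \<in> uhp \<Longrightarrow> u z = G (ee z)"
  shows "has_q_expansion 1 (mero_of u) F"
proof -
  have "\<forall>z. Im z \<ge> 1 \<longrightarrow> eval_uhp (mero_of u) z = G (ee (z / of_nat 1))"
    using eval_mero_of_holomorphic[OF hol] eq by (auto simp: uhp_def)
  thus ?thesis unfolding has_q_expansion_iff using G by blast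
qed

lemma fps_expansion_shift:
  assumes "f has_fps_expansion F"
  shows "(\<lambda>q. q powi n * f q) has_laurent_expansion fls_X_intpow n * fps_to_fls F"
  by (intro has_laurent_expansion_mult has_laurent_expansion_fps_X_power_int has_laurent_expansion_fps assms)

lemma qexp_hf: "has_q_expansion 1 hf (fls_X_intpow (-1) * fps_to_fls h0F)"
  unfolding hf_def
proof (rule has_q_expansion_mero_of)
  show "(\<lambda>q. q powi (-1) * (eul 1 q / eul 9 q) ^ 3) has_laurent_expansion fls_X_intpow (-1) * fps_to_fls h0F"
    unfolding h0F_def by (intro fps_expansion_shift has_fps_expansion_power eul_quotient_expansion) auto
  fix z assume z: "z \<in> uhp"
  have "ee (- z / 3) ^ 3 = ee z powi (-1)"
    using ee_of_nat_mult[of 3 "- z / 3"] by (simp add: ee_minus power_int_minus)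
  thus "k1 z ^ 3 = ee z powi (-1) * (eul 1 (ee z) / eul 9 (ee z)) ^ 3"
    by (simp add: k1_product[OF z] power_mult_distrib power_divide)
qed (intro holomorphic_intros k1_holomorphic)

lemma qexp_kf: "has_q_expansion 1 kf (fls_X_intpow (-5) * fps_to_fls k0F)"
  unfolding kf_def
proof (rule has_q_expansion_mero_of)
  show "(\<lambda>q. q powi (-5) * (eul 5 q / eul 45 q) ^ 3) has_laurent_expansion fls_X_intpow (-5) * fps_to_fls k0F"
    unfolding k0F_def by (intro fps_expansion_shift has_fps_expansion_power eul_quotient_expansion) auto
  fix z assume z: "z \<in> uhp"
  have "ee (- (5 * z) / 3) ^ 3 = ee (of_int (- 5) * z)"
    using ee_of_nat_mult[of 3 "- (5 * z) / 3"] by simp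
  hence "ee (- (5 * z) / 3) ^ 3 = ee z powi (-5)"
    by (simp only: ee_of_int_mult)
  thus "k2 z ^ 3 = ee z powi (-5) * (eul 5 (ee z) / eul 45 (ee z)) ^ 3"
    by (simp add: k2_product[OF z] power_mult_distrib power_divide)
qed (intro holomorphic_intros k2_holomorphic)

lemma qexp_pf: "has_q_expansion 1 pf (fls_X_intpow (-2) * fps_to_fls p0F)"
  unfolding pf_def
proof (rule has_q_expansion_mero_of)
  show "(\<lambda>q. q powi (-2) * ((eul 1 q / eul 9 q) * (eul 5 q / eul 45 q))) has_laurent_expansion
          fls_X_intpow (-2) * fps_to_fls p0F"
    unfolding p0F_def by (intro fps_expansion_shift has_fps_expansion_mult eul_quotient_expansion) auto
  fix z assume z: "z \<in> uhp"
  have "- z / 3 + - (5 * z) / 3 = of_int (- 2) * z" by (simp add: field_simps)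
  hence "ee (- z / 3) * ee (- (5 * z) / 3) = ee z powi (-2)"
    by (simp only: ee_of_int_mult flip: ee_add)
  moreover have "k1 z * k2 z = (ee (- z / 3) * ee (- (5 * z) / 3)) *
      ((eul 1 (ee z) / eul 9 (ee z)) * (eul 5 (ee z) / eul 45 (ee z)))"
    by (simp add: k1_product[OF z] k2_product[OF z])
  ultimately show "k1 z * k2 z = ee z powi (-2) * ((eul 1 (ee z) / eul 9 (ee z)) * (eul 5 (ee z) / eul 45 (ee z)))"
    by simp
qed (intro holomorphic_intros k1_holomorphic k2_holomorphic)

lemma rat_fls_intpow_mult:
  assumes "\<And>k. fps_nth F k \<in> \<rat>"
  shows "rat_fls (fls_X_intpow n * fps_to_fls F)"
  using assms by (auto simp: rat_fls_def fls_X_intpow_times_conv_shift)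

lemma Rats_quotient:
  assumes "n > 0" "m > 0"
  shows "fps_nth (eulF n * inverse (eulF m)) k \<in> \<rat>"
  by (intro Rats_fps_mult Rats_fps_inverse Rats_eulF assms)

lemma hf_rat: "hf \<in> X0_functions_rat 45"
  unfolding X0_rat_iff using hf_X0c qexp_hf
  by (metis Rats_fps_power Rats_quotient h0F_def rat_fls_intpow_mult zero_less_numeral zero_less_one)

lemma kf_rat: "kf \<in> X0_functions_rat 45"
  unfolding X0_rat_iff using kf_X0c qexp_kf
  by (metis Rats_fps_power Rats_quotient k0F_def rat_fls_intpow_mult zero_less_numeral)

lemma pf_rat: "pf \<in> X0_functions_rat 45"
  unfolding X0_rat_iff using pf_X0c qexp_pf
  by (metis Rats_fps_mult Rats_quotient p0F_def rat_fls_intpow_mult zero_less_numeral zero_less_one)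

text \<open>Power series are computed modulo \<open>X ^ 11\<close>, because the relation between \<open>pf\<close> and \<open>Sf\<close> has pole
  order at most 10 at \<open>\<infinity>\<close>.\<close>
definition series_of :: "int list \<Rightarrow> complex fps" where
  "series_of xs = Abs_fps (\<lambda>k. of_int (if k < 11 then xs ! k else 0))"

definition mult_list :: "int list \<Rightarrow> int list \<Rightarrow> int list" where
  "mult_list xs ys = map (\<lambda>k. sum_list (map (\<lambda>i. xs ! i * ys ! (k - i)) [0..<Suc k])) [0..<11]"

lemma fps_eq_upto_fl_mult:
  assumes "fps_eq_upto 11 F (series_of xs)" "fps_eq_upto 11 G (series_of ys)"
  shows "fps_eq_upto 11 (F * G) (series_of (mult_list xs ys))"
  unfolding fps_eq_upto_def
proof (intro allI impI)
  fix k :: nat assume k: "k < 11"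
  have "fps_nth (F * G) k = (\<Sum>i=0..k. of_int (xs ! i) * of_int (ys ! (k - i)))"
    unfolding fps_mult_nth using assms k by (intro sum.cong) (auto simp: fps_eq_upto_def series_of_def)
  also have "\<dots> = of_int (\<Sum>i\<leftarrow>[0..<Suc k]. xs ! i * ys ! (k - i))"
    by (simp add: interv_sum_list_conv_sum_set_nat atLeastLessThanSuc_atLeastAtMost del: upt_Suc)
  also have "\<dots> = fps_nth (series_of (mult_list xs ys)) k"
    using k by (simp add: series_of_def mult_list_def del: upt_Suc)
  finally show "fps_nth (F * G) k = fps_nth (series_of (mult_list xs ys)) k" .
qed

lemma fps_eq_upto_fl_add:
  assumes "fps_eq_upto 11 F (series_of xs)" "fps_eq_upto 11 G (series_of ys)"
  shows "fps_eq_upto 11 (F + G) (series_of (map (\<lambda>i. xs ! i + ys ! i) [0..<11]))"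
  using assms by (simp add: fps_eq_upto_def series_of_def)

lemma fps_eq_upto_fl_const: "fps_eq_upto 11 (of_int c) (series_of [c, 0, 0, 0, 0, 0, 0, 0, 0, 0, 0])"
proof -
  have "fps_nth (of_int c :: complex fps) k = of_int (if k = 0 then c else 0)" for k
    by (simp add: fps_of_int[symmetric])
  moreover have "[c, 0, 0, 0, 0, 0, 0, 0, 0, 0, 0] ! k = (if k = 0 then c else 0)" if "k < 11" for k
    using that by (auto simp: nth_Cons' eval_nat_numeral less_Suc_eq)
  ultimately show ?thesis by (simp add: fps_eq_upto_def series_of_def)
qed

definition one_minus_X_list :: "nat \<Rightarrow> int list" where
  "one_minus_X_list n = map (\<lambda>k. if k = 0 then 1 else if k = n then - 1 else 0) [0..<11]"

definition X_power_list :: "nat \<Rightarrow> int list" where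
  "X_power_list n = map (\<lambda>k. if k = n then 1 else 0) [0..<11]"

definition const_list :: "int \<Rightarrow> int list" where
  "const_list c = [c, 0, 0, 0, 0, 0, 0, 0, 0, 0, 0]"

definition add_list :: "int list \<Rightarrow> int list \<Rightarrow> int list" where
  "add_list xs ys = map (\<lambda>i. xs ! i + ys ! i) [0..<11]"

lemma fps_eq_upto_fl_X: "fps_eq_upto 11 (fps_X ^ n) (series_of (X_power_list n))"
  by (simp add: fps_eq_upto_def series_of_def X_power_list_def fps_X_power_nth)

lemma fps_eq_upto_fl_1_minus_X: "n > 0 \<Longrightarrow> fps_eq_upto 11 (1 - fps_X ^ n) (series_of (one_minus_X_list n))"
  by (auto simp: fps_eq_upto_def series_of_def one_minus_X_list_def fps_X_power_nth)

lemmas fps_eq_upto_intros = fps_eq_upto_fl_const[folded const_list_def] fps_eq_upto_fl_add[folded add_list_def] fps_eq_upto_fl_mult fps_eq_upto_fl_X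

primrec euler_list :: "nat \<Rightarrow> nat \<Rightarrow> int list" where
  "euler_list n 0 = const_list 1"
| "euler_list n (Suc M) = mult_list (euler_list n M) (one_minus_X_list (n * Suc M))"

lemma fps_eq_upto_euler_list:
  assumes "n > 0"
  shows "fps_eq_upto 11 (\<Prod>i<M. 1 - fps_X ^ (n * Suc i)) (series_of (euler_list n M))"
proof (induction M)
  case 0
  show ?case using fps_eq_upto_intros(1)[of 1] by simp
next
  case (Suc M)
  have "fps_eq_upto 11 (1 - fps_X ^ (n * Suc M)) (series_of (one_minus_X_list (n * Suc M)))"
    using assms by (intro fps_eq_upto_fl_1_minus_X) simp
  from fps_eq_upto_fl_mult[OF Suc this] show ?case
    unfolding prod.lessThan_Suc euler_list.simps .
qed

text \<open>The omitted factors begin with the exponent \<open>n * Suc M\<close>, beyond the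
  truncation.\<close>

lemma fps_eq_upto_eulF:
  assumes "n > 0" "11 \<le> n * Suc M"
  shows "fps_eq_upto 11 (eulF n) (series_of (euler_list n M))"
  using fps_eq_upto_mono[OF eulF(2)[OF assms(1), of M] assms(2)] fps_eq_upto_euler_list[OF assms(1)] by (rule fps_eq_upto_trans)

lemma fps_eq_upto_inverse_eulF:
  assumes "n > 0" "11 \<le> n * Suc M" "mult_list (euler_list n M) xs = const_list 1"
  shows "fps_eq_upto 11 (inverse (eulF n)) (series_of xs)"
proof (rule fps_eq_upto_inverse)
  have "fps_eq_upto 11 (eulF n * series_of xs) (series_of (mult_list (euler_list n M) xs))"
    by (rule fps_eq_upto_fl_mult[OF fps_eq_upto_eulF[OF assms(1,2)]]) simp
  also have "fps_eq_upto 11 (series_of (mult_list (euler_list n M) xs)) 1"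
    unfolding assms(3) using fps_eq_upto_sym[OF fps_eq_upto_intros(1)[of 1]] by simp
  finally show "fps_eq_upto 11 (eulF n * series_of xs) 1" .
qed (use eulF_0[OF assms(1)] in simp)

lemma fps_eq_upto_eul_series:
  "fps_eq_upto 11 (eulF 1) (series_of [1, -1, -1, 0, 0, 1, 0, 1, 0, 0, 0])"
  "fps_eq_upto 11 (eulF 5) (series_of [1, 0, 0, 0, 0, -1, 0, 0, 0, 0, -1])"
  "fps_eq_upto 11 (inverse (eulF 9)) (series_of [1, 0, 0, 0, 0, 0, 0, 0, 0, 1, 0])"
  "fps_eq_upto 11 (inverse (eulF 45)) (series_of (const_list 1))"
proof -
  have "euler_list 1 10 = [1, -1, -1, 0, 0, 1, 0, 1, 0, 0, 0]" by code_simp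
  with fps_eq_upto_eulF[of 1 10] show "fps_eq_upto 11 (eulF 1) (series_of [1, -1, -1, 0, 0, 1, 0, 1, 0, 0, 0])" by simp
  have "euler_list 5 2 = [1, 0, 0, 0, 0, -1, 0, 0, 0, 0, -1]" by code_simp
  with fps_eq_upto_eulF[of 5 2] show "fps_eq_upto 11 (eulF 5) (series_of [1, 0, 0, 0, 0, -1, 0, 0, 0, 0, -1])" by simp
  have "mult_list (euler_list 9 1) [1, 0, 0, 0, 0, 0, 0, 0, 0, 1, 0] = const_list 1" by code_simp
  with fps_eq_upto_inverse_eulF[of 9 1] show "fps_eq_upto 11 (inverse (eulF 9)) (series_of [1, 0, 0, 0, 0, 0, 0, 0, 0, 1, 0])" by simp
  \<comment> \<open>The empty product suffices, since the first factor \<open>1 - X ^ 45\<close> is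
    1 modulo \<open>X ^ 11\<close>.\<close>
  have "mult_list (euler_list 45 0) (const_list 1) = const_list 1" by code_simp
  with fps_eq_upto_inverse_eulF[of 45 0] show "fps_eq_upto 11 (inverse (eulF 45)) (series_of (const_list 1))" by simp
qed

lemma fps_eq_upto_h0F: "fps_eq_upto 11 h0F (series_of [1, -3, 0, 5, 0, 0, -7, 0, 0, 3, 0])"
proof -
  let ?a = "mult_list [1, -1, -1, 0, 0, 1, 0, 1, 0, 0, 0] [1, 0, 0, 0, 0, 0, 0, 0, 0, 1, 0]"
  have a: "fps_eq_upto 11 (eulF 1 * inverse (eulF 9)) (series_of ?a)"
    by (intro fps_eq_upto_fl_mult fps_eq_upto_eul_series)
  have "h0F = (eulF 1 * inverse (eulF 9)) * ((eulF 1 * inverse (eulF 9)) * (eulF 1 * inverse (eulF 9)))"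
    by (simp only: h0F_def power3_eq_cube mult.assoc)
  hence "fps_eq_upto 11 h0F (series_of (mult_list ?a (mult_list ?a ?a)))"
    using fps_eq_upto_fl_mult[OF a fps_eq_upto_fl_mult[OF a a]] by simp
  moreover have "mult_list ?a (mult_list ?a ?a) = [1, -3, 0, 5, 0, 0, -7, 0, 0, 3, 0]" by code_simp
  ultimately show ?thesis by simp
qed

lemma fps_eq_upto_k0F: "fps_eq_upto 11 k0F (series_of [1, 0, 0, 0, 0, -3, 0, 0, 0, 0, 0])"
proof -
  let ?a = "mult_list [1, 0, 0, 0, 0, -1, 0, 0, 0, 0, -1] (const_list 1)"
  have a: "fps_eq_upto 11 (eulF 5 * inverse (eulF 45)) (series_of ?a)"
    by (intro fps_eq_upto_fl_mult fps_eq_upto_eul_series)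
  have "k0F = (eulF 5 * inverse (eulF 45)) * ((eulF 5 * inverse (eulF 45)) * (eulF 5 * inverse (eulF 45)))"
    by (simp only: k0F_def power3_eq_cube mult.assoc)
  hence "fps_eq_upto 11 k0F (series_of (mult_list ?a (mult_list ?a ?a)))"
    using fps_eq_upto_fl_mult[OF a fps_eq_upto_fl_mult[OF a a]] by simp
  moreover have "mult_list ?a (mult_list ?a ?a) = [1, 0, 0, 0, 0, -3, 0, 0, 0, 0, 0]" by code_simp
  ultimately show ?thesis by simp
qed

lemma fps_eq_upto_p0F: "fps_eq_upto 11 p0F (series_of [1, -1, -1, 0, 0, 0, 1, 2, 0, 1, -3])"
proof -
  let ?a = "mult_list [1, -1, -1, 0, 0, 1, 0, 1, 0, 0, 0] [1, 0, 0, 0, 0, 0, 0, 0, 0, 1, 0]"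
  let ?b = "mult_list [1, 0, 0, 0, 0, -1, 0, 0, 0, 0, -1] (const_list 1)"
  have "fps_eq_upto 11 p0F (series_of (mult_list ?a ?b))"
    unfolding p0F_def by (intro fps_eq_upto_fl_mult fps_eq_upto_eul_series)
  moreover have "mult_list ?a ?b = [1, -1, -1, 0, 0, 0, 1, 2, 0, 1, -3]" by code_simp
  ultimately show ?thesis by simp
qed

text \<open>The expansion of \<open>Sf\<close> times \<open>X ^ 5\<close>; the pole of
  \<open>hf\<close> has order 1, hence the factor \<open>X ^ 4\<close>.\<close>

definition s0F :: "complex fps" where "s0F = k0F + fps_X ^ 4 * h0F"

lemma fps_eq_upto_s0F: "fps_eq_upto 11 s0F (series_of [1, 0, 0, 0, 1, -6, 0, 5, 0, 0, -7])"
proof -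
  let ?a = "add_list [1, 0, 0, 0, 0, -3, 0, 0, 0, 0, 0] (mult_list (X_power_list 4) [1, -3, 0, 5, 0, 0, -7, 0, 0, 3, 0])"
  have "fps_eq_upto 11 s0F (series_of ?a)"
    unfolding s0F_def by (intro fps_eq_upto_intros fps_eq_upto_h0F fps_eq_upto_k0F)
  moreover have "?a = [1, 0, 0, 0, 1, -6, 0, 5, 0, 0, -7]" by code_simp
  ultimately show ?thesis by simp
qed

text \<open>The relation multiplied by \<open>X ^ 10\<close>, where \<open>pf\<close> and \<open>Sf\<close> have the expansions
  \<open>p0F / X ^ 2\<close> and \<open>s0F / X ^ 5\<close>.\<close>
definition r0F :: "complex fps" where
  "r0F = s0F * s0F + of_int (-1) * (p0F * (p0F * (p0F * (p0F * p0F)))) + of_int (-5) * (fps_X ^ 1 * (s0F * (p0F * p0F)))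
     + of_int (-5) * (fps_X ^ 2 * (p0F * (p0F * (p0F * p0F)))) + of_int (-15) * (fps_X ^ 3 * (s0F * p0F))
     + of_int (-12) * (fps_X ^ 4 * (p0F * (p0F * p0F))) + of_int (-45) * (fps_X ^ 6 * (p0F * p0F))
     + of_int (-81) * (fps_X ^ 8 * p0F)"

lemma r0F_vanishes: "fps_eq_upto 11 r0F 0"
proof -
  let ?s = "[1, 0, 0, 0, 1, -6, 0, 5, 0, 0, -7]" and ?p = "[1, -1, -1, 0, 0, 0, 1, 2, 0, 1, -3]"
  let ?p2 = "mult_list ?p ?p" and ?p3 = "mult_list ?p (mult_list ?p ?p)" and ?p4 = "mult_list ?p (mult_list ?p (mult_list ?p ?p))"
  let ?r = "add_list (add_list (add_list (add_list (add_list (add_list (add_list (mult_list ?s ?s)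
     (mult_list (const_list (-1)) (mult_list ?p ?p4))) (mult_list (const_list (-5)) (mult_list (X_power_list 1) (mult_list ?s ?p2))))
     (mult_list (const_list (-5)) (mult_list (X_power_list 2) ?p4))) (mult_list (const_list (-15)) (mult_list (X_power_list 3) (mult_list ?s ?p))))
     (mult_list (const_list (-12)) (mult_list (X_power_list 4) ?p3))) (mult_list (const_list (-45)) (mult_list (X_power_list 6) ?p2)))
     (mult_list (const_list (-81)) (mult_list (X_power_list 8) ?p))"
  have "fps_eq_upto 11 r0F (series_of ?r)"
    unfolding r0F_def by (intro fps_eq_upto_intros fps_eq_upto_s0F fps_eq_upto_p0F)
  also have "?r = const_list 0" by code_simp
  also have "fps_eq_upto 11 (series_of (const_list 0)) 0"
    using fps_eq_upto_sym[OF fps_eq_upto_intros(1)[of 0]] by simp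
  finally show ?thesis .
qed

section \<open>Generators of the field of invariant functions\<close>

definition Sf :: mero_uhp where "Sf = hf + kf"
definition Tf :: mero_uhp where "Tf = hf - kf"
definition PF :: "complex fls" where "PF = fls_X_intpow (-2) * fps_to_fls p0F"
definition HF :: "complex fls" where "HF = fls_X_intpow (-1) * fps_to_fls h0F"
definition KF :: "complex fls" where "KF = fls_X_intpow (-5) * fps_to_fls k0F"

lemma qexps:
  "has_q_expansion 1 pf PF" "has_q_expansion 1 hf HF" "has_q_expansion 1 kf KF"
  unfolding PF_def HF_def KF_def by (rule qexp_pf qexp_hf qexp_kf)+

lemma qexp_Sf: "has_q_expansion 1 Sf (HF + KF)"
  unfolding Sf_def by (intro has_q_expansion_add qexps) simp

lemma fls_X_power_times_intpow:
  "fls_X ^ n * (fls_X_intpow k * F) = fls_X_intpow (int n + k) * (F :: complex fls)"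
  by (simp only: mult.assoc[symmetric] fls_X_power_conv_shift_1 fls_X_intpow_times_fls_X_intpow)

lemma fls_X_mult_expansions:
  "fls_X ^ 2 * PF = fps_to_fls p0F"
  "fls_X ^ 5 * (HF + KF) = fps_to_fls s0F"
proof -
  show "fls_X ^ 2 * PF = fps_to_fls p0F"
    unfolding PF_def fls_X_power_times_intpow by simp
  have "fls_X ^ 5 * HF = fls_X ^ 4 * fps_to_fls h0F"
  proof -
    have "fls_X_intpow (int 5 + - 1) = (fls_X ^ 4 :: complex fls)"
      by (simp add: fls_X_power_conv_shift_1)
    thus ?thesis unfolding HF_def fls_X_power_times_intpow by simp
  qed
  moreover have "fls_X ^ 5 * KF = fps_to_fls k0F"
    unfolding KF_def fls_X_power_times_intpow by simp
  ultimately show "fls_X ^ 5 * (HF + KF) = fps_to_fls s0F"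
    by (simp add: s0F_def distrib_left fls_times_fps_to_fls fps_to_fls_power add.commute)
qed

lemma qexp_bounded:
  assumes "has_q_expansion h f F" "h > 0" "fls_subdegree F \<ge> 0"
  shows "bounded_at_inf f"
proof -
  obtain G B where G: "G has_laurent_expansion F" "\<And>z. Im z \<ge> B \<Longrightarrow> eval_uhp f z = G (ee (z / of_nat h))"
    using assms(1) unfolding has_q_expansion_iff by blast
  have "(\<lambda>q. norm (G q)) \<midarrow>0\<rightarrow> norm (fls_nth F 0)"
    by (intro tendsto_norm has_laurent_expansion_imp_tendsto_0 G assms)
  hence "\<forall>\<^sub>F q in at 0. norm (G q) < norm (fls_nth F 0) + 1"
    by (rule order_tendstoD) simp
  from eventually_at_0_imp_Im[OF this assms(2)] obtain B' where
    "\<And>z. Im z \<ge> B' \<Longrightarrow> norm (G (ee (z / of_nat h))) < norm (fls_nth F 0) + 1" by blast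
  hence "norm (eval_uhp f z) \<le> norm (fls_nth F 0) + 1" if "Im z \<ge> max B B'" for z
    using that G(2)[of z] by (simp add: less_imp_le)
  thus ?thesis unfolding bounded_at_inf_def by blast
qed

text \<open>Without a principal part the function is bounded at \<open>\<infinity>\<close>, hence
  constant by \<open>reg_bounded_constant\<close>, and its constant term is 0.\<close>

lemma reg_eq_0:
  assumes "reg f" "has_q_expansion 1 f F" "\<And>n. n \<le> 0 \<Longrightarrow> fls_nth F n = 0"
  shows "f = 0"
proof -
  have "fls_subdegree F \<ge> 0"
    by (rule fls_subdegree_ge0I) (use assms(3) in auto)
  hence "bounded_at_inf f" using qexp_bounded[OF assms(2)] by simp
  then obtain c where c: "f = cm c" using reg_bounded_constant[OF assms(1)] by blast
  hence "F = fls_const c"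
    using has_q_expansion_unique[OF assms(2)] has_q_expansion_cm[of 1 c] by simp
  hence "c = 0" using assms(3)[of 0] by simp
  thus ?thesis using c by simp
qed

lemma reg_Sf: "reg Sf"
  unfolding Sf_def by (rule reg_hf_kf)

lemma reg_diff: "reg f \<Longrightarrow> reg g \<Longrightarrow> reg (f - g)"
  using reg_add[of f "- g"] reg_uminus[of g] by simp

lemma reg_numeral: "reg (numeral n)"
  using reg_cm[of "numeral n"] cm_of_nat[of "numeral n"] by simp

lemma has_q_expansion_numeral: "has_q_expansion h (numeral n) (numeral n)"
proof -
  have "cm (numeral n) = numeral n" using cm_of_nat[of "numeral n"] by simp
  moreover have "fls_const (numeral n) = (numeral n :: complex fls)" by simp
  ultimately show ?thesis using has_q_expansion_cm[of h "numeral n"] by simp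
qed

lemma has_q_expansion_diff:
  "has_q_expansion h f F \<Longrightarrow> has_q_expansion h g G \<Longrightarrow> h > 0 \<Longrightarrow> has_q_expansion h (f - g) (F - G)"
  using has_q_expansion_add[of h f F "- g" "- G"] has_q_expansion_uminus[of h g G] by simp

text \<open>Every term has a pole of order at most 10 at \<open>\<infinity>\<close>, so it suffices
  to compare the coefficients of exponents -10 to 0. The numbers on the right are those that cancel
  the principal part of \<open>Sf ^ 2\<close> from the highest pole order down.\<close>

theorem Sf_pf_relation:
  "Sf ^ 2 = pf ^ 5 + 5 * (Sf * pf ^ 2) + 5 * pf ^ 4 + 15 * (Sf * pf) + 12 * pf ^ 3 + 45 * pf ^ 2 + 81 * pf"
proof -
  let ?rel = "\<lambda>S P. S ^ 2 - (P ^ 5 + 5 * (S * P ^ 2) + 5 * P ^ 4 + 15 * (S * P) + 12 * P ^ 3 + 45 * P ^ 2 + 81 * P)"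
  have "?rel Sf pf = 0"
  proof (rule reg_eq_0)
    show "reg (?rel Sf pf)"
      by (intro reg_diff reg_add reg_mult reg_power reg_numeral reg_Sf reg_pf)
    show "has_q_expansion 1 (?rel Sf pf) (?rel (HF + KF) PF)"
      by (intro has_q_expansion_diff has_q_expansion_add has_q_expansion_mult has_q_expansion_power
            has_q_expansion_numeral qexp_Sf qexps zero_less_one)
    fix n :: int assume n: "n \<le> 0"
    \<comment> \<open>The factor \<open>x ^ 10\<close> is distributed as \<open>x ^ 5\<close> for
      each \<open>S\<close> and \<open>x ^ 2\<close> for each \<open>P\<close>, which turns the
      Laurent series into power series; the surplus stays as a power of \<open>x\<close>.\<close>
    have alg: "x ^ 10 * ?rel S P = (x ^ 5 * S) * (x ^ 5 * S) + (-1) * ((x ^ 2 * P) * ((x ^ 2 * P) * ((x ^ 2 * P) * ((x ^ 2 * P) * (x ^ 2 * P)))))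
        + (-5) * (x * ((x ^ 5 * S) * ((x ^ 2 * P) * (x ^ 2 * P)))) + (-5) * (x ^ 2 * ((x ^ 2 * P) * ((x ^ 2 * P) * ((x ^ 2 * P) * (x ^ 2 * P)))))
        + (-15) * (x ^ 3 * ((x ^ 5 * S) * (x ^ 2 * P))) + (-12) * (x ^ 4 * ((x ^ 2 * P) * ((x ^ 2 * P) * (x ^ 2 * P))))
        + (-45) * (x ^ 6 * ((x ^ 2 * P) * (x ^ 2 * P))) + (-81) * (x ^ 8 * (x ^ 2 * P))"
      for x S P :: "complex fls"
      by algebra
    have "fls_X ^ 10 * ?rel (HF + KF) PF = fps_to_fls r0F"
      unfolding alg fls_X_mult_expansions r0F_def
      by (simp add: fls_times_fps_to_fls fps_to_fls_power flip: fls_of_int)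
    hence "fls_nth (fls_X ^ 10 * ?rel (HF + KF) PF) (n + 10) = fls_nth (fps_to_fls r0F) (n + 10)"
      by simp
    moreover have "fls_nth (fps_to_fls r0F) (n + 10) = 0"
    proof (cases "n + 10 \<ge> 0")
      case True
      have "nat (n + 10) < 11" using n by linarith
      thus ?thesis using r0F_vanishes True by (simp add: fps_eq_upto_def)
    qed simp
    ultimately show "fls_nth (?rel (HF + KF) PF) n = 0"
      by (simp only: fls_X_power_times_conv_shift fls_shift_nth) simp
  qed
  thus ?thesis by simp
qed

lemma fls_subdegree_intpow_fps:
  assumes "fps_nth F 0 = 1"
  shows "fls_subdegree (fls_X_intpow n * fps_to_fls F) = n" "fls_X_intpow n * fps_to_fls F \<noteq> (0 :: complex fls)"
proof -
  have nth: "fls_nth (fls_X_intpow n * fps_to_fls F) k = (if k < n then 0 else fps_nth F (nat (k - n)))" for k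
    by (simp add: fls_X_intpow_times_conv_shift)
  show "fls_subdegree (fls_X_intpow n * fps_to_fls F) = n"
    by (rule fls_subdegree_eqI) (simp_all add: nth assms)
  show "fls_X_intpow n * fps_to_fls F \<noteq> (0 :: complex fls)"
  proof
    assume "fls_X_intpow n * fps_to_fls F = 0"
    thus False using nth[of n] assms by simp
  qed
qed

lemma subdegree_PF: "fls_subdegree PF = - 2"
  unfolding PF_def by (rule fls_subdegree_intpow_fps) (use fps_eq_upto_p0F in \<open>simp add: fps_eq_upto_def series_of_def\<close>)

lemma subdegree_SF: "fls_subdegree (HF + KF) = - 5"
proof -
  have h: "fls_subdegree HF = - 1" "HF \<noteq> 0"
    unfolding HF_def by (rule fls_subdegree_intpow_fps; use fps_eq_upto_h0F in \<open>simp add: fps_eq_upto_def series_of_def\<close>)+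
  have k: "fls_subdegree KF = - 5" "KF \<noteq> 0"
    unfolding KF_def by (rule fls_subdegree_intpow_fps; use fps_eq_upto_k0F in \<open>simp add: fps_eq_upto_def series_of_def\<close>)+
  show ?thesis using fls_subdegree_add_eq2[of KF HF] h k by simp
qed

lemma Tf_nonzero: "Tf \<noteq> 0"
proof
  assume "Tf = 0"
  hence "hf = kf" by (simp add: Tf_def)
  hence "HF = KF" using has_q_expansion_unique[of 1 hf HF KF] qexps by simp
  moreover have "fls_subdegree HF = - 1" unfolding HF_def
    by (rule fls_subdegree_intpow_fps) (use fps_eq_upto_h0F in \<open>simp add: fps_eq_upto_def series_of_def\<close>)
  moreover have "fls_subdegree KF = - 5" unfolding KF_def
    by (rule fls_subdegree_intpow_fps) (use fps_eq_upto_k0F in \<open>simp add: fps_eq_upto_def series_of_def\<close>)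
  ultimately show False by simp
qed

definition fev :: "complex fls \<Rightarrow> complex poly \<Rightarrow> complex fls" where
  "fev X A = poly (map_poly fls_const A) X"

lemma fev_0 [simp]: "fev X 0 = 0" by (simp add: fev_def)

lemma fev_pCons: "fev X (pCons a A) = fls_const a + X * fev X A"
  by (simp add: fev_def map_poly_pCons)

lemma has_q_expansion_pev:
  assumes "has_q_expansion h x X" "h > 0"
  shows "has_q_expansion h (pev x A) (fev X A)"
proof (induction A)
  case 0
  show ?case using has_q_expansion_cm[of h 0] by simp
next
  case (pCons a A)
  show ?case unfolding pev_pCons fev_pCons
    by (intro has_q_expansion_add has_q_expansion_mult has_q_expansion_cm assms pCons)
qed

text \<open>Since \<open>X\<close> has a pole, the pole of the leading term is strictly the largest
  and cannot cancel.\<close>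

lemma fls_subdegree_fev:
  assumes "fls_subdegree X < 0" "A \<noteq> 0"
  shows "fev X A \<noteq> 0 \<and> fls_subdegree (fev X A) = int (degree A) * fls_subdegree X"
  using assms(2)
proof (induction A)
  case (pCons a A)
  have X0: "X \<noteq> 0" using assms(1) by auto
  show ?case
  proof (cases "A = 0")
    case True
    thus ?thesis using pCons by (simp add: fev_pCons)
  next
    case False
    hence IH: "fev X A \<noteq> 0" "fls_subdegree (fev X A) = int (degree A) * fls_subdegree X"
      using pCons.IH by auto
    have sd: "fls_subdegree (X * fev X A) = int (degree (pCons a A)) * fls_subdegree X"
      using X0 IH False by (simp add: algebra_simps)
    also have "\<dots> < 0" using assms(1) False by (simp add: mult_pos_neg)
    finally have lt: "fls_subdegree (X * fev X A) < fls_subdegree (fls_const a)" by simp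
    have nz: "X * fev X A \<noteq> 0" using X0 IH(1) by simp
    have eq: "fls_subdegree (fev X (pCons a A)) = fls_subdegree (X * fev X A)"
      unfolding fev_pCons by (rule fls_subdegree_add_eq2[OF nz lt])
    have "fev X (pCons a A) \<noteq> 0"
    proof
      assume "fev X (pCons a A) = 0"
      thus False using eq lt by simp
    qed
    thus ?thesis using sd eq by simp
  qed
qed simp

text \<open>Parity: nonzero polynomials in \<open>x\<close> have even pole order, their products
  with \<open>Sf\<close> odd pole order. Any \<open>x\<close> with a double pole is allowed, so that
  the lemma applies to \<open>pf\<close> and to \<open>xf\<close>.\<close>

lemma pev_independent:
  assumes x: "has_q_expansion 1 x X" "fls_subdegree X = - 2"
    and rel: "pev x A + pev x B * Sf = 0"
  shows "A = 0 \<and> B = 0"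
proof -
  have "has_q_expansion 1 (pev x A + pev x B * Sf) (fev X A + fev X B * (HF + KF))"
    by (intro has_q_expansion_add has_q_expansion_mult has_q_expansion_pev x qexp_Sf) auto
  hence eq: "fev X A + fev X B * (HF + KF) = 0"
    using has_q_expansion_unique[of 1 0 _ 0] has_q_expansion_cm[of 1 0] rel by simp
  have neg: "fls_subdegree X < 0" using x(2) by simp
  have S0: "HF + KF \<noteq> 0" using subdegree_SF by auto
  have B: "B = 0"
  proof (rule ccontr)
    assume B: "B \<noteq> 0"
    have eq': "fev X A = - (fev X B * (HF + KF))" using eq by (simp add: eq_neg_iff_add_eq_0)
    have fB: "fev X B \<noteq> 0" "fls_subdegree (fev X B) = - 2 * int (degree B)"
      using fls_subdegree_fev[OF neg B] x(2) by auto
    have sd: "fls_subdegree (fev X A) = - 2 * int (degree B) - 5"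
      unfolding eq' fls_uminus_subdegree using fB S0 subdegree_SF by simp
    have "A \<noteq> 0"
    proof
      assume "A = 0"
      hence "fev X B * (HF + KF) = 0" using eq by simp
      thus False using fB(1) S0 by simp
    qed
    hence "fls_subdegree (fev X A) = - 2 * int (degree A)"
      using fls_subdegree_fev[OF neg] x(2) by auto
    with sd have "2 * int (degree A) = 2 * int (degree B) + 5" by simp
    thus False by presburger
  qed
  have "A = 0"
    using eq fls_subdegree_fev[OF neg, of A] B by auto
  thus ?thesis using B by simp
qed

text \<open>Gaussian elimination, by induction on the number of equations: the last one either is
  trivial or expresses one unknown \<open>j0\<close> by the others.\<close>

lemma underdetermined_system:
  fixes M :: "nat \<Rightarrow> 'j \<Rightarrow> 'a :: field"
  assumes "finite J" "n < card J"
  shows "\<exists>c. (\<exists>j\<in>J. c j \<noteq> 0) \<and> (\<forall>i<n. (\<Sum>j\<in>J. M i j * c j) = 0)"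
  using assms
proof (induction n arbitrary: J M)
  case 0
  then obtain j where "j \<in> J" by fastforce
  thus ?case by (intro exI[of _ "\<lambda>_. 1"]) auto
next
  case (Suc n)
  show ?case
  proof (cases "\<forall>j\<in>J. M n j = 0")
    case True
    obtain c where "\<exists>j\<in>J. c j \<noteq> 0" "\<forall>i<n. (\<Sum>j\<in>J. M i j * c j) = 0"
      using Suc.IH[of J M] Suc.prems by auto
    thus ?thesis using True by (intro exI[of _ c]) (auto simp: less_Suc_eq)
  next
    case False
    then obtain j0 where j0: "j0 \<in> J" "M n j0 \<noteq> 0" by blast
    define J' where "J' = J - {j0}"
    have J': "finite J'" "n < card J'" "J = insert j0 J'" "j0 \<notin> J'"
      using Suc.prems j0 by (auto simp: J'_def)
    obtain c where c: "\<exists>j\<in>J'. c j \<noteq> 0"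
      "\<forall>i<n. (\<Sum>j\<in>J'. (M i j - M i j0 * M n j / M n j0) * c j) = 0"
      using Suc.IH[of J' "\<lambda>i j. M i j - M i j0 * M n j / M n j0"] J' by auto
    \<comment> \<open>The value that equation \<open>n\<close> dictates for the unknown
      \<open>j0\<close>.\<close>
    define s where "s = - (\<Sum>j\<in>J'. M n j * c j) / M n j0"
    define c' where "c' = c(j0 := s)"
    have sum: "(\<Sum>j\<in>J. M i j * c' j) = M i j0 * s + (\<Sum>j\<in>J'. M i j * c j)" for i
    proof -
      have "(\<Sum>j\<in>J'. M i j * c' j) = (\<Sum>j\<in>J'. M i j * c j)"
        using J'(4) by (intro sum.cong) (auto simp: c'_def)
      thus ?thesis using J' by (simp add: c'_def)
    qed
    have "(\<Sum>j\<in>J. M i j * c' j) = 0" if "i < Suc n" for i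
    proof (cases "i = n")
      case True
      thus ?thesis using j0(2) by (simp add: sum s_def)
    next
      case False
      hence "0 = (\<Sum>j\<in>J'. (M i j - M i j0 * M n j / M n j0) * c j)" using c(2) that by simp
      also have "\<dots> = (\<Sum>j\<in>J'. M i j * c j) - (M i j0 / M n j0) * (\<Sum>j\<in>J'. M n j * c j)"
      proof -
        have "(M i j - M i j0 * M n j / M n j0) * c j = M i j * c j - (M i j0 / M n j0) * (M n j * c j)" for j
          by (simp add: left_diff_distrib)
        thus ?thesis by (simp only: sum_subtractf sum_distrib_left)
      qed
      also have "\<dots> = (\<Sum>j\<in>J. M i j * c' j)"
        by (simp add: sum s_def)
      finally show ?thesis by simp
    qed
    moreover have "\<exists>j\<in>J. c' j \<noteq> 0" using c(1) J' by (auto simp: c'_def)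
    ultimately show ?thesis by blast
  qed
qed

lemma reg_has_q_expansion:
  assumes "reg f"
  shows "\<exists>F. has_q_expansion 1 f F"
proof (rule mod_growth_imp_has_q_expansion)
  have f: "f \<in> X0_functions_complex 45" using assms by (simp add: reg_def)
  have inv: "gamma0_invariant 45 f" by (rule X0c_invariant[OF f])
  have "pullback 1 0 0 1 f = f" using inv by (simp add: gamma0_invariant_def)
  moreover have "mod_growth (pullback 1 0 0 1 f)" using f X0_functions_complex_iff[of 45 f] by auto
  ultimately show "mod_growth f" by simp
  have T: "pullback 1 1 0 1 f = f" using inv by (simp add: gamma0_invariant_def)
  show "eval_uhp f (z + of_nat 1) = eval_uhp f z" if "z \<in> uhp" for z
    using eval_pullback_upper[of 1 1 z 1 f] that by (simp add: T)
qed simp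

lemma fls_nth_sum: "fls_nth (\<Sum>i\<in>I. F i) n = (\<Sum>i\<in>I. fls_nth (F i) n)"
  by (induction I rule: infinite_finite_induct) auto

lemma fls_subdegree_power_ge:
  fixes X :: "complex fls"
  assumes "k < int n * fls_subdegree X"
  shows "fls_nth (X ^ n) k = 0"
  using assms by (simp add: fls_pow_nth_below_subdegree)

lemma fls_mult_nth_below:
  fixes F G :: "complex fls"
  assumes "\<And>i. i < a \<Longrightarrow> fls_nth F i = 0" "\<And>i. i < b \<Longrightarrow> fls_nth G i = 0" "n < a + b"
  shows "fls_nth (F * G) n = 0"
proof (cases "F = 0 \<or> G = 0")
  case False
  hence "a \<le> fls_subdegree F" "b \<le> fls_subdegree G" using assms by (auto intro!: fls_subdegree_geI)
  thus ?thesis using assms(3) by (intro fls_times_nth_eq0) auto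
qed auto

text \<open>Linear algebra in place of Riemann-Roch. The numbers of powers of \<open>pf\<close> are
  balanced against the pole order \<open>2n\<close> allowed for \<open>g\<close>: the highest
  functions \<open>pf ^ 2 * g\<close>, \<open>pf ^ (n + 2)\<close> and
  \<open>pf ^ (n - 1) * Sf\<close> have poles of order at most \<open>2n + 4\<close>,
  \<open>2n + 4\<close> and \<open>2n + 3\<close>.\<close>

theorem reg_rational_in_pf:
  assumes g: "reg g"
  shows "\<exists>D A B. D \<noteq> 0 \<and> pev pf D * g = pev pf A + pev pf B * Sf"
proof -
  obtain G where G: "has_q_expansion 1 g G" using reg_has_q_expansion[OF g] by blast
  define n where "n = nat (- fls_subdegree G)"
  have Gn: "fls_nth G i = 0" if "i < - 2 * int n" for i
    using that unfolding n_def by (intro fls_eq0_below_subdegree) linarith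
  \<comment> \<open>\<open>2n + 6\<close> functions with poles of order at most \<open>2n + 4\<close> at \<open>\<infinity>\<close>, so some nontrivial
    combination of them has no principal part and no constant term.\<close>
  define J :: "(nat + nat + nat) set" where "J = {..<3} <+> ({..<n + 3} <+> {..<n})"
  define v where "v = case_sum (\<lambda>i. pf ^ i * g) (case_sum (\<lambda>i. pf ^ i) (\<lambda>i. pf ^ i * Sf))"
  define V where "V = case_sum (\<lambda>i. PF ^ i * G) (case_sum (\<lambda>i. PF ^ i) (\<lambda>i. PF ^ i * (HF + KF)))"
  have finJ: "finite J" by (simp add: J_def)
  have cardJ: "card J = 2 * n + 6" by (simp add: J_def card_Plus)
  have P: "fls_nth (PF ^ i) k = 0" if "k < - 2 * int i" for i k
    using that by (intro fls_subdegree_power_ge) (simp add: subdegree_PF)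
  have S: "fls_nth (HF + KF) k = 0" if "k < - 5" for k
    using that subdegree_SF by (intro fls_eq0_below_subdegree) simp
  have low: "fls_nth (V j) k = 0" if "j \<in> J" "k < - int (2 * n + 4)" for j k
    using that by (auto simp: J_def V_def intro!: P fls_mult_nth_below[OF P Gn] fls_mult_nth_below[OF P S])
  have reg_v: "reg (v j)" for j
    by (auto simp: v_def split: sum.split intro!: reg_mult reg_power reg_pf reg_Sf g)
  have qv: "has_q_expansion 1 (v j) (V j)" for j
    by (auto simp: v_def V_def simp del: One_nat_def split: sum.split
         intro!: has_q_expansion_mult has_q_expansion_power qexps qexp_Sf G)
  obtain c where c: "\<exists>j\<in>J. c j \<noteq> 0" "\<forall>i<2 * n + 5. (\<Sum>j\<in>J. fls_nth (V j) (- int i) * c j) = 0"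
    using underdetermined_system[OF finJ, of "2 * n + 5" "\<lambda>i j. fls_nth (V j) (- int i)"] cardJ by auto
  have sum0: "(\<Sum>j\<in>J. cm (c j) * v j) = 0"
  proof (rule reg_eq_0)
    show "reg (\<Sum>j\<in>J. cm (c j) * v j)" by (intro reg_sum reg_mult reg_cm reg_v)
    show "has_q_expansion 1 (\<Sum>j\<in>J. cm (c j) * v j) (\<Sum>j\<in>J. fls_const (c j) * V j)"
      by (intro has_q_expansion_sum has_q_expansion_mult has_q_expansion_cm qv zero_less_one)
    fix k :: int assume k: "k \<le> 0"
    have "fls_nth (\<Sum>j\<in>J. fls_const (c j) * V j) k = (\<Sum>j\<in>J. fls_nth (V j) k * c j)"
      by (simp add: fls_nth_sum mult.commute)
    also have "\<dots> = 0"
    proof (cases "nat (- k) < 2 * n + 5")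
      case True
      hence "(\<Sum>j\<in>J. fls_nth (V j) (- int (nat (- k))) * c j) = 0" using c(2) by blast
      moreover have "- int (nat (- k)) = k" using k by simp
      ultimately show ?thesis by simp
    next
      case False
      hence "k < - int (2 * n + 4)" using k by linarith
      thus ?thesis using low by simp
    qed
    finally show "fls_nth (\<Sum>j\<in>J. fls_const (c j) * V j) k = 0" .
  qed
  define D where "D = (\<Sum>i<3. monom (c (Inl i)) i)"
  define A where "A = (\<Sum>i<n + 3. monom (c (Inr (Inl i))) i)"
  define B where "B = (\<Sum>i<n. monom (c (Inr (Inr i))) i)"
  have "(\<Sum>j\<in>J. cm (c j) * v j) = pev pf D * g + (pev pf A + pev pf B * Sf)"
    unfolding J_def D_def A_def B_def
    by (simp add: sum.Plus v_def pev_sum pev_monom sum_distrib_left sum_distrib_right mult_ac)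
  hence rel: "pev pf D * g + (pev pf A + pev pf B * Sf) = 0" using sum0 by simp
  \<comment> \<open>If \<open>D\<close> vanished, the relation would involve \<open>pf\<close> and
    \<open>Sf\<close> alone, and \<open>pev_independent\<close> would annihilate every
    coefficient.\<close>
  have "D \<noteq> 0"
  proof
    assume D0: "D = 0"
    hence "A = 0" "B = 0" using rel pev_independent[OF qexps(1) subdegree_PF, of A B] by auto
    have co: "m < k \<Longrightarrow> coeff (\<Sum>i<k. monom (f i) i) m = f m" for k m and f :: "nat \<Rightarrow> complex"
      by (simp add: coeff_sum)
    have "c j = 0" if "j \<in> J" for j
    proof -
      from that consider i where "j = Inl i" "i < 3" | i where "j = Inr (Inl i)" "i < n + 3"
        | i where "j = Inr (Inr i)" "i < n" by (auto simp: J_def)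
      thus ?thesis
      proof cases
        case 1
        thus ?thesis using co[of i 3 "\<lambda>i. c (Inl i)"] D0 by (simp add: D_def)
      next
        case 2
        thus ?thesis using co[of i "n + 3" "\<lambda>i. c (Inr (Inl i))"] \<open>A = 0\<close> by (simp add: A_def)
      next
        case 3
        thus ?thesis using co[of i n "\<lambda>i. c (Inr (Inr i))"] \<open>B = 0\<close> by (simp add: B_def)
      qed
    qed
    thus False using c(1) by blast
  qed
  moreover have "pev pf D * g = pev pf (- A) + pev pf (- B) * Sf"
  proof -
    have neg: "pev pf (- A) = - pev pf A" "pev pf (- B) = - pev pf B"
      using pev_smult[of pf "-1"] by (simp_all add: cm_minus)
    have "pev pf D * g = - (pev pf A + pev pf B * Sf)"
      using rel by (simp only: eq_neg_iff_add_eq_0 add.assoc)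
    thus ?thesis unfolding neg by simp
  qed
  ultimately show ?thesis by blast
qed

text \<open>The matrix of \<open>w5\<close> normalises \<open>\<Gamma>\<^sub>0(45)\<close>. For the
  cusps it is written as a matrix of determinant 1 times \<open>diag(5, 1)\<close>, and
  \<open>hecke_decomposition\<close> turns \<open>diag(5, 1)\<close> times the given matrix into a
  matrix of determinant 1 times an upper triangular one.\<close>

lemma X0c_w5:
  assumes "f \<in> X0_functions_complex 45"
  shows "w5 f \<in> X0_functions_complex 45"
  unfolding X0_functions_complex_iff[OF zero_less_numeral] gamma0_invariant_def
proof (intro conjI allI impI)
  have f: "gamma0_invariant 45 f" "\<And>a b c d. a * d - b * c = 1 \<Longrightarrow> mod_growth (pullback a b c d f)"
    using assms X0_functions_complex_iff[of 45 f] by auto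
  {
    fix a b c d :: int assume *: "a * d - b * c = 1 \<and> int 45 dvd c"
    then obtain e where e: "c = 45 * e" by auto
    have det: "a * d - b * (45 * e) = 1" using * e by simp
    \<comment> \<open>Entries of the given matrix conjugated by that of \<open>w5\<close>;
      \<open>B\<close> is integral because \<open>45 dvd c\<close>.\<close>
    define A B C D where "A = 10 * a + c - 90 * b - 9 * d" and "B = - 2 * a - 9 * e + 20 * b + 2 * d"
      and "C = 45 * a + 5 * c - 405 * b - 45 * d" and "D = - 9 * a - c + 90 * b + 10 * d"
    have "A * D - B * C = a * d - b * (45 * e)"
      by (simp add: A_def B_def C_def D_def e algebra_simps)
    hence detD: "A * D - B * C = 1" using det by simp
    have "int 45 dvd C" by (simp add: C_def e)
    hence inv: "pullback A B C D f = f"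
      using f(1) detD unfolding gamma0_invariant_def by blast
    have "pullback a b c d (w5 f) = pullback (10 * a + 1 * c) (10 * b + 1 * d) (45 * a + 5 * c) (45 * b + 5 * d) f"
      unfolding w5_def by (rule pullback_pullback) (use * in auto)
    also have "10 * a + 1 * c = A * 10 + B * 45" by (simp add: A_def B_def e)
    also have "10 * b + 1 * d = A * 1 + B * 5" by (simp add: A_def B_def e)
    also have "45 * a + 5 * c = C * 10 + D * 45" by (simp add: C_def D_def e)
    also have "45 * b + 5 * d = C * 1 + D * 5" by (simp add: C_def D_def e)
    also have "pullback (A * 10 + B * 45) (A * 1 + B * 5) (C * 10 + D * 45) (C * 1 + D * 5) f = w5 (pullback A B C D f)"
      unfolding w5_def by (rule pullback_pullback[symmetric]) (use detD in auto)
    finally show "pullback a b c d (w5 f) = w5 f" by (simp add: inv)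
  }
  fix a b c d :: int assume det: "a * d - b * c = 1"
  obtain a' b' c' d' \<alpha> \<beta> \<delta> where
    *: "a' * d' - b' * c' = 1" "\<alpha> > 0" "\<delta> > 0"
    "\<forall>z\<in>uhp. of_int 5 * moebius_map a b c d z = moebius_map a' b' c' d' (moebius_map \<alpha> \<beta> 0 \<delta> z)"
    using hecke_decomposition[OF det, of 5] by (metis zero_less_numeral)
  \<comment> \<open>The factorisation is
    \<open>(10, 1; 45, 5) = (2, 1; 9, 5) (5, 0; 0, 1)\<close>.\<close>
  let ?f0 = "pullback 2 1 9 5 f"
  have w5: "w5 f = pullback 5 0 0 1 ?f0"
    unfolding w5_def using pullback_pullback[of 2 5 1 9 5 1 0 0 f] by simp
  have "pullback a b c d (w5 f) = pullback \<alpha> \<beta> 0 \<delta> (pullback a' b' c' d' ?f0)"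
  proof (rule mero_uhp_eqI)
    have "eval_uhp (pullback a b c d (w5 f)) z = eval_uhp (pullback \<alpha> \<beta> 0 \<delta> (pullback a' b' c' d' ?f0)) z"
      if z: "z \<in> uhp" for z
    proof -
      have gz: "moebius_map a b c d z \<in> uhp" by (rule moebius_in_uhp) (use det z in auto)
      have uz: "moebius_map \<alpha> \<beta> 0 \<delta> z \<in> uhp" by (rule moebius_in_uhp) (use *(2,3) z in auto)
      have "eval_uhp (pullback a b c d (w5 f)) z = eval_uhp (w5 f) (moebius_map a b c d z)"
        by (rule eval_pullback) (use det z in auto)
      also have "\<dots> = eval_uhp ?f0 (5 * moebius_map a b c d z)"
        unfolding w5 using eval_pullback[of 5 1 0 0 _ ?f0, OF _ gz] by (simp add: moebius_map_def[of 5 0 0 1])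
      also have "5 * moebius_map a b c d z = moebius_map a' b' c' d' (moebius_map \<alpha> \<beta> 0 \<delta> z)"
        using *(4) z by simp
      also have "eval_uhp ?f0 \<dots> = eval_uhp (pullback a' b' c' d' ?f0) (moebius_map \<alpha> \<beta> 0 \<delta> z)"
        by (rule eval_pullback[symmetric]) (use *(1) uz in auto)
      also have "\<dots> = eval_uhp (pullback \<alpha> \<beta> 0 \<delta> (pullback a' b' c' d' ?f0)) z"
        by (rule eval_pullback[symmetric]) (use *(2,3) z in auto)
      finally show ?thesis .
    qed
    thus "\<forall>\<^sub>\<approx>z\<in>uhp. eval_uhp (pullback a b c d (w5 f)) z = eval_uhp (pullback \<alpha> \<beta> 0 \<delta> (pullback a' b' c' d' ?f0)) z"
      using eventually_in_uhp by (auto elim: eventually_mono)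
  qed
  moreover have "pullback a' b' c' d' ?f0 = pullback (2 * a' + 1 * c') (2 * b' + 1 * d') (9 * a' + 5 * c') (9 * b' + 5 * d') f"
    by (rule pullback_pullback) (use *(1) in auto)
  moreover have "(2 * a' + 1 * c') * (9 * b' + 5 * d') - (2 * b' + 1 * d') * (9 * a' + 5 * c') = 1"
    using *(1) by (simp add: algebra_simps)
  ultimately show "mod_growth (pullback a b c d (w5 f))"
    using f(2) mod_growth_pullback_upper *(2,3) by metis
qed

lemma w5_w5:
  assumes "f \<in> X0_functions_complex 45"
  shows "w5 (w5 f) = f"
proof -
  \<comment> \<open>The square of the matrix is 5 times a matrix of
    \<open>\<Gamma>\<^sub>0(45)\<close>.\<close>
  have "w5 (w5 f) = pullback 145 15 675 70 f"
    unfolding w5_def using pullback_pullback[of 10 5 1 45 10 5 1 45 f] by simp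
  also have "\<dots> = pullback 29 3 135 14 f"
  proof -
    have "moebius_map 145 15 675 70 = moebius_map 29 3 135 14"
    proof
      fix z :: complex
      have "moebius_map 145 15 675 70 z = (5 * (29 * z + 3)) / (5 * (135 * z + 14))"
        by (simp add: moebius_map_def algebra_simps)
      thus "moebius_map 145 15 675 70 z = moebius_map 29 3 135 14 z"
        by (simp only: mult_divide_mult_cancel_left_if) (simp add: moebius_map_def)
    qed
    thus ?thesis by (simp add: pullback_def)
  qed
  also have "\<dots> = f" using X0c_invariant[OF assms] by (simp add: gamma0_invariant_def)
  finally show ?thesis .
qed

section \<open>Descent to \<open>\<rat>\<close>\<close>

text \<open>The independent set consisting of \<open>c\<close> extends to a basis of the complex
  numbers over \<open>\<rat>\<close>.\<close>

lemma rat_linear_functional: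
  assumes "c \<noteq> (0 :: complex)"
  shows "\<exists>\<phi> :: complex \<Rightarrow> rat. (\<forall>x y. \<phi> (x + y) = \<phi> x + \<phi> y) \<and> (\<forall>r x. \<phi> (of_rat r * x) = r * \<phi> x) \<and> \<phi> c = 1"
proof -
  interpret V: vector_space_pair "\<lambda>(r::rat) (x::complex). of_rat r * x" "\<lambda>(r::rat) (x::rat). r * x"
    by unfold_locales (auto simp: algebra_simps of_rat_add of_rat_mult)
  have "V.vs1.independent {c}" using assms by simp
  then obtain g where "Vector_Spaces.linear (\<lambda>(r::rat) (x::complex). of_rat r * x) (\<lambda>(r::rat) (x::rat). r * x) g" "g c = 1"
    using V.linear_independent_extend[of "{c}" "\<lambda>_. 1"] by auto
  thus ?thesis
    by (intro exI[of _ g]) (auto simp: Vector_Spaces.linear_iff)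
qed

text \<open>A \<open>\<rat>\<close>-linear map applied to each coefficient of the relation between
  expansions commutes with the rational coefficients of the \<open>u j\<close>, so it replaces the
  constants \<open>c j\<close> by rational ones. Its normalisation at \<open>c j0\<close> keeps the
  relation nontrivial.\<close>

lemma rational_dependence:
  assumes J: "finite J" and u: "\<And>j. j \<in> J \<Longrightarrow> u j \<in> X0_functions_rat N"
    and dep: "(\<Sum>j\<in>J. cm (c j) * u j) = 0" and j0: "c j0 \<noteq> 0"
  shows "\<exists>r :: 'j \<Rightarrow> rat. r j0 = 1 \<and> (\<Sum>j\<in>J. of_rat (r j) * u j) = 0"
proof -
  have "\<forall>j\<in>J. \<exists>U. has_q_expansion 1 (u j) U \<and> rat_fls U" using u by (auto simp: X0_rat_iff)
  from bchoice[OF this] obtain U where U: "\<forall>j\<in>J. has_q_expansion 1 (u j) (U j) \<and> rat_fls (U j)" by blast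
  have "\<forall>j\<in>J. \<forall>n. \<exists>r. fls_nth (U j) n = of_rat r" using U unfolding rat_fls_def Rats_def by blast
  then obtain R where R: "\<And>j n. j \<in> J \<Longrightarrow> fls_nth (U j) n = of_rat (R j n)" by metis
  obtain \<phi> :: "complex \<Rightarrow> rat" where phi: "\<And>x y. \<phi> (x + y) = \<phi> x + \<phi> y" "\<And>r x. \<phi> (of_rat r * x) = r * \<phi> x" "\<phi> (c j0) = 1"
    using rat_linear_functional[OF j0] by blast
  have phi0: "\<phi> 0 = 0" using phi(1)[of 0 0] by simp
  have phi_sum: "\<phi> (\<Sum>j\<in>J. g j) = (\<Sum>j\<in>J. \<phi> (g j))" for g
    using J by (induction J rule: finite_induct) (auto simp: phi0 phi(1))
  have "has_q_expansion 1 (\<Sum>j\<in>J. cm (c j) * u j) (\<Sum>j\<in>J. fls_const (c j) * U j)"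
    using U by (intro has_q_expansion_sum has_q_expansion_mult has_q_expansion_cm) auto
  hence eq: "(\<Sum>j\<in>J. fls_const (c j) * U j) = 0"
    using has_q_expansion_unique[of 1 0 _ 0] has_q_expansion_cm[of 1 0] dep by simp
  have "(\<Sum>j\<in>J. fls_const (of_rat (\<phi> (c j))) * U j) = 0"
  proof (rule fls_eqI)
    fix n
    have "(\<Sum>j\<in>J. of_rat (R j n) * c j) = fls_nth (\<Sum>j\<in>J. fls_const (c j) * U j) n"
      using R by (simp add: fls_nth_sum mult.commute)
    hence "\<phi> (\<Sum>j\<in>J. of_rat (R j n) * c j) = 0" by (simp add: eq phi0)
    hence "(\<Sum>j\<in>J. R j n * \<phi> (c j)) = 0" by (simp add: phi_sum phi(2))
    hence "of_rat (\<Sum>j\<in>J. R j n * \<phi> (c j)) = (0 :: complex)" by simp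
    thus "fls_nth (\<Sum>j\<in>J. fls_const (of_rat (\<phi> (c j))) * U j) n = fls_nth 0 n"
      using R by (simp add: fls_nth_sum of_rat_sum of_rat_mult mult.commute)
  qed
  moreover have "has_q_expansion 1 (\<Sum>j\<in>J. cm (of_rat (\<phi> (c j))) * u j) (\<Sum>j\<in>J. fls_const (of_rat (\<phi> (c j))) * U j)"
    using U by (intro has_q_expansion_sum has_q_expansion_mult has_q_expansion_cm) auto
  ultimately have "(\<Sum>j\<in>J. cm (of_rat (\<phi> (c j))) * u j) = 0"
    using has_q_expansion_0_imp by fastforce
  thus ?thesis using phi(3) by (intro exI[of _ "\<lambda>j. \<phi> (c j)"]) (simp add: cm_of_rat)
qed

lemma even_rational_in_pf:
  assumes "f \<in> X0_functions_complex 45" "w5 f = f"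
  shows "\<exists>D A B. D \<noteq> 0 \<and> pev pf D * f = pev pf A + pev pf B * Sf"
proof -
  obtain D1 where D1: "D1 \<noteq> 0" "reg (pev pf D1 * f)"
    using kill_all_poles[OF assms] by blast
  obtain D2 A B where "D2 \<noteq> 0" "pev pf D2 * (pev pf D1 * f) = pev pf A + pev pf B * Sf"
    using reg_rational_in_pf[OF D1(2)] by blast
  thus ?thesis using D1(1) by (intro exI[of _ "D2 * D1"] exI[of _ A] exI[of _ B]) (simp add: pev_mult mult_ac)
qed

lemma pev_altdef: "degree D \<le> d \<Longrightarrow> pev x D = (\<Sum>i\<le>d. cm (coeff D i) * x ^ i)"
  using pev_sum[of x "\<lambda>i. monom (coeff D i) i" "{..d}"] by (simp add: poly_as_sum_of_monoms' pev_monom)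

lemma w5_Sf: "w5 Sf = Sf" by (simp add: Sf_def w5_add w5_hf w5_kf add.commute)
lemma w5_Tf: "w5 Tf = - Tf" by (simp add: Tf_def w5_diff w5_hf w5_kf)

lemma rat_adjoin_diff: "u \<in> rat_adjoin S \<Longrightarrow> v \<in> rat_adjoin S \<Longrightarrow> u - v \<in> rat_adjoin S"
  using rat_adjoin.add[OF _ rat_adjoin.uminus] by fastforce

lemma rat_adjoin_divide: "u \<in> rat_adjoin S \<Longrightarrow> v \<in> rat_adjoin S \<Longrightarrow> u / v \<in> rat_adjoin S"
  unfolding divide_inverse by (intro rat_adjoin.mult rat_adjoin.inverse)

lemma rat_adjoin_0: "0 \<in> rat_adjoin S" using rat_adjoin.rat[of 0] by simp
lemma rat_adjoin_1: "1 \<in> rat_adjoin S" using rat_adjoin.rat[of 1] by simp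
lemma rat_adjoin_numeral: "numeral n \<in> rat_adjoin S" using rat_adjoin.rat[of "numeral n"] by simp

lemma rat_adjoin_power: "u \<in> rat_adjoin S \<Longrightarrow> u ^ n \<in> rat_adjoin S"
  by (induction n) (auto intro: rat_adjoin_1 rat_adjoin.mult)

lemma rat_adjoin_sum: "(\<And>i. i \<in> I \<Longrightarrow> f i \<in> rat_adjoin S) \<Longrightarrow> (\<Sum>i\<in>I. f i) \<in> rat_adjoin S"
  by (induction I rule: infinite_finite_induct) (auto intro: rat_adjoin_0 rat_adjoin.add)

lemma rat_adjoin_subset:
  assumes "S \<subseteq> rat_adjoin S'"
  shows "rat_adjoin S \<subseteq> rat_adjoin S'"
proof
  fix u assume "u \<in> rat_adjoin S"
  thus "u \<in> rat_adjoin S'"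
    by induction (use assms in \<open>auto intro: rat_adjoin.intros\<close>)
qed

lemma X0_rat_add: "f \<in> X0_functions_rat N \<Longrightarrow> g \<in> X0_functions_rat N \<Longrightarrow> N > 0 \<Longrightarrow> f + g \<in> X0_functions_rat N"
  by (rule subsetD[OF rat_adjoin_subset_X0_rat[of "{f, g}" N]]) (auto intro: rat_adjoin.intros)

lemma X0_rat_mult: "f \<in> X0_functions_rat N \<Longrightarrow> g \<in> X0_functions_rat N \<Longrightarrow> N > 0 \<Longrightarrow> f * g \<in> X0_functions_rat N"
  by (rule subsetD[OF rat_adjoin_subset_X0_rat[of "{f, g}" N]]) (auto intro: rat_adjoin.intros)

lemma X0_rat_power: "f \<in> X0_functions_rat N \<Longrightarrow> N > 0 \<Longrightarrow> f ^ n \<in> X0_functions_rat N"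
  by (rule subsetD[OF rat_adjoin_subset_X0_rat[of "{f}" N]]) (auto intro: rat_adjoin.base rat_adjoin_power)

lemma X0_rat_1: "N > 0 \<Longrightarrow> 1 \<in> X0_functions_rat N"
  using rat_adjoin_subset_X0_rat[of "{}" N] rat_adjoin_1 by auto

lemma Sf_rat: "Sf \<in> X0_functions_rat 45"
  unfolding Sf_def by (intro X0_rat_add hf_rat kf_rat) simp

lemma Tf_rat: "Tf \<in> X0_functions_rat 45"
  using rat_adjoin_subset_X0_rat[of "{hf, kf}" 45] hf_rat kf_rat
  by (auto simp: Tf_def intro: rat_adjoin_diff rat_adjoin.base)

text \<open>Half the sum and half the difference of \<open>f\<close> and \<open>w5 f\<close> are
  treated separately; the second is \<open>Tf\<close> times an invariant function. Clearing
  denominators gives a complex linear relation among powers of \<open>pf\<close> times the five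
  functions in \<open>w\<close>, all with rational expansions, to which
  \<open>rational_dependence\<close> applies.\<close>

theorem X0_rat_decomposition:
  assumes f: "f \<in> X0_functions_rat 45"
  shows "\<exists>u\<in>rat_adjoin {pf, Sf}. \<exists>v\<in>rat_adjoin {pf, Sf}. f = u + Tf * v"
proof -
  have fc: "f \<in> X0_functions_complex 45" and Tc: "Tf \<in> X0_functions_complex 45"
    using f Tf_rat by (auto simp: X0_rat_iff)
  define f1 where "f1 = cm (1 / 2) * (f + w5 f)"
  define f2 where "f2 = cm (1 / 2) * (f - w5 f) * inverse Tf"
  have "f1 \<in> X0_functions_complex 45" "f2 \<in> X0_functions_complex 45"
    unfolding f1_def f2_def by (intro X0c_mult X0c_cm X0c_add X0c_diff X0c_inverse X0c_w5 fc Tc; simp)+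
  moreover have "w5 f1 = f1" "w5 f2 = f2"
    by (simp_all add: f1_def f2_def w5_mult w5_cm w5_add w5_diff w5_inverse w5_Tf w5_w5[OF fc] algebra_simps)
  ultimately obtain D1 A1 B1 D2 A2 B2 where
    D: "D1 \<noteq> 0" "pev pf D1 * f1 = pev pf A1 + pev pf B1 * Sf"
       "D2 \<noteq> 0" "pev pf D2 * f2 = pev pf A2 + pev pf B2 * Sf"
    using even_rational_in_pf by metis
  have half: "cm (1 / 2) + cm (1 / 2) = 1" by (simp flip: cm_add)
  have "f1 + Tf * f2 = (cm (1 / 2) + cm (1 / 2)) * f"
  proof -
    have "Tf * f2 = cm (1 / 2) * (f - w5 f)" using Tf_nonzero by (simp add: f2_def)
    thus ?thesis by (simp add: f1_def algebra_simps)
  qed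
  hence f12: "f = f1 + Tf * f2" using half by simp
  define L where "L k = [D1 * D2, - (D2 * A1), - (D2 * B1), - (D1 * A2), - (D1 * B2)] ! k" for k :: nat
  define w where "w k = [f, 1, Sf, Tf, Tf * Sf] ! k" for k :: nat
  define d where "d = Max ((\<lambda>k. degree (L k)) ` {..<5})"
  have deg: "degree (L k) \<le> d" if "k < 5" for k
    unfolding d_def using that by (intro Max_ge) auto
  have set5: "{..<5} = {0, 1, 2, 3, 4 :: nat}" by auto
  have neg: "pev pf (- A) = - pev pf A" for A
    using pev_smult[of pf "-1" A] by (simp add: cm_minus)
  have "pev pf (D1 * D2) * f = pev pf D2 * (pev pf D1 * f1) + Tf * (pev pf D1 * (pev pf D2 * f2))"
    by (simp add: f12 pev_mult algebra_simps)
  hence rel: "(\<Sum>k<5. pev pf (L k) * w k) = 0"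
    unfolding D by (simp add: set5 L_def w_def neg pev_mult algebra_simps)
  define J where "J = {..<5::nat} \<times> {..d}"
  define u where "u = (\<lambda>(k, i). pf ^ i * w k)"
  define c where "c = (\<lambda>(k, i). coeff (L k) i)"
  have dep: "(\<Sum>j\<in>J. cm (c j) * u j) = 0"
  proof -
    have "(\<Sum>j\<in>J. cm (c j) * u j) = (\<Sum>k<5. \<Sum>i\<le>d. cm (coeff (L k) i) * (pf ^ i * w k))"
      by (simp add: J_def sum.cartesian_product c_def u_def case_prod_beta)
    also have "\<dots> = (\<Sum>k<5. pev pf (L k) * w k)"
      using deg by (intro sum.cong) (auto simp: pev_altdef[of _ d] sum_distrib_right mult.assoc)
    finally show ?thesis using rel by simp
  qed
  have wrat: "w k \<in> X0_functions_rat 45" if "k < 5" for k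
  proof -
    have "k \<in> {0, 1, 2, 3, 4}" using that by auto
    thus ?thesis using f X0_rat_1[of 45] Sf_rat Tf_rat X0_rat_mult[OF Tf_rat Sf_rat] by (auto simp: w_def)
  qed
  have urat: "u j \<in> X0_functions_rat 45" if "j \<in> J" for j
    using that wrat by (auto simp: J_def u_def intro!: X0_rat_mult X0_rat_power pf_rat)
  \<comment> \<open>The coefficient to be normalised to 1 is the leading one of
    \<open>D1 * D2\<close>, so the new multiplier \<open>q 0\<close> of \<open>f\<close> is a
    nonzero polynomial in \<open>pf\<close>.\<close>
  have c0: "c (0, degree (D1 * D2)) \<noteq> 0"
    using leading_coeff_0_iff[of "D1 * D2"] D(1,3) unfolding c_def L_def by simp
  have finJ: "finite J" by (simp add: J_def)
  from rational_dependence[OF finJ urat dep c0] obtain r :: "nat \<times> nat \<Rightarrow> rat" where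
    r: "r (0, degree (D1 * D2)) = 1" "(\<Sum>j\<in>J. of_rat (r j) * u j) = 0" by blast
  define q where "q k = (\<Sum>i\<le>d. of_rat (r (k, i)) * pf ^ i)" for k
  have "(\<Sum>j\<in>J. of_rat (r j) * u j) = (\<Sum>k<5. \<Sum>i\<le>d. of_rat (r (k, i)) * (pf ^ i * w k))"
    by (simp add: J_def sum.cartesian_product u_def case_prod_beta)
  also have "\<dots> = (\<Sum>k<5. q k * w k)"
    by (simp add: q_def sum_distrib_right mult.assoc)
  finally have "q 0 * f + (q 1 + q 2 * Sf + Tf * (q 3 + q 4 * Sf)) = 0"
    using r(2) by (simp add: set5 w_def algebra_simps)
  hence "q 0 * f = - (q 1 + q 2 * Sf + Tf * (q 3 + q 4 * Sf))"
    by (simp only: eq_neg_iff_add_eq_0)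
  hence eq: "q 0 * f = - (q 1 + q 2 * Sf) + Tf * - (q 3 + q 4 * Sf)"
    by (simp only: minus_add_distrib[of "q 1 + q 2 * Sf"] mult_minus_right)
  have q0: "q 0 \<noteq> 0"
  proof
    assume q0: "q 0 = 0"
    define Q where "Q = (\<Sum>i\<le>d. monom (of_rat (r (0, i)) :: complex) i)"
    have "pev pf Q = q 0" by (simp add: Q_def q_def pev_sum pev_monom cm_of_rat)
    hence "pev pf Q + pev pf 0 * Sf = 0" using q0 by simp
    hence "Q = 0" using pev_independent[OF qexps(1) subdegree_PF] by blast
    moreover have "degree (D1 * D2) \<le> d" using deg[of 0] by (simp add: L_def)
    hence "coeff Q (degree (D1 * D2)) = 1" using r(1) by (simp add: Q_def coeff_sum)
    ultimately show False by simp
  qed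
  have qra: "q k \<in> rat_adjoin {pf, Sf}" for k
    unfolding q_def by (intro rat_adjoin_sum rat_adjoin.mult rat_adjoin.rat rat_adjoin_power rat_adjoin.base) auto
  have S: "Sf \<in> rat_adjoin {pf, Sf}" by (intro rat_adjoin.base) auto
  have "f = (q 0 * f) / q 0" using q0 by simp
  hence "f = - (q 1 + q 2 * Sf) / q 0 + Tf * (- (q 3 + q 4 * Sf) / q 0)"
    unfolding eq by (simp only: add_divide_distrib times_divide_eq_right)
  moreover have "- (q 1 + q 2 * Sf) / q 0 \<in> rat_adjoin {pf, Sf}" "- (q 3 + q 4 * Sf) / q 0 \<in> rat_adjoin {pf, Sf}"
    by (intro rat_adjoin_divide rat_adjoin.uminus rat_adjoin.add rat_adjoin.mult qra S)+
  ultimately show ?thesis by blast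
qed

section \<open>The equations\<close>

definition xf :: mero_uhp where "xf = pf + 2"
definition y0f :: mero_uhp where "y0f = Sf / (pf + 3) - pf"
definition yf :: mero_uhp where "yf = y0f - 2 * xf + 3"
definition tf :: mero_uhp where "tf = xf * Tf / (pf - y0f)"

lemma cm_numeral: "cm (numeral n) = numeral n"
  using cm_of_nat[of "numeral n"] by simp

lemma pf_not_const: "pf + cm c \<noteq> 0"
proof
  assume "pf + cm c = 0"
  hence "pev pf [:c, 1:] + pev pf 0 * Sf = 0" by (simp add: pev_pCons add.commute)
  from pev_independent[OF qexps(1) subdegree_PF this] show False by simp
qed

lemma pf3_nonzero: "pf + 3 \<noteq> 0" using pf_not_const[of 3] by (simp add: cm_numeral)
lemma xf_nonzero: "xf \<noteq> 0" using pf_not_const[of 2] by (simp add: cm_numeral xf_def)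

lemma Sf_y0f: "Sf = (y0f + pf) * (pf + 3)"
  using pf3_nonzero by (simp add: y0f_def)

lemma pf_y0f_nonzero: "pf - y0f \<noteq> 0"
proof
  assume "pf - y0f = 0"
  hence "Sf = 2 * pf * (pf + 3)" using Sf_y0f by simp
  hence "pev pf [:0, - 6, - 2:] + pev pf [:1:] * Sf = 0"
    by (simp add: pev_pCons cm_minus cm_numeral algebra_simps)
  from pev_independent[OF qexps(1) subdegree_PF this] show False by simp
qed

text \<open>Substituting \<open>Sf = (y0f + pf) * (pf + 3)\<close> into
  \<open>Sf_pf_relation\<close> lets the factor \<open>(pf + 3) ^ 2\<close> split off.\<close>

lemma y0f_relation: "y0f ^ 2 = pf ^ 3 + 3 * (y0f * pf) + 3 * pf ^ 2 + 9 * pf"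
proof -
  have "Sf ^ 2 - (pf ^ 5 + 5 * (Sf * pf ^ 2) + 5 * pf ^ 4 + 15 * (Sf * pf) + 12 * pf ^ 3 + 45 * pf ^ 2 + 81 * pf) =
     (pf + 3) ^ 2 * (y0f ^ 2 - (pf ^ 3 + 3 * (y0f * pf) + 3 * pf ^ 2 + 9 * pf))"
    unfolding Sf_y0f by algebra
  hence "(pf + 3) ^ 2 * (y0f ^ 2 - (pf ^ 3 + 3 * (y0f * pf) + 3 * pf ^ 2 + 9 * pf)) = 0"
    using Sf_pf_relation by simp
  thus ?thesis using pf3_nonzero by simp
qed

lemma xf_yf_relation: "yf ^ 2 + xf * yf = xf ^ 3 - xf ^ 2 - 5"
proof -
  have "yf ^ 2 + xf * yf - (xf ^ 3 - xf ^ 2 - 5) = y0f ^ 2 - (pf ^ 3 + 3 * (y0f * pf) + 3 * pf ^ 2 + 9 * pf)"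
    unfolding yf_def xf_def by algebra
  thus ?thesis using y0f_relation by simp
qed

lemma tf_relation: "tf ^ 2 = xf ^ 2 * (- 3 + 6 * xf + xf ^ 2 + 4 * yf)"
proof -
  have "Tf ^ 2 = Sf ^ 2 - 4 * pf ^ 3"
    unfolding Sf_def Tf_def hf_kf[symmetric] by algebra
  \<comment> \<open>The last summand is a multiple of the relation for \<open>y0f\<close> and so
    vanishes; including it makes the equation an identity of polynomials.\<close>
  also have "\<dots> = (- 3 + 6 * xf + xf ^ 2 + 4 * yf) * (pf - y0f) ^ 2
      - 4 * y0f * (y0f ^ 2 - (pf ^ 3 + 3 * (y0f * pf) + 3 * pf ^ 2 + 9 * pf))"
    unfolding Sf_y0f yf_def xf_def by algebra
  finally have "Tf ^ 2 = (- 3 + 6 * xf + xf ^ 2 + 4 * yf) * (pf - y0f) ^ 2"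
    using y0f_relation by simp
  thus ?thesis
    using pf_y0f_nonzero by (simp add: tf_def power_divide power_mult_distrib)
qed

lemma w5_numeral: "w5 (numeral n) = numeral n"
  using w5_cm[of "numeral n"] by (simp add: cm_numeral)

lemma w5_xf: "w5 xf = xf" by (simp add: xf_def w5_add w5_pf w5_numeral)
lemma w5_y0f: "w5 y0f = y0f" by (simp add: y0f_def w5_diff w5_divide w5_add w5_pf w5_Sf w5_numeral)
lemma w5_yf: "w5 yf = yf" by (simp add: yf_def w5_add w5_diff w5_mult w5_y0f w5_xf w5_numeral)
lemma w5_tf: "w5 tf = - tf" by (simp add: tf_def w5_mult w5_divide w5_diff w5_pf w5_y0f w5_xf w5_Tf)

lemma tf_nonzero: "tf \<noteq> 0"
  using xf_nonzero Tf_nonzero pf_y0f_nonzero by (simp add: tf_def)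

lemma rat_adjoin_xy: "rat_adjoin {xf, yf} = rat_adjoin {pf, Sf}"
proof
  have p: "pf \<in> rat_adjoin {pf, Sf}" "Sf \<in> rat_adjoin {pf, Sf}" by (auto intro: rat_adjoin.base)
  hence x: "xf \<in> rat_adjoin {pf, Sf}" unfolding xf_def by (intro rat_adjoin.add rat_adjoin_numeral)
  have "y0f \<in> rat_adjoin {pf, Sf}" unfolding y0f_def by (intro rat_adjoin_diff rat_adjoin_divide rat_adjoin.add rat_adjoin_numeral p)
  hence "yf \<in> rat_adjoin {pf, Sf}" unfolding yf_def
    by (intro rat_adjoin_diff rat_adjoin.add rat_adjoin.mult rat_adjoin_numeral x)
  with x show "rat_adjoin {xf, yf} \<subseteq> rat_adjoin {pf, Sf}" by (intro rat_adjoin_subset) auto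
  have x: "xf \<in> rat_adjoin {xf, yf}" "yf \<in> rat_adjoin {xf, yf}" by (auto intro: rat_adjoin.base)
  have "pf = xf - 2" by (simp add: xf_def)
  hence p: "pf \<in> rat_adjoin {xf, yf}" using rat_adjoin_diff[OF x(1) rat_adjoin_numeral[of "num.Bit0 num.One"]] by simp
  have "y0f = yf + 2 * xf - 3" by (simp add: yf_def)
  moreover have "yf + 2 * xf - 3 \<in> rat_adjoin {xf, yf}"
    by (intro rat_adjoin_diff rat_adjoin_numeral rat_adjoin.add rat_adjoin.mult x)
  ultimately have "y0f \<in> rat_adjoin {xf, yf}" by simp
  hence "Sf \<in> rat_adjoin {xf, yf}" unfolding Sf_y0f using p
    by (intro rat_adjoin.mult rat_adjoin.add rat_adjoin_numeral)
  with p show "rat_adjoin {pf, Sf} \<subseteq> rat_adjoin {xf, yf}" by (intro rat_adjoin_subset) auto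
qed

lemma xyt_rat: "xf \<in> X0_functions_rat 45" "yf \<in> X0_functions_rat 45" "tf \<in> X0_functions_rat 45"
proof -
  have sub: "rat_adjoin {pf, Sf} \<subseteq> X0_functions_rat 45"
    by (rule rat_adjoin_subset_X0_rat) (use pf_rat Sf_rat in auto)
  have "xf \<in> rat_adjoin {pf, Sf}" "yf \<in> rat_adjoin {pf, Sf}"
    unfolding rat_adjoin_xy[symmetric] by (auto intro: rat_adjoin.base)
  thus x: "xf \<in> X0_functions_rat 45" and y: "yf \<in> X0_functions_rat 45" using sub by auto
  have "rat_adjoin {xf, yf, Tf} \<subseteq> X0_functions_rat 45"
    by (rule rat_adjoin_subset_X0_rat) (use x y Tf_rat in auto)
  moreover have "tf \<in> rat_adjoin {xf, yf, Tf}"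
  proof -
    have x: "xf \<in> rat_adjoin {xf, yf, Tf}" "yf \<in> rat_adjoin {xf, yf, Tf}" "Tf \<in> rat_adjoin {xf, yf, Tf}"
      by (auto intro: rat_adjoin.base)
    have e: "pf = xf - 2" "y0f = yf + 2 * xf - 3" by (simp_all add: xf_def yf_def)
    show ?thesis unfolding tf_def e
      by (intro rat_adjoin_divide rat_adjoin_diff rat_adjoin_numeral rat_adjoin.add rat_adjoin.mult x)
  qed
  ultimately show "tf \<in> X0_functions_rat 45" by blast
qed

lemma Tf_in_xyt: "Tf \<in> rat_adjoin {xf, yf, tf}"
proof -
  have x: "xf \<in> rat_adjoin {xf, yf, tf}" "yf \<in> rat_adjoin {xf, yf, tf}" "tf \<in> rat_adjoin {xf, yf, tf}"
    by (auto intro: rat_adjoin.base)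
  have e: "pf = xf - 2" "y0f = yf + 2 * xf - 3" by (simp_all add: xf_def yf_def)
  have "Tf = tf * (pf - y0f) / xf"
    using xf_nonzero pf_y0f_nonzero by (simp add: tf_def)
  also have "\<dots> \<in> rat_adjoin {xf, yf, tf}" unfolding e
    by (intro rat_adjoin_divide rat_adjoin_diff rat_adjoin_numeral rat_adjoin.add rat_adjoin.mult x)
  finally show ?thesis .
qed

lemma function_field_eq: "X0_functions_rat 45 = rat_adjoin {xf, yf, tf}"
proof
  show "rat_adjoin {xf, yf, tf} \<subseteq> X0_functions_rat 45"
    by (rule rat_adjoin_subset_X0_rat) (use xyt_rat in auto)
  show "X0_functions_rat 45 \<subseteq> rat_adjoin {xf, yf, tf}"
  proof
    fix f assume "f \<in> X0_functions_rat 45"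
    then obtain u v where "u \<in> rat_adjoin {xf, yf}" "v \<in> rat_adjoin {xf, yf}" "f = u + Tf * v"
      using X0_rat_decomposition unfolding rat_adjoin_xy by blast
    moreover have "rat_adjoin {xf, yf} \<subseteq> rat_adjoin {xf, yf, tf}"
      by (intro rat_adjoin_subset) (auto intro: rat_adjoin.base)
    ultimately show "f \<in> rat_adjoin {xf, yf, tf}"
      using Tf_in_xyt by (auto intro!: rat_adjoin.add rat_adjoin.mult)
  qed
qed

lemma w5_rat_adjoin:
  assumes "f \<in> rat_adjoin S" "\<And>s. s \<in> S \<Longrightarrow> w5 s = s"
  shows "w5 f = f"
  using assms(1)
proof induction
  case (rat r)
  show ?case using w5_cm[of "of_rat r"] by (simp add: cm_of_rat)
qed (simp_all add: assms(2) w5_add w5_mult w5_uminus w5_inverse)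

lemma w5_rat_adjoin_xy: "f \<in> rat_adjoin {xf, yf} \<Longrightarrow> w5 f = f"
  by (rule w5_rat_adjoin) (auto simp: w5_xf w5_yf)

lemma invariant_field_eq: "{f \<in> X0_functions_rat 45. atkin_lehner 45 5 f = f} = rat_adjoin {xf, yf}"
proof safe
  fix f assume f: "f \<in> X0_functions_rat 45" "atkin_lehner 45 5 f = f"
  hence wf: "w5 f = f" using atkin_lehner_w5 by (simp add: X0_rat_iff)
  obtain u v where uv: "u \<in> rat_adjoin {xf, yf}" "v \<in> rat_adjoin {xf, yf}" "f = u + Tf * v"
    using X0_rat_decomposition[OF f(1)] unfolding rat_adjoin_xy by blast
  \<comment> \<open>\<open>w5\<close> fixes \<open>u\<close> and \<open>v\<close> and negates
    \<open>Tf\<close>, so invariance of \<open>f\<close> leaves only \<open>u\<close>.\<close>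
  have "u - Tf * v = u + Tf * v"
    using wf uv by (simp add: w5_add w5_mult w5_Tf w5_rat_adjoin_xy)
  hence "2 * (Tf * v) = 0" by (simp add: algebra_simps)
  hence "f = u" using uv(3) by auto
  thus "f \<in> rat_adjoin {xf, yf}" using uv(1) by simp
next
  fix f assume f: "f \<in> rat_adjoin {xf, yf}"
  have "rat_adjoin {xf, yf} \<subseteq> X0_functions_rat 45"
    by (rule rat_adjoin_subset_X0_rat) (use xyt_rat in auto)
  thus fX: "f \<in> X0_functions_rat 45" using f by blast
  thus "atkin_lehner 45 5 f = f"
    using atkin_lehner_w5 w5_rat_adjoin_xy[OF f] by (simp add: X0_rat_iff)
qed

text \<open>Multiplication by \<open>xf + 1\<close>, which is \<open>pf + 3\<close>, clears the
  denominator in \<open>yf\<close> and reduces the claim to the independence of 1 and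
  \<open>Sf\<close>.\<close>

lemma xf_yf_independent:
  assumes "pev xf A + pev xf B * yf = 0"
  shows "A = 0 \<and> B = 0"
proof -
  have qx: "has_q_expansion 1 xf (PF + 2)"
    unfolding xf_def by (intro has_q_expansion_add qexps has_q_expansion_numeral) simp
  have "fls_subdegree (PF + 2) = - 2"
  proof -
    have "PF \<noteq> 0" using subdegree_PF by auto
    thus ?thesis using fls_subdegree_add_eq1[of PF 2] subdegree_PF by simp
  qed
  note ind = pev_independent[OF qx this]
  have "yf * (xf + 1) = Sf + (xf + 1) * (5 - 3 * xf)"
    unfolding Sf_y0f by (simp add: yf_def xf_def algebra_simps)
  moreover have "(pev xf A + pev xf B * yf) * (xf + 1) = pev xf A * (xf + 1) + pev xf B * (yf * (xf + 1))"
    by (simp add: algebra_simps)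
  ultimately have "pev xf A * (xf + 1) + pev xf B * (Sf + (xf + 1) * (5 - 3 * xf)) = 0"
    using assms by simp
  moreover have "pev xf [:1, 1:] = xf + 1" "pev xf [:5, - 3:] = 5 - 3 * xf"
    by (simp_all add: pev_pCons cm_minus cm_numeral)
  ultimately have "pev xf (A * [:1, 1:] + B * ([:1, 1:] * [:5, - 3:])) + pev xf B * Sf = 0"
    by (simp only: pev_add pev_mult) (simp add: algebra_simps)
  note AB = ind[OF this]
  hence "A * [:1, 1:] + 0 * ([:1, 1:] * [:5, - 3:]) = 0" by blast
  hence "A * [:1, 1:] = 0" by (simp only: mult_zero_left add_0_right)
  hence "A = 0 \<or> [:1, 1:] = (0 :: complex poly)" by (simp only: mult_eq_0_iff)
  thus ?thesis using AB by simp
qed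

section \<open>Evaluation homomorphisms and the affine model\<close>

definition ring_hom :: "('a :: comm_ring_1 \<Rightarrow> 'b :: comm_ring_1) \<Rightarrow> bool" where
  "ring_hom \<phi> \<longleftrightarrow> \<phi> 0 = 0 \<and> \<phi> 1 = 1 \<and> (\<forall>a b. \<phi> (a + b) = \<phi> a + \<phi> b) \<and> (\<forall>a b. \<phi> (a * b) = \<phi> a * \<phi> b)"

text \<open>One step of evaluation; \<open>eval_poly3\<close> is its threefold iteration.\<close>

definition heval :: "('a :: comm_ring_1 \<Rightarrow> 'b :: comm_ring_1) \<Rightarrow> 'b \<Rightarrow> 'a poly \<Rightarrow> 'b" where
  "heval \<phi> x p = poly (map_poly \<phi> p) x"

lemma heval_0 [simp]: "heval \<phi> x 0 = 0"
  by (simp add: heval_def)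

lemma heval_pCons: "\<phi> 0 = 0 \<Longrightarrow> heval \<phi> x (pCons a p) = \<phi> a + x * heval \<phi> x p"
  by (simp add: heval_def map_poly_pCons)

lemma ring_hom_heval:
  assumes "ring_hom \<phi>"
  shows "ring_hom (heval \<phi> x)"
proof -
  have phi: "\<phi> 0 = 0" "\<phi> 1 = 1" "\<And>a b. \<phi> (a + b) = \<phi> a + \<phi> b" "\<And>a b. \<phi> (a * b) = \<phi> a * \<phi> b"
    using assms by (auto simp: ring_hom_def)
  have add: "heval \<phi> x (p + q) = heval \<phi> x p + heval \<phi> x q" for p q
    by (induction p q rule: poly_induct2) (simp_all add: heval_pCons phi algebra_simps)
  have smult: "heval \<phi> x (smult c p) = \<phi> c * heval \<phi> x p" for c p
    by (induction p) (simp_all add: heval_pCons phi algebra_simps)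
  have "heval \<phi> x (p * q) = heval \<phi> x p * heval \<phi> x q" for p q
    by (induction p) (simp_all add: heval_pCons phi add smult algebra_simps)
  moreover have "heval \<phi> x 1 = 1" by (simp add: one_pCons heval_pCons phi)
  ultimately show ?thesis using add by (simp add: ring_hom_def)
qed

lemma ring_hom_simps:
  assumes "ring_hom \<phi>"
  shows "\<phi> 0 = 0" "\<phi> 1 = 1" "\<phi> (a + b) = \<phi> a + \<phi> b" "\<phi> (a * b) = \<phi> a * \<phi> b"
    "\<phi> (- a) = - \<phi> a" "\<phi> (a - b) = \<phi> a - \<phi> b" "\<phi> (a ^ n) = \<phi> a ^ n" "\<phi> (numeral k) = numeral k"
proof -
  show 1: "\<phi> 0 = 0" "\<phi> 1 = 1" "\<And>a b. \<phi> (a + b) = \<phi> a + \<phi> b" "\<And>a b. \<phi> (a * b) = \<phi> a * \<phi> b"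
    using assms by (auto simp: ring_hom_def)
  show um: "\<phi> (- a) = - \<phi> a" for a
    using 1(3)[of a "- a"] 1(1) by (simp add: eq_neg_iff_add_eq_0 add.commute)
  show "\<phi> (a - b) = \<phi> a - \<phi> b" using 1(3)[of a "- b"] um by simp
  show "\<phi> (a ^ n) = \<phi> a ^ n" by (induction n) (simp_all add: 1)
  have "\<phi> (of_nat m) = of_nat m" for m by (induction m) (simp_all add: 1)
  from this[of "numeral k"] show "\<phi> (numeral k) = numeral k" by simp
qed

lemma ring_hom_of_rat: "ring_hom (of_rat :: rat \<Rightarrow> 'a :: field_char_0)"
  by (simp add: ring_hom_def of_rat_add of_rat_mult)

text \<open>The divisor is monic, so division works over any commutative ring; it is applied over
  \<open>\<rat>[X]\<close> and over \<open>\<rat>[X][Y]\<close>.\<close>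

lemma quadratic_division:
  fixes P :: "'a :: comm_ring_1 poly"
  shows "\<exists>V r0 r1. P = V * [:c0, c1, 1:] + [:r0, r1:]"
proof (induction P)
  case 0
  show ?case by (intro exI[of _ 0]) simp
next
  case (pCons a P)
  then obtain V r0 r1 where "P = V * [:c0, c1, 1:] + [:r0, r1:]" by blast
  hence "pCons a P = pCons 0 V * [:c0, c1, 1:] + [:a, r0, r1:]" by simp
  also have "[:a, r0, r1:] = [:r1:] * [:c0, c1, 1:] + [:a - r1 * c0, r0 - r1 * c1:]" by simp
  finally have "pCons a P = (pCons 0 V + [:r1:]) * [:c0, c1, 1:] + [:a - r1 * c0, r0 - r1 * c1:]"
    by (simp only: distrib_right add.assoc)
  thus ?case by blast
qed

lemma eval_poly3_heval: "eval_poly3 P x y t = heval (heval (heval of_rat x) y) t P"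
  by (simp add: eval_poly3_def heval_def[abs_def])

lemma heval_of_rat: "heval of_rat xf a = pev xf (map_poly of_rat a)"
  by (induction a) (simp_all add: heval_pCons map_poly_pCons pev_pCons cm_of_rat)

text \<open>Division by the second equation in \<open>T\<close> and by the first in \<open>Y\<close>
  reduces \<open>P\<close> to \<open>a0 + b0 Y + (a1 + b1 Y) T\<close> with coefficients in
  \<open>\<rat>[X]\<close>. If this remainder vanishes at \<open>(xf, yf, tf)\<close>, then
  \<open>w5\<close> separates the part with \<open>T\<close>, and independence of 1 and
  \<open>yf\<close> annihilates all four coefficients.\<close>

theorem birational_xyt:
  "birational_equations (X0_functions_rat 45) (xf, yf, tf)
      (polyY ^ 2 + polyX * polyY - (polyX ^ 3 - polyX ^ 2 - 5))
      (polyT ^ 2 - polyX ^ 2 * (- 3 + 6 * polyX + polyX ^ 2 + 4 * polyY))"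
  unfolding birational_equations_def case_prod_conv
proof (intro conjI allI iffI)
  let ?F = "polyY ^ 2 + polyX * polyY - (polyX ^ 3 - polyX ^ 2 - 5)"
  let ?G = "polyT ^ 2 - polyX ^ 2 * (- 3 + 6 * polyX + polyX ^ 2 + 4 * polyY)"
  show "X0_functions_rat 45 = rat_adjoin {xf, yf, tf}" by (rule function_field_eq)
  define ex where "ex = heval of_rat xf"
  define ey where "ey = heval ex yf"
  define et where "et = heval ey tf"
  have hx: "ring_hom ex" unfolding ex_def by (intro ring_hom_heval ring_hom_of_rat)
  have hy: "ring_hom ey" unfolding ey_def by (intro ring_hom_heval hx)
  have ht: "ring_hom et" unfolding et_def by (intro ring_hom_heval hy)
  have ev: "eval_poly3 P xf yf tf = et P" for P
    by (simp add: eval_poly3_heval et_def ey_def ex_def)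
  have z: "ex 0 = 0" "ey 0 = 0" "et 0 = 0" using hx hy ht by (auto simp: ring_hom_def)
  have o: "ex 1 = 1" "ey 1 = 1" using hx hy by (auto simp: ring_hom_def)
  have exC: "ex (pCons a p) = of_rat a + xf * ex p" for a p unfolding ex_def by (simp add: heval_pCons)
  have eyC: "ey (pCons a p) = ex a + yf * ey p" for a p unfolding ey_def by (simp add: heval_pCons z)
  have etC: "et (pCons a p) = ey a + tf * et p" for a p unfolding et_def by (simp add: heval_pCons z)
  have XYT: "et polyX = xf" "et polyY = yf" "et polyT = tf"
    by (simp_all add: polyX_def polyY_def polyT_def etC eyC exC z o)
  have F0: "et ?F = 0"
    using xf_yf_relation by (simp add: ring_hom_simps[OF ht] XYT)
  have G0: "et ?G = 0"
    using tf_relation by (simp add: ring_hom_simps[OF ht] XYT)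
  fix P :: rat_poly3
  show "eval_poly3 P xf yf tf = 0" if ex: "\<exists>U V. P = U * ?F + V * ?G"
  proof -
    obtain U V where P: "P = U * ?F + V * ?G" using ex by blast
    have "et P = et U * et ?F + et V * et ?G"
      unfolding P by (simp only: ring_hom_simps(3,4)[OF ht])
    thus ?thesis unfolding ev F0 G0 by simp
  qed
  show "\<exists>U V. P = U * ?F + V * ?G" if P0: "eval_poly3 P xf yf tf = 0"
  proof -
    define X :: "rat poly" where "X = [:0, 1:]"
    define F1 :: "rat poly poly" where "F1 = [:- (X ^ 3 - X ^ 2 - 5), X, 1:]"
    define g :: "rat poly poly" where "g = [:X:] ^ 2 * (- 3 + 6 * [:X:] + [:X:] ^ 2 + 4 * [:0, 1:])"
    have c1: "[:a:] * [:b:] = [:a * b:]" for a b :: "'c :: comm_ring_1" by simp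
    have cn: "(numeral n :: 'c :: comm_ring_1 poly) = [:numeral n:]" for n by (rule numeral_poly)
    have cp: "[:a:] ^ n = [:a ^ n:]" for a :: "'c :: comm_ring_1" and n
      by (induction n) (simp_all add: one_pCons)
    \<comment> \<open>The first equation is constant in \<open>T\<close>, so division by it acts
      separately on the two coefficients \<open>r0\<close> and \<open>r1\<close>.\<close>
    have F: "?F = [:F1:]"
      unfolding polyX_def polyY_def F1_def X_def[symmetric] cp cn
      by (simp add: power2_eq_square)
    have G: "?G = [:- g, 0, 1:]"
    proof -
      have "polyX ^ 2 * (- 3 + 6 * polyX + polyX ^ 2 + 4 * polyY) = [:g:]"
        unfolding polyX_def polyY_def g_def X_def[symmetric] cp cn by simp
      thus ?thesis by (simp add: polyT_def power2_eq_square)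
    qed
    obtain V r0 r1 where P: "P = V * [:- g, 0, 1:] + [:r0, r1:]"
      using quadratic_division[of P "- g" 0] by blast
    obtain V0 a0 b0 where r0: "r0 = V0 * F1 + [:a0, b0:]"
      using quadratic_division[of r0] unfolding F1_def by blast
    obtain V1 a1 b1 where r1: "r1 = V1 * F1 + [:a1, b1:]"
      using quadratic_division[of r1] unfolding F1_def by blast
    have P': "P = [:V0, V1:] * ?F + V * ?G + [:[:a0, b0:], [:a1, b1:]:]"
      unfolding F G P r0 r1 by simp
    have "et P = et [:V0, V1:] * et ?F + et V * et ?G + et [:[:a0, b0:], [:a1, b1:]:]"
      unfolding P' by (simp only: ring_hom_simps(3,4)[OF ht])
    hence rem: "(ex a0 + yf * ex b0) + tf * (ex a1 + yf * ex b1) = 0"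
      using P0 unfolding ev F0 G0 by (simp add: etC eyC z)
    have wex: "w5 (ex a) = ex a" for a
      unfolding ex_def heval_of_rat by (simp add: w5_pev w5_xf)
    have "w5 ((ex a0 + yf * ex b0) + tf * (ex a1 + yf * ex b1)) = 0"
      unfolding rem using w5_cm[of 0] by simp
    hence rem': "(ex a0 + yf * ex b0) - tf * (ex a1 + yf * ex b1) = 0"
      by (simp add: w5_add w5_mult w5_yf w5_tf wex)
    have "2 * (ex a0 + yf * ex b0) = 0" using rem rem' by algebra
    hence 1: "ex a0 + yf * ex b0 = 0" by (simp only: mult_eq_0_iff zero_neq_numeral[symmetric] simp_thms)
    hence 2: "ex a1 + yf * ex b1 = 0" using rem tf_nonzero by simp
    have inj: "a = 0 \<and> b = 0" if "ex a + yf * ex b = 0" for a b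
    proof -
      have "pev xf (map_poly of_rat a) + pev xf (map_poly of_rat b) * yf = 0"
        using that by (simp add: ex_def heval_of_rat mult.commute)
      from xf_yf_independent[OF this] show ?thesis by (simp add: map_poly_eq_0_iff)
    qed
    show ?thesis
      using P' inj[OF 1] inj[OF 2] by (intro exI[of _ "[:V0, V1:]"] exI[of _ V]) simp
  qed
qed

theorem mainTheorem5:
  shows "\<exists>x y t. x \<in> X0_functions_rat 45 \<and> y \<in> X0_functions_rat 45 \<and> t \<in> X0_functions_rat 45 \<and>
    X0_functions_rat 45 = rat_adjoin {x, y, t} \<and>
    {f \<in> X0_functions_rat 45. atkin_lehner 45 5 f = f} = rat_adjoin {x, y} \<and>
    atkin_lehner 45 5 t = - t \<and>
    y ^ 2 + x * y = x ^ 3 - x ^ 2 - 5 \<and>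
    t ^ 2 = x ^ 2 * (- 3 + 6 * x + x ^ 2 + 4 * y) \<and>
    birational_equations (X0_functions_rat 45) (x, y, t)
      (polyY ^ 2 + polyX * polyY - (polyX ^ 3 - polyX ^ 2 - 5))
      (polyT ^ 2 - polyX ^ 2 * (- 3 + 6 * polyX + polyX ^ 2 + 4 * polyY))"
proof (rule exI[of _ xf], rule exI[of _ yf], rule exI[of _ tf], intro conjI)
  show "atkin_lehner 45 5 tf = - tf"
    using atkin_lehner_w5 xyt_rat(3) w5_tf by (simp add: X0_rat_iff)
qed (fact xyt_rat function_field_eq invariant_field_eq xf_yf_relation tf_relation birational_xyt)+

end
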